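(* Let $H$ be a Hopf algebra over a field $k$ and let $\mathcal F\in H\otimes H$ be a $2$-cocycle. If $C=A\cdot B$ is an algebra factorisation in the category of $H$-modules, then $C_{\mathcal F}$ is an algebra factorisation $C_{\mathcal F}=A_{\mathcal F}\cdot B_{\mathcal F}$ in the category of $H^{\mathcal F}$-modules, and $$\Psi_{C_{\mathcal F}}=(\mathcal F\rhd)\circ\Psi_C\circ(\mathcal F^{-1}\rhd)$$ as maps $B\otimes A\to A\otimes B$.
   Context: All tensor products are over $k$; algebras are associative and unital. $H$ has coproduct $\triangle$, counit $\epsilon$ and antipode $S$. A $2$-cocycle on $H$ is an invertible $\mathcal F\in H\otimes H$ such that $(\mathcal F\otimes1)\cdot(\triangle\otimes\mathrm{id})(\mathcal F)=(1\otimes\mathcal F)\cdot(\mathrm{id}\otimes\triangle)(\mathcal F)$ and $(\epsilon\otimes\mathrm{id})(\mathcal F)=1=(\mathrm{id}\otimes\epsilon)(\mathcal F)$. $H^{\mathcal F}$ is the Hopf algebra with the same algebra structure and counit as $H$, coproduct $\triangle_{\mathcal F}(h)=\mathcal F\,\triangle(h)\,\mathcal F^{-1}$, and antipode $S_{\mathcal F}(h)=U S(h)U^{-1}$, where $U=\mathcal F_1S(\mathcal F_2)$ for $\mathcal F=\mathcal F_1\otimes\mathcal F_2$ (summation understood). If $(A,m)$ is an $H$-module algebra, its (Drinfeld) cocycle twist $A_{\mathcal F}$ is the $H^{\mathcal F}$-module algebra with the same underlying $H$-module and product $m_{\mathcal F}=m\circ(\mathcal F^{-1}\rhd)$, where $\mathcal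 F^{-1}\rhd$ denotes the action of $\mathcal F^{-1}\in H\otimes H$ on $A\otimes A$ (and likewise on a tensor product of two $H$-modules). An algebra factorisation $C=A\cdot B$ is a pair of subalgebras $A,B$ of an algebra $C$, with product $m$, such that $m|_{A\otimes B}\colon A\otimes B\to C$ is a $k$-linear isomorphism. The associated map $\Psi_C\colon B\otimes A\to A\otimes B$ is $\Psi_C=(m|_{A\otimes B})^{-1}\circ m|_{B\otimes A}$. It is an algebra factorisation in the category of $H$-modules if $C$ is an $H$-module algebra and $A,B$ are $H$-module subalgebras. *)

theory Defs
  imports "HOL-Algebra.Module" "HOL-Algebra.AbelCoset"
begin

section \<open>Tensor products of vector spaces\<close>

text \<open>
  A vector space over a field \<open>K\<close> is a \<open>module K V\<close> in the sense of HOL-Algebra.  As a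
  \<open>module\<close> record also has the fields \<open>mult\<close> and \<open>one\<close>, the same records serve for algebras; where
  only the vector space matters, these two fields are \<open>undefined\<close> or ignored.
\<close>

definition linear_map ::
  "('k, 'm) ring_scheme \<Rightarrow> ('k, 'v, 'n) module_scheme \<Rightarrow> ('k, 'w, 'p) module_scheme
    \<Rightarrow> ('v \<Rightarrow> 'w) \<Rightarrow> bool" where
  "linear_map K V W f \<longleftrightarrow>
     f \<in> carrier V \<rightarrow> carrier W \<and>
     (\<forall>x\<in>carrier V. \<forall>y\<in>carrier V. f (x \<oplus>\<^bsub>V\<^esub> y) = f x \<oplus>\<^bsub>W\<^esub> f y) \<and>
     (\<forall>c\<in>carrier K. \<forall>x\<in>carrier V. f (c \<odot>\<^bsub>V\<^esub> x) = c \<odot>\<^bsub>W\<^esub> f x)"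

definition free_module :: "('k, 'm) ring_scheme \<Rightarrow> 'x set \<Rightarrow> ('k, 'x \<Rightarrow> 'k) module" where
  "free_module K X =
     \<lparr> carrier = {f. f \<in> X \<rightarrow> carrier K \<and> (\<forall>x. x \<notin> X \<longrightarrow> f x = \<zero>\<^bsub>K\<^esub>) \<and> finite {x. f x \<noteq> \<zero>\<^bsub>K\<^esub>}},
       mult = undefined, one = undefined,
       zero = (\<lambda>x. \<zero>\<^bsub>K\<^esub>), add = (\<lambda>f g x. f x \<oplus>\<^bsub>K\<^esub> g x),
       smult = (\<lambda>c f x. c \<otimes>\<^bsub>K\<^esub> f x) \<rparr>"

definition free_gen :: "('k, 'm) ring_scheme \<Rightarrow> 'x \<Rightarrow> 'x \<Rightarrow> 'k" where
  "free_gen K x = (\<lambda>y. if y = x then \<one>\<^bsub>K\<^esub> else \<zero>\<^bsub>K\<^esub>)"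

definition quotient_module :: "('k, 'v, 'n) module_scheme \<Rightarrow> 'v set \<Rightarrow> ('k, 'v set) module" where
  "quotient_module V N =
     \<lparr> carrier = a_rcosets\<^bsub>V\<^esub> N, mult = undefined, one = undefined,
       zero = N, add = set_add V,
       smult = (\<lambda>c X. \<Union>x\<in>X. N +>\<^bsub>V\<^esub> (c \<odot>\<^bsub>V\<^esub> x)) \<rparr>"

definition generated_submodule ::
  "('k, 'm) ring_scheme \<Rightarrow> ('k, 'v) module \<Rightarrow> 'v set \<Rightarrow> 'v set" where
  "generated_submodule K V R = \<Inter>{N. submodule N K V \<and> R \<subseteq> N}"

definition tensor_free ::
  "('k, 'm) ring_scheme \<Rightarrow> ('k, 'v, 'n) module_scheme \<Rightarrow> ('k, 'w, 'p) module_scheme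
    \<Rightarrow> ('k, 'v \<times> 'w \<Rightarrow> 'k) module" where
  "tensor_free K V W = free_module K (carrier V \<times> carrier W)"

definition tensor_relations ::
  "('k, 'm) ring_scheme \<Rightarrow> ('k, 'v, 'n) module_scheme \<Rightarrow> ('k, 'w, 'p) module_scheme
    \<Rightarrow> ('v \<times> 'w \<Rightarrow> 'k) set" where
  "tensor_relations K V W =
     (let L = tensor_free K V W; e = (\<lambda>v w. free_gen K (v, w)) in
       {e (v \<oplus>\<^bsub>V\<^esub> v') w \<ominus>\<^bsub>L\<^esub> (e v w \<oplus>\<^bsub>L\<^esub> e v' w) | v v' w.
          v \<in> carrier V \<and> v' \<in> carrier V \<and> w \<in> carrier W} \<union>
       {e v (w \<oplus>\<^bsub>W\<^esub> w') \<ominus>\<^bsub>L\<^esub> (e v w \<oplus>\<^bsub>L\<^esub> e v w') | v w w'.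
          v \<in> carrier V \<and> w \<in> carrier W \<and> w' \<in> carrier W} \<union>
       {e (c \<odot>\<^bsub>V\<^esub> v) w \<ominus>\<^bsub>L\<^esub> c \<odot>\<^bsub>L\<^esub> e v w | c v w.
          c \<in> carrier K \<and> v \<in> carrier V \<and> w \<in> carrier W} \<union>
       {e v (c \<odot>\<^bsub>W\<^esub> w) \<ominus>\<^bsub>L\<^esub> c \<odot>\<^bsub>L\<^esub> e v w | c v w.
          c \<in> carrier K \<and> v \<in> carrier V \<and> w \<in> carrier W})"

definition tensor_null ::
  "('k, 'm) ring_scheme \<Rightarrow> ('k, 'v, 'n) module_scheme \<Rightarrow> ('k, 'w, 'p) module_scheme
    \<Rightarrow> ('v \<times> 'w \<Rightarrow> 'k) set" where
  "tensor_null K V W = generated_submodule K (tensor_free K V W) (tensor_relations K V W)"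

type_synonym ('k, 'v, 'w) tensor = "('v \<times> 'w \<Rightarrow> 'k) set"

definition tensor ::
  "('k, 'm) ring_scheme \<Rightarrow> ('k, 'v, 'n) module_scheme \<Rightarrow> ('k, 'w, 'p) module_scheme
    \<Rightarrow> ('k, ('k, 'v, 'w) tensor) module" where
  "tensor K V W = quotient_module (tensor_free K V W) (tensor_null K V W)"

definition pure_tensor ::
  "('k, 'm) ring_scheme \<Rightarrow> ('k, 'v, 'n) module_scheme \<Rightarrow> ('k, 'w, 'p) module_scheme
    \<Rightarrow> 'v \<Rightarrow> 'w \<Rightarrow> ('k, 'v, 'w) tensor" where
  "pure_tensor K V W v w = tensor_null K V W +>\<^bsub>tensor_free K V W\<^esub> free_gen K (v, w)"

text \<open>
  \<open>tensor_lift K V W U \<phi>\<close> is the linear map \<open>V \<otimes> W \<rightarrow> U\<close> with \<open>v \<otimes> w \<mapsto> \<phi> v w\<close>.  It is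
  meaningful only for bilinear \<open>\<phi>\<close>, when the value does not depend on the representative \<open>f\<close>.
\<close>

definition tensor_lift ::
  "('k, 'm) ring_scheme \<Rightarrow> ('k, 'v, 'n) module_scheme \<Rightarrow> ('k, 'w, 'p) module_scheme
    \<Rightarrow> ('k, 'u, 'q) module_scheme \<Rightarrow> ('v \<Rightarrow> 'w \<Rightarrow> 'u) \<Rightarrow> ('k, 'v, 'w) tensor \<Rightarrow> 'u" where
  "tensor_lift K V W U \<phi> t =
     (THE u. \<exists>f\<in>t. u = finsum U (\<lambda>p. f p \<odot>\<^bsub>U\<^esub> \<phi> (fst p) (snd p)) {p. f p \<noteq> \<zero>\<^bsub>K\<^esub>})"

definition tensor_map ::
  "('k, 'm) ring_scheme \<Rightarrow> ('k, 'v, 'n) module_scheme \<Rightarrow> ('k, 'w, 'p) module_scheme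
    \<Rightarrow> ('k, 'v1, 'n1) module_scheme \<Rightarrow> ('k, 'w1, 'p1) module_scheme
    \<Rightarrow> ('v \<Rightarrow> 'v1) \<Rightarrow> ('w \<Rightarrow> 'w1) \<Rightarrow> ('k, 'v, 'w) tensor \<Rightarrow> ('k, 'v1, 'w1) tensor" where
  "tensor_map K V W V1 W1 f g =
     tensor_lift K V W (tensor K V1 W1) (\<lambda>v w. pure_tensor K V1 W1 (f v) (g w))"

text \<open>The canonical associativity isomorphism \<open>(U \<otimes> V) \<otimes> W \<rightarrow> U \<otimes> (V \<otimes> W)\<close>.\<close>

definition tensor_assoc ::
  "('k, 'm) ring_scheme \<Rightarrow> ('k, 'u, 'q) module_scheme \<Rightarrow> ('k, 'v, 'n) module_scheme
    \<Rightarrow> ('k, 'w, 'p) module_scheme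
    \<Rightarrow> ('k, ('k, 'u, 'v) tensor, 'w) tensor \<Rightarrow> ('k, 'u, ('k, 'v, 'w) tensor) tensor" where
  "tensor_assoc K U V W =
     (let T = tensor K U (tensor K V W) in
       tensor_lift K (tensor K U V) W T
         (\<lambda>x w. tensor_lift K U V T
           (\<lambda>u v. pure_tensor K U (tensor K V W) u (pure_tensor K V W v w)) x))"

section \<open>Algebras and Hopf algebras\<close>

text \<open>The locale \<open>algebra\<close> of HOL-Algebra is restricted to commutative algebras.\<close>

locale assoc_algebra = field K + module K A + ring A for K (structure) and A (structure) +
  assumes smult_mult_left:
      "\<lbrakk>c \<in> carrier K; x \<in> carrier A; y \<in> carrier A\<rbrakk>
        \<Longrightarrow> (c \<odot>\<^bsub>A\<^esub> x) \<otimes>\<^bsub>A\<^esub> y = c \<odot>\<^bsub>A\<^esub> (x \<otimes>\<^bsub>A\<^esub> y)"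
    and smult_mult_right:
      "\<lbrakk>c \<in> carrier K; x \<in> carrier A; y \<in> carrier A\<rbrakk>
        \<Longrightarrow> x \<otimes>\<^bsub>A\<^esub> (c \<odot>\<^bsub>A\<^esub> y) = c \<odot>\<^bsub>A\<^esub> (x \<otimes>\<^bsub>A\<^esub> y)"

text \<open>A subalgebra is given as an algebra record of its own, so that it can itself be twisted.\<close>

definition is_subalgebra ::
  "('k, 'm) ring_scheme \<Rightarrow> ('k, 'c, 'n) module_scheme \<Rightarrow> ('k, 'c, 'p) module_scheme \<Rightarrow> bool" where
  "is_subalgebra K A C \<longleftrightarrow>
     assoc_algebra K A \<and> assoc_algebra K C \<and> carrier A \<subseteq> carrier C \<and>
     \<one>\<^bsub>A\<^esub> = \<one>\<^bsub>C\<^esub> \<and> \<zero>\<^bsub>A\<^esub> = \<zero>\<^bsub>C\<^esub> \<and>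
     (\<forall>x\<in>carrier A. \<forall>y\<in>carrier A. x \<otimes>\<^bsub>A\<^esub> y = x \<otimes>\<^bsub>C\<^esub> y \<and> x \<oplus>\<^bsub>A\<^esub> y = x \<oplus>\<^bsub>C\<^esub> y) \<and>
     (\<forall>c\<in>carrier K. \<forall>x\<in>carrier A. c \<odot>\<^bsub>A\<^esub> x = c \<odot>\<^bsub>C\<^esub> x)"

definition tensor_algebra ::
  "('k, 'm) ring_scheme \<Rightarrow> ('k, 'a, 'n) module_scheme \<Rightarrow> ('k, 'b, 'p) module_scheme
    \<Rightarrow> ('k, ('k, 'a, 'b) tensor) module" where
  "tensor_algebra K A B =
     (let T = tensor K A B in
       T\<lparr> mult := (\<lambda>x y. tensor_lift K A B T (\<lambda>a b. tensor_lift K A B T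
              (\<lambda>a' b'. pure_tensor K A B (a \<otimes>\<^bsub>A\<^esub> a') (b \<otimes>\<^bsub>B\<^esub> b')) y) x),
          one := pure_tensor K A B \<one>\<^bsub>A\<^esub> \<one>\<^bsub>B\<^esub> \<rparr>)"

record ('k, 'h) hopf = "('k, 'h) module" +
  comult :: "'h \<Rightarrow> ('k, 'h, 'h) tensor"
  counit :: "'h \<Rightarrow> 'k"
  antipode :: "'h \<Rightarrow> 'h"

text \<open>The maps \<open>\<epsilon> \<otimes> id\<close> and \<open>id \<otimes> \<epsilon>\<close>, with \<open>K \<otimes> H\<close> and \<open>H \<otimes> K\<close> identified with \<open>H\<close>.\<close>

definition counit_left :: "('k, 'm) ring_scheme \<Rightarrow> ('k, 'h) hopf \<Rightarrow> ('k, 'h, 'h) tensor \<Rightarrow> 'h" where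
  "counit_left K H = tensor_lift K H H H (\<lambda>g h. counit H g \<odot>\<^bsub>H\<^esub> h)"

definition counit_right :: "('k, 'm) ring_scheme \<Rightarrow> ('k, 'h) hopf \<Rightarrow> ('k, 'h, 'h) tensor \<Rightarrow> 'h" where
  "counit_right K H = tensor_lift K H H H (\<lambda>g h. counit H h \<odot>\<^bsub>H\<^esub> g)"

text \<open>The maps \<open>\<Delta> \<otimes> id : H \<otimes> H \<rightarrow> (H \<otimes> H) \<otimes> H\<close> and \<open>id \<otimes> \<Delta> : H \<otimes> H \<rightarrow> H \<otimes> (H \<otimes> H)\<close>.\<close>

definition comult_left ::
  "('k, 'm) ring_scheme \<Rightarrow> ('k, 'h) hopf \<Rightarrow> ('k, 'h, 'h) tensor
    \<Rightarrow> ('k, ('k, 'h, 'h) tensor, 'h) tensor" where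
  "comult_left K H = tensor_map K H H (tensor K H H) H (comult H) (\<lambda>h. h)"

definition comult_right ::
  "('k, 'm) ring_scheme \<Rightarrow> ('k, 'h) hopf \<Rightarrow> ('k, 'h, 'h) tensor
    \<Rightarrow> ('k, 'h, ('k, 'h, 'h) tensor) tensor" where
  "comult_right K H = tensor_map K H H H (tensor K H H) (\<lambda>h. h) (comult H)"

locale hopf_algebra = assoc_algebra K H for K (structure) and H :: "('k, 'h) hopf" (structure) +
  assumes comult_linear: "linear_map K H (tensor K H H) (comult H)"
    and comult_hom: "comult H \<in> ring_hom H (tensor_algebra K H H)"
    and counit_hom: "counit H \<in> ring_hom H K"
    and counit_smult:
      "\<lbrakk>c \<in> carrier K; h \<in> carrier H\<rbrakk> \<Longrightarrow> counit H (c \<odot>\<^bsub>H\<^esub> h) = c \<otimes>\<^bsub>K\<^esub> counit H h"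
    and coassoc:
      "h \<in> carrier H
        \<Longrightarrow> tensor_assoc K H H H (comult_left K H (comult H h)) = comult_right K H (comult H h)"
    and counit_left: "h \<in> carrier H \<Longrightarrow> counit_left K H (comult H h) = h"
    and counit_right: "h \<in> carrier H \<Longrightarrow> counit_right K H (comult H h) = h"
    and antipode_linear: "linear_map K H H (antipode H)"
    and antipode_left:
      "h \<in> carrier H \<Longrightarrow>
        tensor_lift K H H H (\<lambda>x y. antipode H x \<otimes>\<^bsub>H\<^esub> y) (comult H h) = counit H h \<odot>\<^bsub>H\<^esub> \<one>\<^bsub>H\<^esub>"
    and antipode_right:
      "h \<in> carrier H \<Longrightarrow>
        tensor_lift K H H H (\<lambda>x y. x \<otimes>\<^bsub>H\<^esub> antipode H y) (comult H h) = counit H h \<odot>\<^bsub>H\<^esub> \<one>\<^bsub>H\<^esub>"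

section \<open>Cocycles and twists\<close>

definition two_cocycle :: "('k, 'm) ring_scheme \<Rightarrow> ('k, 'h) hopf \<Rightarrow> ('k, 'h, 'h) tensor \<Rightarrow> bool" where
  "two_cocycle K H F \<longleftrightarrow>
     (let HH = tensor_algebra K H H in
       F \<in> Units HH \<and>
       tensor_assoc K H H H
         (pure_tensor K HH H F \<one>\<^bsub>H\<^esub> \<otimes>\<^bsub>tensor_algebra K HH H\<^esub> comult_left K H F)
         = pure_tensor K H HH \<one>\<^bsub>H\<^esub> F \<otimes>\<^bsub>tensor_algebra K H HH\<^esub> comult_right K H F \<and>
       counit_left K H F = \<one>\<^bsub>H\<^esub> \<and> counit_right K H F = \<one>\<^bsub>H\<^esub>)"

definition twist_unit :: "('k, 'm) ring_scheme \<Rightarrow> ('k, 'h) hopf \<Rightarrow> ('k, 'h, 'h) tensor \<Rightarrow> 'h" where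
  "twist_unit K H F = tensor_lift K H H H (\<lambda>f g. f \<otimes>\<^bsub>H\<^esub> antipode H g) F"

definition hopf_twist ::
  "('k, 'm) ring_scheme \<Rightarrow> ('k, 'h) hopf \<Rightarrow> ('k, 'h, 'h) tensor \<Rightarrow> ('k, 'h) hopf" where
  "hopf_twist K H F =
     (let HH = tensor_algebra K H H; U = twist_unit K H F in
       H\<lparr> comult := (\<lambda>h. F \<otimes>\<^bsub>HH\<^esub> comult H h \<otimes>\<^bsub>HH\<^esub> inv\<^bsub>HH\<^esub> F),
          antipode := (\<lambda>h. U \<otimes>\<^bsub>H\<^esub> antipode H h \<otimes>\<^bsub>H\<^esub> inv\<^bsub>H\<^esub> U) \<rparr>)"

record ('k, 'v, 'h) hopf_module = "('k, 'v) module" +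
  act :: "'h \<Rightarrow> 'v \<Rightarrow> 'v"

text \<open>The action of an element of \<open>H \<otimes> H\<close> on \<open>V \<otimes> W\<close>, for \<open>H\<close>-modules \<open>V\<close> and \<open>W\<close>.\<close>

definition tensor_act ::
  "('k, 'm) ring_scheme \<Rightarrow> ('k, 'h) hopf
    \<Rightarrow> ('k, 'v, 'h) hopf_module \<Rightarrow> ('k, 'w, 'h) hopf_module
    \<Rightarrow> ('k, 'h, 'h) tensor \<Rightarrow> ('k, 'v, 'w) tensor \<Rightarrow> ('k, 'v, 'w) tensor" where
  "tensor_act K H V W X t =
     tensor_lift K H H (tensor K V W) (\<lambda>g h. tensor_map K V W V W (act V g) (act W h) t) X"

text \<open>\<open>mult_map K A B C\<close> is the product of \<open>C\<close> as a linear map \<open>A \<otimes> B \<rightarrow> C\<close>.\<close>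

definition mult_map ::
  "('k, 'm) ring_scheme \<Rightarrow> ('k, 'c, 'n) module_scheme \<Rightarrow> ('k, 'c, 'p) module_scheme
    \<Rightarrow> ('k, 'c, 'q) module_scheme \<Rightarrow> ('k, 'c, 'c) tensor \<Rightarrow> 'c" where
  "mult_map K A B C = tensor_lift K A B C (\<lambda>a b. a \<otimes>\<^bsub>C\<^esub> b)"

locale h_module_algebra = H: hopf_algebra K H + A: assoc_algebra K A
  for K (structure) and H :: "('k, 'h) hopf" and A :: "('k, 'a, 'h) hopf_module" +
  assumes act_linear_right: "h \<in> carrier H \<Longrightarrow> linear_map K A A (act A h)"
    and act_linear_left: "x \<in> carrier A \<Longrightarrow> linear_map K H A (\<lambda>h. act A h x)"
    and act_one: "x \<in> carrier A \<Longrightarrow> act A \<one>\<^bsub>H\<^esub> x = x"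
    and act_mult:
      "\<lbrakk>g \<in> carrier H; h \<in> carrier H; x \<in> carrier A\<rbrakk>
        \<Longrightarrow> act A (g \<otimes>\<^bsub>H\<^esub> h) x = act A g (act A h x)"
    and act_prod:
      "\<lbrakk>h \<in> carrier H; x \<in> carrier A; y \<in> carrier A\<rbrakk>
        \<Longrightarrow> act A h (x \<otimes>\<^bsub>A\<^esub> y)
          = mult_map K A A A (tensor_act K H A A (comult H h) (pure_tensor K A A x y))"
    and act_unit: "h \<in> carrier H \<Longrightarrow> act A h \<one>\<^bsub>A\<^esub> = counit H h \<odot>\<^bsub>A\<^esub> \<one>\<^bsub>A\<^esub>"

definition is_h_module_subalgebra ::
  "('k, 'm) ring_scheme \<Rightarrow> ('k, 'h) hopf
    \<Rightarrow> ('k, 'c, 'h) hopf_module \<Rightarrow> ('k, 'c, 'h) hopf_module \<Rightarrow> bool" where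
  "is_h_module_subalgebra K H A C \<longleftrightarrow>
     is_subalgebra K A C \<and> h_module_algebra K H A \<and> h_module_algebra K H C \<and>
     (\<forall>h\<in>carrier H. \<forall>x\<in>carrier A. act A h x = act C h x)"

definition cocycle_twist ::
  "('k, 'm) ring_scheme \<Rightarrow> ('k, 'h) hopf \<Rightarrow> ('k, 'h, 'h) tensor
    \<Rightarrow> ('k, 'a, 'h) hopf_module \<Rightarrow> ('k, 'a, 'h) hopf_module" where
  "cocycle_twist K H F A =
     A\<lparr> mult := (\<lambda>x y. mult_map K A A A
          (tensor_act K H A A (inv\<^bsub>tensor_algebra K H H\<^esub> F) (pure_tensor K A A x y))) \<rparr>"

section \<open>Algebra factorisations\<close>

definition algebra_factorisation ::
  "('k, 'm) ring_scheme \<Rightarrow> ('k, 'c, 'q) module_scheme \<Rightarrow> ('k, 'c, 'n) module_scheme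
    \<Rightarrow> ('k, 'c, 'p) module_scheme \<Rightarrow> bool" where
  "algebra_factorisation K C A B \<longleftrightarrow>
     is_subalgebra K A C \<and> is_subalgebra K B C \<and>
     linear_map K (tensor K A B) C (mult_map K A B C) \<and>
     bij_betw (mult_map K A B C) (carrier (tensor K A B)) (carrier C)"

definition factorisation_map ::
  "('k, 'm) ring_scheme \<Rightarrow> ('k, 'c, 'q) module_scheme \<Rightarrow> ('k, 'c, 'n) module_scheme
    \<Rightarrow> ('k, 'c, 'p) module_scheme \<Rightarrow> ('k, 'c, 'c) tensor \<Rightarrow> ('k, 'c, 'c) tensor" where
  "factorisation_map K C A B t =
     inv_into (carrier (tensor K A B)) (mult_map K A B C) (mult_map K B A C t)"

definition h_module_factorisation ::
  "('k, 'm) ring_scheme \<Rightarrow> ('k, 'h) hopf \<Rightarrow> ('k, 'c, 'h) hopf_module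
    \<Rightarrow> ('k, 'c, 'h) hopf_module \<Rightarrow> ('k, 'c, 'h) hopf_module \<Rightarrow> bool" where
  "h_module_factorisation K H C A B \<longleftrightarrow>
     algebra_factorisation K C A B \<and> h_module_algebra K H C \<and>
     is_h_module_subalgebra K H A C \<and> is_h_module_subalgebra K H B C"

end

theory Submission
  imports Defs
begin

text \<open>
  Write \<open>F'\<close> for the inverse of \<open>F\<close>, and \<open>m\<close> for the product of \<open>C\<close> restricted to \<open>A \<otimes> B\<close> or
  \<open>B \<otimes> A\<close>. By its definition, the product of the twist of \<open>C\<close> restricts to \<open>m \<circ> (F' \<rhd>)\<close> on either
  tensor product (\<open>mult_map_twist\<close>). The action of \<open>F'\<close> on \<open>A \<otimes> B\<close> is invertible, with inverse the
  action of \<open>F\<close>. Hence the twisted product is bijective on \<open>A \<otimes> B\<close> because \<open>m\<close> is, and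
  \<open>(m \<circ> (F' \<rhd>))\<^sup>-\<^sup>1 \<circ> m \<circ> (F' \<rhd>) = (F \<rhd>) \<circ> (m\<^sup>-\<^sup>1 \<circ> m) \<circ> (F' \<rhd>)\<close>, where the
  inverses belong to maps on \<open>A \<otimes> B\<close>; this is the formula for the factorisation map.

  The remaining content is that the twists are the structures they are said to be. Apart from the
  counit conditions on \<open>F\<close>, all of it comes from one identity, \<open>(F \<otimes> 1) (\<Delta> \<otimes> id)(F) = (1 \<otimes> F) (id \<otimes> \<Delta>)(F)\<close>, in which every factor is
  invertible, so that it can be solved for other products of the factors (\<open>cocycle_forms\<close>):

  \<^item> The inverted identity \<open>(\<Delta> \<otimes> id)(F') (F' \<otimes> 1) = (id \<otimes> \<Delta>)(F') (1 \<otimes> F')\<close>, let act on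
    \<open>x \<otimes> y \<otimes> z\<close> and multiplied out, is the associativity of the twisted product
    (\<open>twisted_mult_assoc\<close>). Conjugating the coassociativity of \<open>\<Delta>\<close> by the two sides of the
    identity gives the coassociativity of the twisted coproduct (\<open>coassoc_twist\<close>).

  \<^item> Two more forms, evaluated under \<open>a \<otimes> b \<otimes> c \<mapsto> a S(b) c\<close> and \<open>a \<otimes> b \<otimes> c \<mapsto> S(a) b S(c)\<close>, show
    that \<open>U = F\<^sub>1 S(F\<^sub>2)\<close> has the inverse \<open>V = S(F'\<^sub>1) F'\<^sub>2\<close> (\<open>U_V\<close>, \<open>V_U\<close>). The antipode axioms for
    \<open>U S(h) V\<close> then follow by cancelling \<open>F\<close> against \<open>F'\<close>. These calculations use that the antipode
    reverses products (\<open>antipode_mult\<close>), which is deduced from the Hopf algebra axioms.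

  Calculations with \<open>t = t\<^sub>1 \<otimes> t\<^sub>2\<close> in Sweedler's notation become calculations with
  \<open>tensor_lift K V W U \<phi> t\<close>, the sum of the values \<open>\<phi> t\<^sub>1 t\<^sub>2\<close>. Such sums may be interchanged
  (\<open>tensor_lift_swap\<close>), linear maps may be moved in and out of them (\<open>linear_map_tensor_lift\<close>), and
  summands may be rewritten in place (\<open>tensor_lift_cong\<close>). Each of these steps needs the summand to be
  multilinear, which the rules \<open>linear_intros\<close> establish from its syntax.
\<close>

section \<open>Linear and multilinear maps\<close>

lemma linear_mapI:
  assumes "\<And>x. x \<in> carrier V \<Longrightarrow> f x \<in> carrier W"
    and "\<And>x y. \<lbrakk>x \<in> carrier V; y \<in> carrier V\<rbrakk> \<Longrightarrow> f (x \<oplus>\<^bsub>V\<^esub> y) = f x \<oplus>\<^bsub>W\<^esub> f y"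
    and "\<And>c x. \<lbrakk>c \<in> carrier K; x \<in> carrier V\<rbrakk> \<Longrightarrow> f (c \<odot>\<^bsub>V\<^esub> x) = c \<odot>\<^bsub>W\<^esub> f x"
  shows "linear_map K V W f"
  using assms by (auto simp: linear_map_def)

lemma linear_map_closed: "\<lbrakk>linear_map K V W f; x \<in> carrier V\<rbrakk> \<Longrightarrow> f x \<in> carrier W"
  by (auto simp: linear_map_def)

lemma linear_map_add:
  "\<lbrakk>linear_map K V W f; x \<in> carrier V; y \<in> carrier V\<rbrakk> \<Longrightarrow> f (x \<oplus>\<^bsub>V\<^esub> y) = f x \<oplus>\<^bsub>W\<^esub> f y"
  by (auto simp: linear_map_def)

lemma linear_map_smult:
  "\<lbrakk>linear_map K V W f; c \<in> carrier K; x \<in> carrier V\<rbrakk> \<Longrightarrow> f (c \<odot>\<^bsub>V\<^esub> x) = c \<odot>\<^bsub>W\<^esub> f x"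
  by (auto simp: linear_map_def)

lemma linear_map_zero:
  assumes "module K V" "module K W" and f: "linear_map K V W f"
  shows "f \<zero>\<^bsub>V\<^esub> = \<zero>\<^bsub>W\<^esub>"
proof -
  interpret V: module K V by fact
  interpret W: module K W by fact
  have "f (\<zero>\<^bsub>K\<^esub> \<odot>\<^bsub>V\<^esub> \<zero>\<^bsub>V\<^esub>) = \<zero>\<^bsub>K\<^esub> \<odot>\<^bsub>W\<^esub> f \<zero>\<^bsub>V\<^esub>"
    by (rule linear_map_smult[OF f]) auto
  then show ?thesis
    using linear_map_closed[OF f] by simp
qed

lemma linear_map_cong:
  assumes "\<And>x. x \<in> carrier V \<Longrightarrow> f x = g x" and "module K V"
  shows "linear_map K V W f \<longleftrightarrow> linear_map K V W g"
proof -
  interpret V: module K V by fact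
  show ?thesis
    using assms(1) unfolding linear_map_def by (auto simp: Pi_iff)
qed

definition bilinear_map where
  "bilinear_map K V W U \<phi> \<longleftrightarrow>
     (\<forall>v\<in>carrier V. linear_map K W U (\<phi> v)) \<and> (\<forall>w\<in>carrier W. linear_map K V U (\<lambda>v. \<phi> v w))"

lemma bilinear_mapI:
  assumes "\<And>v. v \<in> carrier V \<Longrightarrow> linear_map K W U (\<phi> v)"
    and "\<And>w. w \<in> carrier W \<Longrightarrow> linear_map K V U (\<lambda>v. \<phi> v w)"
  shows "bilinear_map K V W U \<phi>"
  using assms by (auto simp: bilinear_map_def)

lemma bilinear_map_right: "\<lbrakk>bilinear_map K V W U \<phi>; v \<in> carrier V\<rbrakk> \<Longrightarrow> linear_map K W U (\<phi> v)"
  by (auto simp: bilinear_map_def)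

lemma bilinear_map_left:
  "\<lbrakk>bilinear_map K V W U \<phi>; w \<in> carrier W\<rbrakk> \<Longrightarrow> linear_map K V U (\<lambda>v. \<phi> v w)"
  by (auto simp: bilinear_map_def)

lemma bilinear_map_closed:
  "\<lbrakk>bilinear_map K V W U \<phi>; v \<in> carrier V; w \<in> carrier W\<rbrakk> \<Longrightarrow> \<phi> v w \<in> carrier U"
  by (blast dest: bilinear_map_right linear_map_closed)

section \<open>Free modules and quotients\<close>

context
  fixes K :: "('k, 'm) ring_scheme" and X :: "'x set"
  assumes K: "cring K"
begin

interpretation K: cring K by (rule K)

lemma free_module_coeff: "f \<in> carrier (free_module K X) \<Longrightarrow> f x \<in> carrier K"
  by (cases "x \<in> X") (auto simp: free_module_def)

lemma free_module_module: "module K (free_module K X)"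
proof -
  have add: "finite {x. f x \<oplus>\<^bsub>K\<^esub> g x \<noteq> \<zero>\<^bsub>K\<^esub>}"
    if "finite {x. f x \<noteq> \<zero>\<^bsub>K\<^esub>}" "finite {x. g x \<noteq> \<zero>\<^bsub>K\<^esub>}" for f g :: "'x \<Rightarrow> 'k"
    by (rule finite_subset[of _ "{x. f x \<noteq> \<zero>\<^bsub>K\<^esub>} \<union> {x. g x \<noteq> \<zero>\<^bsub>K\<^esub>}"]) (use that in auto)
  have smult: "finite {x. c \<otimes>\<^bsub>K\<^esub> f x \<noteq> \<zero>\<^bsub>K\<^esub>}"
    if "finite {x. f x \<noteq> \<zero>\<^bsub>K\<^esub>}" "c \<in> carrier K" for c and f :: "'x \<Rightarrow> 'k"
    by (rule finite_subset[OF _ that(1)]) (use that in auto)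
  have coeff: "f x \<in> carrier K" if "f \<in> X \<rightarrow> carrier K" "\<forall>x. x \<notin> X \<longrightarrow> f x = \<zero>\<^bsub>K\<^esub>" for f x
    using that by (cases "x \<in> X") auto
  have "abelian_group (free_module K X)"
  proof (rule abelian_groupI)
    fix f assume f: "f \<in> carrier (free_module K X)"
    have "(\<lambda>x. \<ominus>\<^bsub>K\<^esub> f x) \<in> carrier (free_module K X)"
      using f smult[of f "\<ominus>\<^bsub>K\<^esub> \<one>\<^bsub>K\<^esub>"] free_module_coeff[OF f]
      by (auto simp: free_module_def K.l_minus)
    moreover have "(\<lambda>x. \<ominus>\<^bsub>K\<^esub> f x) \<oplus>\<^bsub>free_module K X\<^esub> f = \<zero>\<^bsub>free_module K X\<^esub>"
      using free_module_coeff[OF f] by (auto simp: free_module_def K.l_neg)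
    ultimately show "\<exists>g\<in>carrier (free_module K X). g \<oplus>\<^bsub>free_module K X\<^esub> f = \<zero>\<^bsub>free_module K X\<^esub>"
      by blast
  qed (auto simp: free_module_def add K.a_ac coeff)
  then show ?thesis
    by (intro moduleI K)
      (auto simp: free_module_def smult K.l_distr K.r_distr K.m_assoc coeff intro!: ext)
qed

lemma free_gen_closed: "x \<in> X \<Longrightarrow> free_gen K x \<in> carrier (free_module K X)"
  by (auto simp: free_module_def free_gen_def)

lemma free_module_induct [consumes 1, case_names zero gen add]:
  assumes f: "f \<in> carrier (free_module K X)"
    and zero: "P \<zero>\<^bsub>free_module K X\<^esub>"
    and gen: "\<And>c x. \<lbrakk>c \<in> carrier K; x \<in> X\<rbrakk> \<Longrightarrow> P (c \<odot>\<^bsub>free_module K X\<^esub> free_gen K x)"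
    and add: "\<And>f g. \<lbrakk>f \<in> carrier (free_module K X); g \<in> carrier (free_module K X); P f; P g\<rbrakk>
                \<Longrightarrow> P (f \<oplus>\<^bsub>free_module K X\<^esub> g)"
  shows "P f"
proof -
  interpret L: module K "free_module K X" by (rule free_module_module)
  have "P f" if "finite S" "f \<in> carrier (free_module K X)" "{x. f x \<noteq> \<zero>\<^bsub>K\<^esub>} \<subseteq> S" for S f
    using that
  proof (induction S arbitrary: f rule: finite_induct)
    case empty
    then have "f = \<zero>\<^bsub>free_module K X\<^esub>"
      by (auto simp: free_module_def)
    with zero show ?case by simp
  next
    case (insert y S f)
    let ?g = "f(y := \<zero>\<^bsub>K\<^esub>)"
    have "finite {x. ?g x \<noteq> \<zero>\<^bsub>K\<^esub>}"
      by (rule finite_subset[of _ "{x. f x \<noteq> \<zero>\<^bsub>K\<^esub>}"])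
        (use insert.prems in \<open>auto simp: free_module_def\<close>)
    then have g: "?g \<in> carrier (free_module K X)"
      using insert.prems by (auto simp: free_module_def)
    have Pg: "P ?g"
      by (rule insert.IH[OF g]) (use insert.prems in auto)
    show ?case
    proof (cases "y \<in> X")
      case False
      then have "?g = f"
        using insert.prems by (auto simp: free_module_def)
      with Pg show ?thesis by simp
    next
      case True
      then have y: "f y \<in> carrier K" and f: "\<And>x. f x \<in> carrier K"
        using insert.prems free_module_coeff by auto
      have "f = (f y \<odot>\<^bsub>free_module K X\<^esub> free_gen K y) \<oplus>\<^bsub>free_module K X\<^esub> ?g"
        using f by (auto simp: free_module_def free_gen_def)
      moreover have "P ((f y \<odot>\<^bsub>free_module K X\<^esub> free_gen K y) \<oplus>\<^bsub>free_module K X\<^esub> ?g)"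
        using add gen[OF y True] g Pg L.smult_closed[OF y free_gen_closed[OF True]] by blast
      ultimately show ?thesis by simp
    qed
  qed
  with f show ?thesis
    by (auto simp: free_module_def)
qed

definition free_extension where
  "free_extension U \<phi> f = finsum U (\<lambda>x. f x \<odot>\<^bsub>U\<^esub> \<phi> x) {x. f x \<noteq> \<zero>\<^bsub>K\<^esub>}"

lemma free_extension_linear:
  assumes "module K U" and \<phi>: "\<phi> \<in> X \<rightarrow> carrier U"
  shows "linear_map K (free_module K X) U (free_extension U \<phi>)"
proof -
  interpret U: module K U by fact
  have ev: "f x \<odot>\<^bsub>U\<^esub> \<phi> x \<in> carrier U" if "f \<in> carrier (free_module K X)" "x \<in> X" for f x
    using that \<phi> by (auto simp: free_module_def)
  have coeff: "f x \<in> carrier K" if "f \<in> carrier (free_module K X)" "x \<in> X" for f x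
    using that by (auto simp: free_module_def)
  have gen: "\<phi> x \<in> carrier U" if "x \<in> X" for x
    using that \<phi> by auto
  \<comment> \<open>Enlarging the index set to a common finite superset of the supports makes sums comparable.\<close>
  have superset: "free_extension U \<phi> f = finsum U (\<lambda>x. f x \<odot>\<^bsub>U\<^esub> \<phi> x) S"
    if "f \<in> carrier (free_module K X)" "finite S" "{x. f x \<noteq> \<zero>\<^bsub>K\<^esub>} \<subseteq> S" "S \<subseteq> X" for f S
    unfolding free_extension_def
    by (rule U.add.finprod_mono_neutral_cong_left) (use that ev gen in \<open>auto 0 3\<close>)
  have supp: "finite {x. f x \<noteq> \<zero>\<^bsub>K\<^esub>}" "{x. f x \<noteq> \<zero>\<^bsub>K\<^esub>} \<subseteq> X"
    if "f \<in> carrier (free_module K X)" for f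
    using that by (auto simp: free_module_def)
  interpret L: module K "free_module K X" by (rule free_module_module)
  show ?thesis
  proof (rule linear_mapI)
    fix f assume f: "f \<in> carrier (free_module K X)"
    show "free_extension U \<phi> f \<in> carrier U"
      unfolding free_extension_def
      by (rule U.finsum_closed) (use supp[OF f] ev[OF f] in blast)
    fix g assume g: "g \<in> carrier (free_module K X)"
    let ?S = "{x. f x \<noteq> \<zero>\<^bsub>K\<^esub>} \<union> {x. g x \<noteq> \<zero>\<^bsub>K\<^esub>}"
    have S: "finite ?S" "?S \<subseteq> X"
      using supp[OF f] supp[OF g] by auto
    have "free_extension U \<phi> (f \<oplus>\<^bsub>free_module K X\<^esub> g)
        = finsum U (\<lambda>x. (f \<oplus>\<^bsub>free_module K X\<^esub> g) x \<odot>\<^bsub>U\<^esub> \<phi> x) ?S"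
    proof (rule superset)
      show "f \<oplus>\<^bsub>free_module K X\<^esub> g \<in> carrier (free_module K X)"
        using f g by simp
    qed (use S in \<open>auto simp: free_module_def\<close>)
    also have "\<dots> = finsum U (\<lambda>x. f x \<odot>\<^bsub>U\<^esub> \<phi> x \<oplus>\<^bsub>U\<^esub> g x \<odot>\<^bsub>U\<^esub> \<phi> x) ?S"
      by (rule U.finsum_cong')
        (use S ev[OF f] ev[OF g] coeff[OF f] coeff[OF g] gen in
          \<open>auto simp: free_module_def U.smult_l_distr subset_iff\<close>)
    also have "\<dots> = finsum U (\<lambda>x. f x \<odot>\<^bsub>U\<^esub> \<phi> x) ?S \<oplus>\<^bsub>U\<^esub> finsum U (\<lambda>x. g x \<odot>\<^bsub>U\<^esub> \<phi> x) ?S"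
      by (rule U.finsum_addf) (use S ev[OF f] ev[OF g] in auto)
    also have "\<dots> = free_extension U \<phi> f \<oplus>\<^bsub>U\<^esub> free_extension U \<phi> g"
      using superset[OF f, of ?S] superset[OF g, of ?S] S by simp
    finally show "free_extension U \<phi> (f \<oplus>\<^bsub>free_module K X\<^esub> g)
        = free_extension U \<phi> f \<oplus>\<^bsub>U\<^esub> free_extension U \<phi> g" .
  next
    fix c f assume c: "c \<in> carrier K" and f: "f \<in> carrier (free_module K X)"
    let ?S = "{x. f x \<noteq> \<zero>\<^bsub>K\<^esub>}"
    have "free_extension U \<phi> (c \<odot>\<^bsub>free_module K X\<^esub> f)
        = finsum U (\<lambda>x. (c \<odot>\<^bsub>free_module K X\<^esub> f) x \<odot>\<^bsub>U\<^esub> \<phi> x) ?S"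
    proof (rule superset)
      show "c \<odot>\<^bsub>free_module K X\<^esub> f \<in> carrier (free_module K X)"
        using c f by simp
    qed (use c supp[OF f] in \<open>auto simp: free_module_def\<close>)
    also have "\<dots> = finsum U (\<lambda>x. c \<odot>\<^bsub>U\<^esub> (f x \<odot>\<^bsub>U\<^esub> \<phi> x)) ?S"
      by (rule U.finsum_cong')
        (use c supp[OF f] ev[OF f] coeff[OF f] gen in
          \<open>auto simp: free_module_def U.smult_assoc1 subset_iff\<close>)
    also have "\<dots> = c \<odot>\<^bsub>U\<^esub> free_extension U \<phi> f"
      unfolding free_extension_def
      by (rule U.finsum_smult_ldistr[symmetric]) (use c supp[OF f] ev[OF f] in auto)
    finally show "free_extension U \<phi> (c \<odot>\<^bsub>free_module K X\<^esub> f) = c \<odot>\<^bsub>U\<^esub> free_extension U \<phi> f" .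
  qed
qed

lemma free_extension_gen:
  assumes "module K U" and \<phi>: "\<phi> \<in> X \<rightarrow> carrier U" and x: "x \<in> X"
  shows "free_extension U \<phi> (free_gen K x) = \<phi> x"
proof -
  interpret U: module K U by fact
  have \<phi>x: "\<phi> x \<in> carrier U" using \<phi> x by auto
  have trivial: "\<phi> x = \<zero>\<^bsub>U\<^esub>" if "\<one>\<^bsub>K\<^esub> = \<zero>\<^bsub>K\<^esub>"
    using U.smult_one[OF \<phi>x] U.smult_l_null[OF \<phi>x] that by simp
  have "free_extension U \<phi> (free_gen K x) = finsum U (\<lambda>y. free_gen K x y \<odot>\<^bsub>U\<^esub> \<phi> y) {x}"
    unfolding free_extension_def
    by (rule U.add.finprod_mono_neutral_cong_left)
      (use \<phi>x trivial in \<open>auto simp: free_gen_def\<close>)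
  also have "\<dots> = \<phi> x"
    using \<phi>x by (simp add: free_gen_def)
  finally show ?thesis .
qed

end

lemma kernel_submodule:
  assumes "module K V" "module K W" and f: "linear_map K V W f"
  shows "submodule {x \<in> carrier V. f x = \<zero>\<^bsub>W\<^esub>} K V"
proof -
  interpret V: module K V by fact
  interpret W: module K W by fact
  have neg: "f (\<ominus>\<^bsub>V\<^esub> x) = \<ominus>\<^bsub>W\<^esub> f x" if "x \<in> carrier V" for x
  proof -
    have "f (\<ominus>\<^bsub>V\<^esub> x) \<oplus>\<^bsub>W\<^esub> f x = \<zero>\<^bsub>W\<^esub>"
      using linear_map_add[OF f, of "\<ominus>\<^bsub>V\<^esub> x" x] that linear_map_zero[OF assms]
      by (simp add: V.l_neg)
    then show ?thesis
      using that linear_map_closed[OF f] by (metis V.a_inv_closed W.minus_equality)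
  qed
  show ?thesis
    by (rule V.submoduleI)
      (auto simp: linear_map_zero[OF assms] neg linear_map_add[OF f] linear_map_smult[OF f])
qed

lemma generated_submodule_submodule:
  assumes "module K V" and R: "R \<subseteq> carrier V"
  shows "submodule (generated_submodule K V R) K V"
proof -
  interpret V: module K V by fact
  have V: "carrier V \<in> {N. submodule N K V \<and> R \<subseteq> N}"
    using V.carrier_is_submodule R by auto
  have zero: "\<zero>\<^bsub>V\<^esub> \<in> N" if "submodule N K V" for N
    using subgroup.one_closed[OF submodule.axioms(1)[OF that]] by simp
  show ?thesis
  proof (rule V.submoduleI)
    show "generated_submodule K V R \<subseteq> carrier V"
      using V by (auto simp: generated_submodule_def)
  qed (simp_all add: generated_submodule_def zero V.submoduleE)
qed

lemma generated_submodule_minimal: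
  "\<lbrakk>submodule N K V; R \<subseteq> N\<rbrakk> \<Longrightarrow> generated_submodule K V R \<subseteq> N"
  by (auto simp: generated_submodule_def)

lemma generated_submodule_generators: "R \<subseteq> generated_submodule K V R"
  by (auto simp: generated_submodule_def)

context
  fixes K :: "('k, 'm) ring_scheme" and V :: "('k, 'v, 'n) module_scheme" and N :: "'v set"
  assumes V: "module K V" and N: "submodule N K V"
begin

interpretation V: module K V by (rule V)
interpretation N: submodule N K V by (rule N)
interpretation NV: abelian_subgroup N V
  by (intro abelian_subgroupI3 additive_subgroupI N.subgroup_axioms V.abelian_group_axioms)

lemma quotient_carrier: "carrier (quotient_module V N) = (\<lambda>x. N +>\<^bsub>V\<^esub> x) ` carrier V"
  by (auto simp: quotient_module_def A_RCOSETS_def')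

lemma quotient_add:
  "\<lbrakk>x \<in> carrier V; y \<in> carrier V\<rbrakk>
    \<Longrightarrow> (N +>\<^bsub>V\<^esub> x) \<oplus>\<^bsub>quotient_module V N\<^esub> (N +>\<^bsub>V\<^esub> y) = N +>\<^bsub>V\<^esub> (x \<oplus>\<^bsub>V\<^esub> y)"
  by (simp add: quotient_module_def NV.a_rcos_sum)

lemma quotient_zero: "\<zero>\<^bsub>quotient_module V N\<^esub> = N +>\<^bsub>V\<^esub> \<zero>\<^bsub>V\<^esub>"
  by (simp add: quotient_module_def NV.a_rcos_const)

lemma quotient_eqI:
  assumes "x \<in> carrier V" "y \<in> carrier V" "x \<ominus>\<^bsub>V\<^esub> y \<in> N"
  shows "N +>\<^bsub>V\<^esub> x = N +>\<^bsub>V\<^esub> y"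
  using assms NV.a_rcos_module_rev[of y x] NV.a_repr_independence'[of x y]
  by (simp add: V.minus_eq)

lemma quotient_representative:
  assumes "x \<in> carrier V" "y \<in> N +>\<^bsub>V\<^esub> x"
  obtains n where "n \<in> N" "y = n \<oplus>\<^bsub>V\<^esub> x" "y \<in> carrier V"
  using assms NV.a_elemrcos_carrier[OF assms] by (auto simp: a_r_coset_def')

lemma quotient_smult:
  assumes c: "c \<in> carrier K" and x: "x \<in> carrier V"
  shows "c \<odot>\<^bsub>quotient_module V N\<^esub> (N +>\<^bsub>V\<^esub> x) = N +>\<^bsub>V\<^esub> (c \<odot>\<^bsub>V\<^esub> x)"
proof -
  have "N +>\<^bsub>V\<^esub> (c \<odot>\<^bsub>V\<^esub> y) = N +>\<^bsub>V\<^esub> (c \<odot>\<^bsub>V\<^esub> x)" if "y \<in> N +>\<^bsub>V\<^esub> x" for y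
  proof -
    from x that obtain n where n: "n \<in> N" "y = n \<oplus>\<^bsub>V\<^esub> x"
      by (rule quotient_representative)
    have "c \<odot>\<^bsub>V\<^esub> y = c \<odot>\<^bsub>V\<^esub> n \<oplus>\<^bsub>V\<^esub> c \<odot>\<^bsub>V\<^esub> x"
      using c x n by (simp add: V.smult_r_distr)
    moreover have "c \<odot>\<^bsub>V\<^esub> n \<in> N"
      using c n by simp
    ultimately have "c \<odot>\<^bsub>V\<^esub> y \<in> N +>\<^bsub>V\<^esub> (c \<odot>\<^bsub>V\<^esub> x)"
      by (auto simp: a_r_coset_def')
    then show ?thesis
      using NV.a_repr_independence' c x by force
  qed
  then have "(\<Union>y\<in>N +>\<^bsub>V\<^esub> x. N +>\<^bsub>V\<^esub> (c \<odot>\<^bsub>V\<^esub> y)) = (\<Union>y\<in>N +>\<^bsub>V\<^esub> x. N +>\<^bsub>V\<^esub> (c \<odot>\<^bsub>V\<^esub> x))"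
    by (rule SUP_cong[OF refl])
  also have "\<dots> = N +>\<^bsub>V\<^esub> (c \<odot>\<^bsub>V\<^esub> x)"
    using NV.a_rcos_self[OF x] by blast
  finally show ?thesis
    by (simp add: quotient_module_def)
qed

lemmas quotient_simps = quotient_carrier quotient_add quotient_zero quotient_smult

lemma quotient_module_module: "module K (quotient_module V N)"
proof (rule moduleI)
  show "cring K" by (rule V.is_cring)
  show "abelian_group (quotient_module V N)"
  proof (rule abelian_groupI)
    fix X assume "X \<in> carrier (quotient_module V N)"
    then obtain x where x: "x \<in> carrier V" "X = N +>\<^bsub>V\<^esub> x"
      by (auto simp: quotient_carrier)
    then have "(N +>\<^bsub>V\<^esub> (\<ominus>\<^bsub>V\<^esub> x)) \<oplus>\<^bsub>quotient_module V N\<^esub> X = \<zero>\<^bsub>quotient_module V N\<^esub>"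
      by (simp add: quotient_simps V.l_neg)
    then show "\<exists>Y\<in>carrier (quotient_module V N).
        Y \<oplus>\<^bsub>quotient_module V N\<^esub> X = \<zero>\<^bsub>quotient_module V N\<^esub>"
      using x by (auto simp: quotient_carrier)
  qed (auto simp: quotient_simps V.a_ac)
next
  fix c X assume c: "c \<in> carrier K" and "X \<in> carrier (quotient_module V N)"
  then obtain x where x: "x \<in> carrier V" "X = N +>\<^bsub>V\<^esub> x"
    by (auto simp: quotient_carrier)
  then show "c \<odot>\<^bsub>quotient_module V N\<^esub> X \<in> carrier (quotient_module V N)"
    using c by (simp add: quotient_simps)
  fix d assume d: "d \<in> carrier K"
  show "(c \<oplus>\<^bsub>K\<^esub> d) \<odot>\<^bsub>quotient_module V N\<^esub> X
      = c \<odot>\<^bsub>quotient_module V N\<^esub> X \<oplus>\<^bsub>quotient_module V N\<^esub> d \<odot>\<^bsub>quotient_module V N\<^esub> X"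
    using c d x by (simp add: quotient_smult quotient_add V.smult_l_distr)
  show "(c \<otimes>\<^bsub>K\<^esub> d) \<odot>\<^bsub>quotient_module V N\<^esub> X
      = c \<odot>\<^bsub>quotient_module V N\<^esub> (d \<odot>\<^bsub>quotient_module V N\<^esub> X)"
    using c d x by (simp add: quotient_smult V.smult_assoc1)
next
  fix X assume "X \<in> carrier (quotient_module V N)"
  then show "\<one>\<^bsub>K\<^esub> \<odot>\<^bsub>quotient_module V N\<^esub> X = X"
    by (auto simp: quotient_carrier quotient_smult)
next
  fix c X Y assume c: "c \<in> carrier K"
    and "X \<in> carrier (quotient_module V N)" "Y \<in> carrier (quotient_module V N)"
  then obtain x y where "x \<in> carrier V" "X = N +>\<^bsub>V\<^esub> x" "y \<in> carrier V" "Y = N +>\<^bsub>V\<^esub> y"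
    by (auto simp: quotient_carrier)
  then show "c \<odot>\<^bsub>quotient_module V N\<^esub> (X \<oplus>\<^bsub>quotient_module V N\<^esub> Y)
      = c \<odot>\<^bsub>quotient_module V N\<^esub> X \<oplus>\<^bsub>quotient_module V N\<^esub> c \<odot>\<^bsub>quotient_module V N\<^esub> Y"
    using c by (simp add: quotient_smult quotient_add V.smult_r_distr)
qed

text \<open>
  A map that vanishes on \<open>N\<close> is constant on cosets of \<open>N\<close>; this makes the value of \<open>tensor_lift\<close>
  independent of the representative on which it is computed.
\<close>

lemma quotient_lift_unique:
  assumes W: "module K W" and f: "linear_map K V W f"
    and ker: "\<And>n. n \<in> N \<Longrightarrow> f n = \<zero>\<^bsub>W\<^esub>"
    and x: "x \<in> carrier V" and y: "y \<in> N +>\<^bsub>V\<^esub> x"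
  shows "f y = f x"
proof -
  interpret W: module K W by fact
  from x y obtain n where n: "n \<in> N" "y = n \<oplus>\<^bsub>V\<^esub> x"
    by (rule quotient_representative)
  then show ?thesis
    using x ker linear_map_add[OF f] linear_map_closed[OF f] by simp
qed

lemma quotient_self: "x \<in> carrier V \<Longrightarrow> x \<in> N +>\<^bsub>V\<^esub> x"
  by (rule NV.a_rcos_self)

end

section \<open>The tensor product and its universal property\<close>

locale module_pair = V: module K V + W: module K W
  for K :: "('k, 'm) ring_scheme" (structure)
    and V :: "('k, 'v, 'n) module_scheme" and W :: "('k, 'w, 'p) module_scheme"
begin

lemma tensor_free_module: "module K (tensor_free K V W)"
  unfolding tensor_free_def by (rule free_module_module) (rule V.is_cring)

sublocale L: module K "tensor_free K V W"
  by (rule tensor_free_module)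

lemma tensor_gen_closed:
  "\<lbrakk>v \<in> carrier V; w \<in> carrier W\<rbrakk> \<Longrightarrow> free_gen K (v, w) \<in> carrier (tensor_free K V W)"
  unfolding tensor_free_def by (rule free_gen_closed) (auto intro: V.is_cring)

lemma tensor_relations_closed: "tensor_relations K V W \<subseteq> carrier (tensor_free K V W)"
  by (auto simp: tensor_relations_def Let_def tensor_gen_closed)

lemma tensor_null_submodule: "submodule (tensor_null K V W) K (tensor_free K V W)"
  unfolding tensor_null_def
  by (rule generated_submodule_submodule[OF tensor_free_module tensor_relations_closed])

lemma tensor_module: "module K (tensor K V W)"
  unfolding tensor_def by (rule quotient_module_module[OF tensor_free_module tensor_null_submodule])

sublocale T: module K "tensor K V W"
  by (rule tensor_module)

lemmas quot = quotient_simps[OF tensor_free_module tensor_null_submodule, folded tensor_def]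

lemma pure_tensor_closed [simp, intro]:
  "\<lbrakk>v \<in> carrier V; w \<in> carrier W\<rbrakk> \<Longrightarrow> pure_tensor K V W v w \<in> carrier (tensor K V W)"
  by (auto simp: pure_tensor_def quot tensor_gen_closed)

lemma tensor_relation_eqI:
  assumes "x \<ominus>\<^bsub>tensor_free K V W\<^esub> y \<in> tensor_relations K V W"
    and "x \<in> carrier (tensor_free K V W)" "y \<in> carrier (tensor_free K V W)"
  shows "tensor_null K V W +>\<^bsub>tensor_free K V W\<^esub> x = tensor_null K V W +>\<^bsub>tensor_free K V W\<^esub> y"
  using assms quotient_eqI[OF tensor_free_module tensor_null_submodule]
    generated_submodule_generators[of "tensor_relations K V W" K "tensor_free K V W"]
  by (auto simp: tensor_null_def)

lemma pure_tensor_bilinear: "bilinear_map K V W (tensor K V W) (pure_tensor K V W)"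
proof (intro bilinear_mapI linear_mapI)
  fix v v' w assume "v \<in> carrier V" "v' \<in> carrier V" "w \<in> carrier W"
  then show "pure_tensor K V W (v \<oplus>\<^bsub>V\<^esub> v') w
      = pure_tensor K V W v w \<oplus>\<^bsub>tensor K V W\<^esub> pure_tensor K V W v' w"
    unfolding pure_tensor_def
    by (subst quot, simp add: tensor_gen_closed, simp add: tensor_gen_closed)
      (rule tensor_relation_eqI,
        unfold tensor_relations_def Let_def, blast, auto simp: tensor_gen_closed)
next
  fix v w w' assume "v \<in> carrier V" "w \<in> carrier W" "w' \<in> carrier W"
  then show "pure_tensor K V W v (w \<oplus>\<^bsub>W\<^esub> w')
      = pure_tensor K V W v w \<oplus>\<^bsub>tensor K V W\<^esub> pure_tensor K V W v w'"
    unfolding pure_tensor_def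
    by (subst quot, simp add: tensor_gen_closed, simp add: tensor_gen_closed)
      (rule tensor_relation_eqI,
        unfold tensor_relations_def Let_def, blast, auto simp: tensor_gen_closed)
next
  fix c v w assume "c \<in> carrier K" "v \<in> carrier V" "w \<in> carrier W"
  then show "pure_tensor K V W (c \<odot>\<^bsub>V\<^esub> v) w = c \<odot>\<^bsub>tensor K V W\<^esub> pure_tensor K V W v w"
    unfolding pure_tensor_def
    by (subst quot, simp, simp add: tensor_gen_closed)
      (rule tensor_relation_eqI,
        unfold tensor_relations_def Let_def, blast, auto simp: tensor_gen_closed)
next
  fix c v w assume "c \<in> carrier K" "v \<in> carrier V" "w \<in> carrier W"
  then show "pure_tensor K V W v (c \<odot>\<^bsub>W\<^esub> w) = c \<odot>\<^bsub>tensor K V W\<^esub> pure_tensor K V W v w"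
    unfolding pure_tensor_def
    by (subst quot, simp, simp add: tensor_gen_closed)
      (rule tensor_relation_eqI,
        unfold tensor_relations_def Let_def, blast, auto simp: tensor_gen_closed)
qed auto

lemmas pure_tensor_add =
  linear_map_add[OF bilinear_map_left[OF pure_tensor_bilinear]]
  linear_map_add[OF bilinear_map_right[OF pure_tensor_bilinear]]

lemma pure_tensor_zero: "pure_tensor K V W \<zero>\<^bsub>V\<^esub> \<zero>\<^bsub>W\<^esub> = \<zero>\<^bsub>tensor K V W\<^esub>"
  by (rule linear_map_zero[OF W.module_axioms tensor_module])
    (simp add: bilinear_map_right[OF pure_tensor_bilinear])

text \<open>
  Scalars are absorbed by either factor, so that additivity alone reduces a statement about all
  tensors to the pure ones.
\<close>

lemma tensor_induct [consumes 1, case_names pure add]: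
  assumes t: "t \<in> carrier (tensor K V W)"
    and pure: "\<And>v w. \<lbrakk>v \<in> carrier V; w \<in> carrier W\<rbrakk> \<Longrightarrow> P (pure_tensor K V W v w)"
    and add: "\<And>x y. \<lbrakk>x \<in> carrier (tensor K V W); y \<in> carrier (tensor K V W); P x; P y\<rbrakk>
                \<Longrightarrow> P (x \<oplus>\<^bsub>tensor K V W\<^esub> y)"
  shows "P t"
proof -
  let ?\<pi> = "\<lambda>f. tensor_null K V W +>\<^bsub>tensor_free K V W\<^esub> f"
  have "P (?\<pi> f)" if "f \<in> carrier (tensor_free K V W)" for f
    using that
  proof (induction f rule: free_module_induct[OF V.is_cring, of _ "carrier V \<times> carrier W",
        folded tensor_free_def, consumes 1, case_names zero gen add])
    case zero
    show ?case
      using pure[of "\<zero>\<^bsub>V\<^esub>" "\<zero>\<^bsub>W\<^esub>"] by (simp add: pure_tensor_zero quot)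
  next
    case (gen c p)
    obtain v w where p: "p = (v, w)" by (cases p)
    have "?\<pi> (c \<odot>\<^bsub>tensor_free K V W\<^esub> free_gen K (v, w)) = pure_tensor K V W (c \<odot>\<^bsub>V\<^esub> v) w"
      using gen p linear_map_smult[OF bilinear_map_left[OF pure_tensor_bilinear, of w], of c v]
      by (simp add: pure_tensor_def quot tensor_gen_closed)
    then show ?case
      using pure[of "c \<odot>\<^bsub>V\<^esub> v" w] gen p by simp
  next
    case (add f g)
    have fg: "?\<pi> f \<in> carrier (tensor K V W)" "?\<pi> g \<in> carrier (tensor K V W)"
      using add.hyps by (auto simp: quot)
    have "?\<pi> f \<oplus>\<^bsub>tensor K V W\<^esub> ?\<pi> g = ?\<pi> (f \<oplus>\<^bsub>tensor_free K V W\<^esub> g)"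
      using add.hyps by (simp add: quot)
    then show ?case
      using assms(3)[OF fg] add.IH by simp
  qed
  with t show ?thesis
    by (auto simp: quot)
qed

lemma tensor_map_unique:
  assumes "linear_map K (tensor K V W) U f" "linear_map K (tensor K V W) U g"
    and "\<And>v w. \<lbrakk>v \<in> carrier V; w \<in> carrier W\<rbrakk> \<Longrightarrow> f (pure_tensor K V W v w) = g (pure_tensor K V W v w)"
    and "t \<in> carrier (tensor K V W)"
  shows "f t = g t"
  using assms(4)
  by (induction t rule: tensor_induct) (simp_all add: assms(3) linear_map_add[OF assms(1)] linear_map_add[OF assms(2)])

context
  fixes U :: "('k, 'u, 'q) module_scheme" and \<phi> :: "'v \<Rightarrow> 'w \<Rightarrow> 'u"
  assumes U: "module K U" and \<phi>: "bilinear_map K V W U \<phi>"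
begin

interpretation U: module K U by (rule U)

abbreviation (input) "ext \<equiv> free_extension K U (\<lambda>p. \<phi> (fst p) (snd p))"

lemma ext_linear: "linear_map K (tensor_free K V W) U ext"
  unfolding tensor_free_def
  by (rule free_extension_linear[OF V.is_cring U]) (use bilinear_map_closed[OF \<phi>] in auto)

lemma ext_gen: "\<lbrakk>v \<in> carrier V; w \<in> carrier W\<rbrakk> \<Longrightarrow> ext (free_gen K (v, w)) = \<phi> v w"
  by (subst free_extension_gen[OF V.is_cring U, where X = "carrier V \<times> carrier W"])
    (use bilinear_map_closed[OF \<phi>] in auto)

text \<open>
  The tensor relations express bilinearity of \<open>\<otimes>\<close>, so every generator is a difference of two elements
  on which the linear extension of a bilinear map agrees.
\<close>

lemma ext_null:
  assumes "n \<in> tensor_null K V W"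
  shows "ext n = \<zero>\<^bsub>U\<^esub>"
proof -
  have minus: "ext (x \<ominus>\<^bsub>tensor_free K V W\<^esub> y) = \<zero>\<^bsub>U\<^esub>"
    if "x \<in> carrier (tensor_free K V W)" "y \<in> carrier (tensor_free K V W)" "ext x = ext y" for x y
  proof -
    let ?d = "x \<ominus>\<^bsub>tensor_free K V W\<^esub> y"
    have d: "?d \<in> carrier (tensor_free K V W)" "?d \<oplus>\<^bsub>tensor_free K V W\<^esub> y = x"
      using that by (simp_all add: L.minus_eq L.a_assoc L.l_neg)
    have "ext ?d \<oplus>\<^bsub>U\<^esub> ext y = ext x"
      using linear_map_add[OF ext_linear d(1) that(2)] unfolding d(2) by (rule sym)
    then have "ext ?d \<oplus>\<^bsub>U\<^esub> ext y = ext y"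
      unfolding that(3) .
    moreover have "ext ?d \<in> carrier U" "ext y \<in> carrier U"
      using d that by (auto intro: linear_map_closed[OF ext_linear])
    ultimately show ?thesis
      using U.add.r_cancel_one by blast
  qed
  note lin = linear_map_add[OF ext_linear] linear_map_smult[OF ext_linear] ext_gen tensor_gen_closed
    linear_map_add[OF bilinear_map_right[OF \<phi>]] linear_map_add[OF bilinear_map_left[OF \<phi>]]
    linear_map_smult[OF bilinear_map_right[OF \<phi>]] linear_map_smult[OF bilinear_map_left[OF \<phi>]]
  have "tensor_relations K V W \<subseteq> {x \<in> carrier (tensor_free K V W). ext x = \<zero>\<^bsub>U\<^esub>}"
    unfolding tensor_relations_def Let_def
    by (intro Un_least subsetI; clarsimp; intro conjI minus) (simp_all add: lin)
  then have "tensor_null K V W \<subseteq> {x \<in> carrier (tensor_free K V W). ext x = \<zero>\<^bsub>U\<^esub>}"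
    unfolding tensor_null_def
    by (intro generated_submodule_minimal kernel_submodule[OF tensor_free_module U ext_linear])
  with assms show ?thesis by auto
qed

lemma tensor_lift_class:
  assumes f: "f \<in> carrier (tensor_free K V W)"
  shows "tensor_lift K V W U \<phi> (tensor_null K V W +>\<^bsub>tensor_free K V W\<^esub> f) = ext f"
  unfolding tensor_lift_def free_extension_def[OF V.is_cring, symmetric]
proof (rule the_equality)
  let ?t = "tensor_null K V W +>\<^bsub>tensor_free K V W\<^esub> f"
  show "\<exists>g\<in>?t. ext f = ext g"
    using quotient_self[OF tensor_free_module tensor_null_submodule f] by blast
  show "u = ext f" if "\<exists>g\<in>?t. u = ext g" for u
    using quotient_lift_unique[OF tensor_free_module tensor_null_submodule U ext_linear ext_null f] that
    by blast
qed

lemma tensor_lift_linear: "linear_map K (tensor K V W) U (tensor_lift K V W U \<phi>)"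
  by (rule linear_mapI)
    (auto simp: quot tensor_lift_class linear_map_closed[OF ext_linear]
      linear_map_add[OF ext_linear] linear_map_smult[OF ext_linear])

lemma tensor_lift_pure:
  "\<lbrakk>v \<in> carrier V; w \<in> carrier W\<rbrakk> \<Longrightarrow> tensor_lift K V W U \<phi> (pure_tensor K V W v w) = \<phi> v w"
  unfolding pure_tensor_def by (simp add: tensor_lift_class tensor_gen_closed ext_gen)

end

end

section \<open>Closure properties of linear maps\<close>

lemma tensor_lift_cong:
  assumes "module K V" "module K W" "module K U" and t: "t \<in> carrier (tensor K V W)"
    and \<phi>: "bilinear_map K V W U \<phi>"
    and eq: "\<And>v w. \<lbrakk>v \<in> carrier V; w \<in> carrier W\<rbrakk> \<Longrightarrow> \<phi> v w = \<psi> v w"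
  shows "tensor_lift K V W U \<phi> t = tensor_lift K V W U \<psi> t"
proof -
  interpret V: module K V by fact
  interpret W: module K W by fact
  interpret module_pair K V W ..
  have \<psi>: "bilinear_map K V W U \<psi>"
  proof (rule bilinear_mapI)
    show "linear_map K W U (\<psi> v)" if "v \<in> carrier V" for v
      using bilinear_map_right[OF \<phi> that] eq[OF that]
      by (subst linear_map_cong[where g = "\<phi> v"]) (simp_all add: W.module_axioms)
    show "linear_map K V U (\<lambda>v. \<psi> v w)" if "w \<in> carrier W" for w
      using bilinear_map_left[OF \<phi> that] eq that
      by (subst linear_map_cong[where g = "\<lambda>v. \<phi> v w"]) (simp_all add: V.module_axioms)
  qed
  show ?thesis
    using tensor_lift_linear[OF assms(3) \<phi>] tensor_lift_linear[OF assms(3) \<psi>]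
    by (rule tensor_map_unique)
      (simp_all add: tensor_lift_pure[OF assms(3) \<phi>] tensor_lift_pure[OF assms(3) \<psi>] eq t)
qed

lemma linear_map_ident: "linear_map K V V (\<lambda>x. x)"
  by (auto simp: linear_map_def)

lemma linear_map_compose:
  "\<lbrakk>linear_map K W U g; linear_map K V W f\<rbrakk> \<Longrightarrow> linear_map K V U (\<lambda>x. g (f x))"
  by (auto simp: linear_map_def Pi_iff)

lemma linear_map_pure_left:
  assumes "module K V" "module K W" "linear_map K X V f" "w \<in> carrier W"
  shows "linear_map K X (tensor K V W) (\<lambda>x. pure_tensor K V W (f x) w)"
proof -
  interpret module_pair K V W by (intro module_pair.intro assms)
  show ?thesis
    by (rule linear_map_compose[OF bilinear_map_left[OF pure_tensor_bilinear]]) fact+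
qed

lemma linear_map_pure_right:
  assumes "module K V" "module K W" "linear_map K X W f" "v \<in> carrier V"
  shows "linear_map K X (tensor K V W) (\<lambda>x. pure_tensor K V W v (f x))"
proof -
  interpret module_pair K V W by (intro module_pair.intro assms)
  show ?thesis
    by (rule linear_map_compose[OF bilinear_map_right[OF pure_tensor_bilinear]]) fact+
qed

lemma linear_map_lift_arg:
  assumes "module K V" "module K W" "module K U"
    and "bilinear_map K V W U \<phi>" "linear_map K X (tensor K V W) f"
  shows "linear_map K X U (\<lambda>x. tensor_lift K V W U \<phi> (f x))"
proof -
  interpret module_pair K V W by (intro module_pair.intro assms)
  show ?thesis
    by (rule linear_map_compose[OF tensor_lift_linear]) fact+
qed

lemma tensor_lift_closed:
  assumes "module K V" "module K W" "module K U"
    and "bilinear_map K V W U \<phi>" "t \<in> carrier (tensor K V W)"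
  shows "tensor_lift K V W U \<phi> t \<in> carrier U"
  using linear_map_lift_arg[OF assms(1-4) linear_map_ident] assms(5) by (rule linear_map_closed)

text \<open>
  A sum over tensor components is also linear in a parameter of its summand. Since the parameter
  changes the lifted map itself, this is no instance of composition; it is proved for one tensor at a
  time, by reduction to pure tensors.
\<close>

lemma linear_map_lift_param:
  assumes "module K X" "module K V" "module K W" "module K U"
    and \<phi>: "\<And>x. x \<in> carrier X \<Longrightarrow> bilinear_map K V W U (\<phi> x)"
    and lin: "\<And>v w. \<lbrakk>v \<in> carrier V; w \<in> carrier W\<rbrakk> \<Longrightarrow> linear_map K X U (\<lambda>x. \<phi> x v w)"
    and t: "t \<in> carrier (tensor K V W)"
  shows "linear_map K X U (\<lambda>x. tensor_lift K V W U (\<phi> x) t)"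
proof -
  interpret module_pair K V W by (intro module_pair.intro assms)
  interpret X: module K X by fact
  interpret U: module K U by fact
  note pure = tensor_lift_pure[OF \<open>module K U\<close> \<phi>]
  note linear = tensor_lift_linear[OF \<open>module K U\<close> \<phi>]
  note closed = tensor_lift_closed[OF assms(2-4) \<phi>]
  from t show ?thesis
  proof (induction t rule: tensor_induct)
    case (pure v w)
    then show ?case
      by (subst linear_map_cong[where g = "\<lambda>x. \<phi> x v w"])
        (simp_all add: tensor_lift_pure[OF \<open>module K U\<close> \<phi>] lin assms(1))
  next
    case (add s t)
    show ?case
    proof (rule linear_mapI)
      fix x assume x: "x \<in> carrier X"
      show "tensor_lift K V W U (\<phi> x) (s \<oplus>\<^bsub>tensor K V W\<^esub> t) \<in> carrier U"
        using x add.hyps by (intro closed) auto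
      fix y assume y: "y \<in> carrier X"
      show "tensor_lift K V W U (\<phi> (x \<oplus>\<^bsub>X\<^esub> y)) (s \<oplus>\<^bsub>tensor K V W\<^esub> t)
          = tensor_lift K V W U (\<phi> x) (s \<oplus>\<^bsub>tensor K V W\<^esub> t)
            \<oplus>\<^bsub>U\<^esub> tensor_lift K V W U (\<phi> y) (s \<oplus>\<^bsub>tensor K V W\<^esub> t)"
        using x y add.hyps linear_map_add[OF add.IH(1), of x y] linear_map_add[OF add.IH(2), of x y]
        by (simp add: linear_map_add[OF linear] closed U.a_ac)
    next
      fix c x assume c: "c \<in> carrier K" and x: "x \<in> carrier X"
      show "tensor_lift K V W U (\<phi> (c \<odot>\<^bsub>X\<^esub> x)) (s \<oplus>\<^bsub>tensor K V W\<^esub> t)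
          = c \<odot>\<^bsub>U\<^esub> tensor_lift K V W U (\<phi> x) (s \<oplus>\<^bsub>tensor K V W\<^esub> t)"
        using x c add.hyps linear_map_smult[OF add.IH(1), of c x] linear_map_smult[OF add.IH(2), of c x]
        by (simp add: linear_map_add[OF linear] closed U.smult_r_distr)
    qed
  qed
qed

text \<open>A linear map may be moved in and out of a sum over the components of a tensor.\<close>

lemma linear_map_tensor_lift:
  assumes "module K V" "module K W" "module K U" "module K X"
    and g: "linear_map K U X g" and \<phi>: "bilinear_map K V W U \<phi>" and t: "t \<in> carrier (tensor K V W)"
  shows "g (tensor_lift K V W U \<phi> t) = tensor_lift K V W X (\<lambda>v w. g (\<phi> v w)) t"
proof -
  interpret module_pair K V W by (intro module_pair.intro assms)
  have g\<phi>: "bilinear_map K V W X (\<lambda>v w. g (\<phi> v w))"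
    by (intro bilinear_mapI linear_map_compose[OF g] bilinear_map_left[OF \<phi>] bilinear_map_right[OF \<phi>])
  show ?thesis
    by (rule tensor_map_unique[OF linear_map_compose[OF g tensor_lift_linear[OF assms(3) \<phi>]]
          tensor_lift_linear[OF assms(4) g\<phi>] _ t])
      (simp add: tensor_lift_pure assms \<phi> g\<phi>)
qed

lemma assoc_algebra_module: "assoc_algebra K A \<Longrightarrow> module K A"
  by (simp add: assoc_algebra_def)

lemma assoc_algebra_ring: "assoc_algebra K A \<Longrightarrow> ring A"
  by (simp add: assoc_algebra_def)

lemma (in assoc_algebra)
  assumes "x \<in> carrier A" "y \<in> carrier A" "z \<in> carrier A"
  shows alg_assoc: "x \<otimes>\<^bsub>A\<^esub> y \<otimes>\<^bsub>A\<^esub> z = x \<otimes>\<^bsub>A\<^esub> (y \<otimes>\<^bsub>A\<^esub> z)"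
    and alg_l_distr: "(x \<oplus>\<^bsub>A\<^esub> y) \<otimes>\<^bsub>A\<^esub> z = x \<otimes>\<^bsub>A\<^esub> z \<oplus>\<^bsub>A\<^esub> y \<otimes>\<^bsub>A\<^esub> z"
    and alg_r_distr: "z \<otimes>\<^bsub>A\<^esub> (x \<oplus>\<^bsub>A\<^esub> y) = z \<otimes>\<^bsub>A\<^esub> x \<oplus>\<^bsub>A\<^esub> z \<otimes>\<^bsub>A\<^esub> y"
proof -
  have ring: "ring A"
    by (rule assoc_algebra_ring[OF assoc_algebra_axioms])
  show "x \<otimes>\<^bsub>A\<^esub> y \<otimes>\<^bsub>A\<^esub> z = x \<otimes>\<^bsub>A\<^esub> (y \<otimes>\<^bsub>A\<^esub> z)"
    "(x \<oplus>\<^bsub>A\<^esub> y) \<otimes>\<^bsub>A\<^esub> z = x \<otimes>\<^bsub>A\<^esub> z \<oplus>\<^bsub>A\<^esub> y \<otimes>\<^bsub>A\<^esub> z"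
    "z \<otimes>\<^bsub>A\<^esub> (x \<oplus>\<^bsub>A\<^esub> y) = z \<otimes>\<^bsub>A\<^esub> x \<oplus>\<^bsub>A\<^esub> z \<otimes>\<^bsub>A\<^esub> y"
    using assms by (simp_all add: ring.ring_simprules[OF ring])
qed

lemma linear_map_mult_right:
  assumes "assoc_algebra K A" "a \<in> carrier A" "linear_map K X A f"
  shows "linear_map K X A (\<lambda>x. a \<otimes>\<^bsub>A\<^esub> f x)"
proof -
  interpret assoc_algebra K A by fact
  show ?thesis
    by (rule linear_mapI)
      (use assms in \<open>auto simp: linear_map_def Pi_iff alg_r_distr smult_mult_right\<close>)
qed

lemma linear_map_mult_left:
  assumes "assoc_algebra K A" "a \<in> carrier A" "linear_map K X A f"
  shows "linear_map K X A (\<lambda>x. f x \<otimes>\<^bsub>A\<^esub> a)"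
proof -
  interpret assoc_algebra K A by fact
  show ?thesis
    by (rule linear_mapI)
      (use assms in \<open>auto simp: linear_map_def Pi_iff alg_l_distr smult_mult_left\<close>)
qed

lemma linear_map_scale:
  assumes "module K V" "c \<in> carrier K" "linear_map K X V f"
  shows "linear_map K X V (\<lambda>x. c \<odot>\<^bsub>V\<^esub> f x)"
proof -
  interpret module K V by fact
  show ?thesis
    by (rule linear_mapI)
      (use assms in \<open>auto simp: linear_map_def Pi_iff smult_r_distr smult_assoc1[symmetric] m_comm\<close>)
qed

section \<open>Records with the same underlying module\<close>

text \<open>
  A tensor product depends only on the modules underlying its factors.  This is what allows a tensor
  product of algebras, or a twist, to be used in place of the module that it is built on.
\<close>

definition same_module where
  "same_module V V' \<longleftrightarrow> carrier V = carrier V' \<and> add V = add V' \<and> zero V = zero V' \<and> smult V = smult V'"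

lemma finsum_same_module:
  assumes "same_module U U'"
  shows "finsum U f S = finsum U' f S"
  using assms by (simp add: same_module_def finsum_def finprod_def)

lemma tensor_lift_same_module:
  assumes "same_module U U'"
  shows "tensor_lift K V W U = tensor_lift K V' W' U'"
  using assms
  by (intro ext) (simp add: tensor_lift_def finsum_same_module[OF assms] same_module_def)

lemma tensor_null_same_module:
  assumes "same_module V V'" "same_module W W'"
  shows "tensor_free K V W = tensor_free K V' W'" "tensor_null K V W = tensor_null K V' W'"
proof -
  show "tensor_free K V W = tensor_free K V' W'"
    using assms by (simp add: tensor_free_def same_module_def)
  then show "tensor_null K V W = tensor_null K V' W'"
    using assms by (simp add: tensor_null_def tensor_relations_def same_module_def)
qed

lemma tensor_same_module:
  "\<lbrakk>same_module V V'; same_module W W'\<rbrakk> \<Longrightarrow> tensor K V W = tensor K V' W'"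
  by (simp add: tensor_def tensor_null_same_module[of V V' W W'])

lemma pure_tensor_same_module:
  "\<lbrakk>same_module V V'; same_module W W'\<rbrakk> \<Longrightarrow> pure_tensor K V W = pure_tensor K V' W'"
  by (intro ext) (simp add: pure_tensor_def tensor_null_same_module[of V V' W W'])

lemma linear_map_same_module:
  "\<lbrakk>same_module V V'; same_module W W'\<rbrakk> \<Longrightarrow> linear_map K V W = linear_map K V' W'"
  by (intro ext) (simp add: linear_map_def same_module_def)

lemma bilinear_map_same_module:
  "\<lbrakk>same_module V V'; same_module W W'; same_module U U'\<rbrakk>
    \<Longrightarrow> bilinear_map K V W U = bilinear_map K V' W' U'"
  by (intro ext) (simp add: bilinear_map_def linear_map_def same_module_def)

lemma same_module_refl: "same_module V V"
  by (simp add: same_module_def)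

lemma same_module_module:
  assumes "same_module V V'" "module K V'"
  shows "module K V"
proof -
  interpret module K V' by fact
  have "abelian_group V"
    by (rule abelian_groupI)
      (use assms(1) in \<open>auto simp: same_module_def M.a_ac intro: M.l_neg M.a_inv_closed\<close>)
  then show ?thesis
    by (intro moduleI R.is_cring)
      (use assms(1) in \<open>auto simp: same_module_def smult_l_distr smult_r_distr smult_assoc1\<close>)
qed

section \<open>Tensor products of algebras\<close>

lemma same_module_tensor_algebra: "same_module (tensor_algebra K A B) (tensor K A B)"
  by (simp add: same_module_def tensor_algebra_def Let_def)

lemma tensor_algebra_simps [simp]:
  "carrier (tensor_algebra K A B) = carrier (tensor K A B)"
  "add (tensor_algebra K A B) = add (tensor K A B)"
  "zero (tensor_algebra K A B) = zero (tensor K A B)"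
  "smult (tensor_algebra K A B) = smult (tensor K A B)"
  "\<one>\<^bsub>tensor_algebra K A B\<^esub> = pure_tensor K A B \<one>\<^bsub>A\<^esub> \<one>\<^bsub>B\<^esub>"
  by (simp_all add: tensor_algebra_def Let_def)

lemma tensor_algebra_as_module [simp]:
  "tensor K (tensor_algebra K A B) W = tensor K (tensor K A B) W"
  "tensor K V (tensor_algebra K A B) = tensor K V (tensor K A B)"
  "pure_tensor K (tensor_algebra K A B) W = pure_tensor K (tensor K A B) W"
  "pure_tensor K V (tensor_algebra K A B) = pure_tensor K V (tensor K A B)"
  by (auto intro!: tensor_same_module pure_tensor_same_module same_module_refl same_module_tensor_algebra)

lemma tensor_lift_tensor_algebra [simp]:
  "tensor_lift K V W (tensor_algebra K A B) = tensor_lift K V W (tensor K A B)"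
  "tensor_lift K (tensor_algebra K A B) W = tensor_lift K (tensor K A B) W"
  "tensor_lift K V (tensor_algebra K A B) = tensor_lift K V (tensor K A B)"
  by (auto intro!: ext tensor_lift_same_module[THEN fun_cong, THEN fun_cong] same_module_refl
      same_module_tensor_algebra)

lemma linear_map_tensor_algebra [simp]:
  "linear_map K V (tensor_algebra K A B) = linear_map K V (tensor K A B)"
  "linear_map K (tensor_algebra K A B) W = linear_map K (tensor K A B) W"
  by (auto intro!: linear_map_same_module same_module_refl same_module_tensor_algebra)

lemma bilinear_map_tensor_algebra [simp]:
  "bilinear_map K (tensor_algebra K A B) W U = bilinear_map K (tensor K A B) W U"
  "bilinear_map K V (tensor_algebra K A B) U = bilinear_map K V (tensor K A B) U"
  "bilinear_map K V W (tensor_algebra K A B) = bilinear_map K V W (tensor K A B)"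
  by (auto intro!: bilinear_map_same_module same_module_refl same_module_tensor_algebra)

text \<open>
  Applied backwards, these rules establish linearity in a variable that occurs exactly once in a term,
  as each component does in a Sweedler expression.
\<close>

lemmas linear_intros =
  bilinear_mapI linear_map_ident linear_map_pure_left linear_map_pure_right linear_map_lift_arg
  linear_map_lift_param linear_map_mult_left linear_map_mult_right linear_map_scale
  tensor_lift_closed

locale algebra_pair = A: assoc_algebra K A + B: assoc_algebra K B
  for K :: "('k, 'm) ring_scheme" (structure)
    and A :: "('k, 'a, 'n) module_scheme" and B :: "('k, 'b, 'p) module_scheme"
begin

sublocale module_pair K A B ..

lemmas [simp] = A.module_axioms B.module_axioms A.assoc_algebra_axioms B.assoc_algebra_axioms tensor_module

lemma tensor_mult:
  "x \<otimes>\<^bsub>tensor_algebra K A B\<^esub> y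
    = tensor_lift K A B (tensor K A B) (\<lambda>a b. tensor_lift K A B (tensor K A B)
        (\<lambda>a' b'. pure_tensor K A B (a \<otimes>\<^bsub>A\<^esub> a') (b \<otimes>\<^bsub>B\<^esub> b')) y) x"
  by (simp add: tensor_algebra_def Let_def)

lemma tensor_mult_bilinear:
  "bilinear_map K (tensor K A B) (tensor K A B) (tensor K A B) (mult (tensor_algebra K A B))"
  unfolding tensor_mult[abs_def] by (intro linear_intros) simp_all

lemma tensor_mult_pure [simp]:
  assumes "a \<in> carrier A" "a' \<in> carrier A" "b \<in> carrier B" "b' \<in> carrier B"
  shows "pure_tensor K A B a b \<otimes>\<^bsub>tensor_algebra K A B\<^esub> pure_tensor K A B a' b'
    = pure_tensor K A B (a \<otimes>\<^bsub>A\<^esub> a') (b \<otimes>\<^bsub>B\<^esub> b')"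
proof -
  have "pure_tensor K A B a b \<otimes>\<^bsub>tensor_algebra K A B\<^esub> pure_tensor K A B a' b'
      = tensor_lift K A B (tensor K A B)
          (\<lambda>a' b'. pure_tensor K A B (a \<otimes>\<^bsub>A\<^esub> a') (b \<otimes>\<^bsub>B\<^esub> b')) (pure_tensor K A B a' b')"
    unfolding tensor_mult by (rule tensor_lift_pure; (intro linear_intros)?; simp add: assms)
  also have "\<dots> = pure_tensor K A B (a \<otimes>\<^bsub>A\<^esub> a') (b \<otimes>\<^bsub>B\<^esub> b')"
    by (rule tensor_lift_pure; (intro linear_intros)?; simp add: assms)
  finally show ?thesis .
qed

lemma tensor_mult_closed [simp]:
  "\<lbrakk>x \<in> carrier (tensor K A B); y \<in> carrier (tensor K A B)\<rbrakk>
    \<Longrightarrow> x \<otimes>\<^bsub>tensor_algebra K A B\<^esub> y \<in> carrier (tensor K A B)"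
  by (rule bilinear_map_closed[OF tensor_mult_bilinear])

lemmas tensor_mult_add [simp] =
  linear_map_add[OF bilinear_map_left[OF tensor_mult_bilinear]]
  linear_map_add[OF bilinear_map_right[OF tensor_mult_bilinear]]

lemmas tensor_mult_smult =
  linear_map_smult[OF bilinear_map_left[OF tensor_mult_bilinear]]
  linear_map_smult[OF bilinear_map_right[OF tensor_mult_bilinear]]

lemma tensor_mult_assoc:
  assumes "x \<in> carrier (tensor K A B)" "y \<in> carrier (tensor K A B)" "z \<in> carrier (tensor K A B)"
  shows "x \<otimes>\<^bsub>tensor_algebra K A B\<^esub> y \<otimes>\<^bsub>tensor_algebra K A B\<^esub> z
    = x \<otimes>\<^bsub>tensor_algebra K A B\<^esub> (y \<otimes>\<^bsub>tensor_algebra K A B\<^esub> z)"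
  using assms(1)
proof (induction x rule: tensor_induct)
  case (pure a b)
  note ab = this
  from assms(2) show ?case
  proof (induction y rule: tensor_induct)
    case (pure a' b')
    note ab' = this
    from assms(3) show ?case
      by (induction z rule: tensor_induct) (simp_all add: ab ab' A.alg_assoc B.alg_assoc)
  qed (simp add: ab assms)
qed (simp add: assms)

lemma tensor_one:
  assumes "x \<in> carrier (tensor K A B)"
  shows "pure_tensor K A B \<one>\<^bsub>A\<^esub> \<one>\<^bsub>B\<^esub> \<otimes>\<^bsub>tensor_algebra K A B\<^esub> x = x"
    and "x \<otimes>\<^bsub>tensor_algebra K A B\<^esub> pure_tensor K A B \<one>\<^bsub>A\<^esub> \<one>\<^bsub>B\<^esub> = x"
  using assms by (induction x rule: tensor_induct; simp)+

lemma tensor_algebra_assoc_algebra: "assoc_algebra K (tensor_algebra K A B)"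
proof -
  have mod: "module K (tensor_algebra K A B)"
    using same_module_tensor_algebra tensor_module by (rule same_module_module)
  have "ring (tensor_algebra K A B)"
  proof (rule ringI)
    show "abelian_group (tensor_algebra K A B)"
      using mod by (simp add: module_def)
    show "monoid (tensor_algebra K A B)"
      by (rule monoidI) (simp_all add: tensor_mult_assoc tensor_one)
  qed simp_all
  then show ?thesis
    using mod
    by (intro assoc_algebra.intro assoc_algebra_axioms.intro A.field_axioms)
      (simp_all add: tensor_mult_smult)
qed

end

lemma linear_map_tensor_mult:
  assumes "assoc_algebra K A" "assoc_algebra K B" "t \<in> carrier (tensor K A B)"
    "linear_map K X (tensor K A B) f"
  shows "linear_map K X (tensor K A B) (\<lambda>x. t \<otimes>\<^bsub>tensor_algebra K A B\<^esub> f x)"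
    and "linear_map K X (tensor K A B) (\<lambda>x. f x \<otimes>\<^bsub>tensor_algebra K A B\<^esub> t)"
proof -
  interpret algebra_pair K A B by (intro algebra_pair.intro assms)
  show "linear_map K X (tensor K A B) (\<lambda>x. t \<otimes>\<^bsub>tensor_algebra K A B\<^esub> f x)"
    "linear_map K X (tensor K A B) (\<lambda>x. f x \<otimes>\<^bsub>tensor_algebra K A B\<^esub> t)"
    using linear_map_mult_right[OF tensor_algebra_assoc_algebra, of t X f]
      linear_map_mult_left[OF tensor_algebra_assoc_algebra, of t X f] assms by simp_all
qed

section \<open>Iterated sums over tensor components\<close>

lemma tensor_lift_pure':
  assumes "module K V" "module K W" "module K U" "bilinear_map K V W U \<phi>"
    and "v \<in> carrier V" "w \<in> carrier W"
  shows "tensor_lift K V W U \<phi> (pure_tensor K V W v w) = \<phi> v w"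
  by (rule module_pair.tensor_lift_pure[OF module_pair.intro]) fact+

text \<open>
  Sweedler's notation for a sum over the components of a tensor \<open>t\<close> is the map \<open>tensor_lift\<close>
  applied to \<open>t\<close>; sums over two tensors can be interchanged.
\<close>

lemma tensor_lift_swap:
  assumes mods: "module K V" "module K W" "module K V'" "module K W'" "module K U"
    and outer: "\<And>v w. \<lbrakk>v \<in> carrier V; w \<in> carrier W\<rbrakk> \<Longrightarrow> bilinear_map K V' W' U (\<phi> v w)"
    and inner: "\<And>v' w'. \<lbrakk>v' \<in> carrier V'; w' \<in> carrier W'\<rbrakk>
                  \<Longrightarrow> bilinear_map K V W U (\<lambda>v w. \<phi> v w v' w')"
    and s: "s \<in> carrier (tensor K V W)" and t: "t \<in> carrier (tensor K V' W')"
  shows "tensor_lift K V W U (\<lambda>v w. tensor_lift K V' W' U (\<phi> v w) t) s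
    = tensor_lift K V' W' U (\<lambda>v' w'. tensor_lift K V W U (\<lambda>v w. \<phi> v w v' w') s) t"
proof -
  interpret P: module_pair K V W by (intro module_pair.intro mods)
  have bil1: "bilinear_map K V W U (\<lambda>v w. tensor_lift K V' W' U (\<phi> v w) t)"
    by (intro bilinear_mapI linear_map_lift_param mods t outer bilinear_map_left[OF inner]
        bilinear_map_right[OF inner])
  have bil2: "bilinear_map K V' W' U (\<lambda>v' w'. tensor_lift K V W U (\<lambda>v w. \<phi> v w v' w') s)"
    if "s \<in> carrier (tensor K V W)" for s
    by (intro bilinear_mapI linear_map_lift_param mods that inner bilinear_map_left[OF outer]
        bilinear_map_right[OF outer])
  have lin: "linear_map K (tensor K V W) U
      (\<lambda>s. tensor_lift K V' W' U (\<lambda>v' w'. tensor_lift K V W U (\<lambda>v w. \<phi> v w v' w') s) t)"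
    by (intro linear_map_lift_param mods t P.tensor_module bil2 linear_map_lift_arg inner
        linear_map_ident)
  show ?thesis
  proof (rule P.tensor_map_unique[OF P.tensor_lift_linear[OF mods(5) bil1] lin _ s])
    fix v w assume vw: "v \<in> carrier V" "w \<in> carrier W"
    have "tensor_lift K V' W' U
        (\<lambda>v' w'. tensor_lift K V W U (\<lambda>v w. \<phi> v w v' w') (pure_tensor K V W v w)) t
        = tensor_lift K V' W' U (\<phi> v w) t"
      by (rule tensor_lift_cong) (simp_all add: mods t bil2 vw tensor_lift_pure' inner)
    then show "tensor_lift K V W U (\<lambda>v w. tensor_lift K V' W' U (\<phi> v w) t) (pure_tensor K V W v w)
        = tensor_lift K V' W' U
            (\<lambda>v' w'. tensor_lift K V W U (\<lambda>v w. \<phi> v w v' w') (pure_tensor K V W v w)) t"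
      by (simp add: tensor_lift_pure' mods bil1 vw)
  qed
qed

definition trilinear_map where
  "trilinear_map K U V W X \<phi> \<longleftrightarrow>
     (\<forall>u\<in>carrier U. bilinear_map K V W X (\<phi> u)) \<and>
     (\<forall>v\<in>carrier V. \<forall>w\<in>carrier W. linear_map K U X (\<lambda>u. \<phi> u v w))"

lemma trilinear_mapI:
  assumes "\<And>u. u \<in> carrier U \<Longrightarrow> bilinear_map K V W X (\<phi> u)"
    and "\<And>v w. \<lbrakk>v \<in> carrier V; w \<in> carrier W\<rbrakk> \<Longrightarrow> linear_map K U X (\<lambda>u. \<phi> u v w)"
  shows "trilinear_map K U V W X \<phi>"
  using assms by (auto simp: trilinear_map_def)

lemma trilinear_map_right: "\<lbrakk>trilinear_map K U V W X \<phi>; u \<in> carrier U\<rbrakk> \<Longrightarrow> bilinear_map K V W X (\<phi> u)"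
  by (auto simp: trilinear_map_def)

lemma trilinear_map_left:
  "\<lbrakk>trilinear_map K U V W X \<phi>; w \<in> carrier W\<rbrakk> \<Longrightarrow> bilinear_map K U V X (\<lambda>u v. \<phi> u v w)"
  by (auto simp: trilinear_map_def bilinear_map_def)

lemma
  assumes "bilinear_map K V W U \<phi>"
  shows linear_map_bilinear_left:
      "\<lbrakk>w \<in> carrier W; linear_map K X V f\<rbrakk> \<Longrightarrow> linear_map K X U (\<lambda>x. \<phi> (f x) w)"
    and linear_map_bilinear_right:
      "\<lbrakk>v \<in> carrier V; linear_map K X W g\<rbrakk> \<Longrightarrow> linear_map K X U (\<lambda>x. \<phi> v (g x))"
  using assms
  by (auto intro: linear_map_compose[OF bilinear_map_left] linear_map_compose[OF bilinear_map_right])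

lemma linear_map_trilinear:
  assumes "trilinear_map K U V W Y \<phi>"
  shows "\<lbrakk>v \<in> carrier V; w \<in> carrier W; linear_map K X U f\<rbrakk> \<Longrightarrow> linear_map K X Y (\<lambda>x. \<phi> (f x) v w)"
    and "\<lbrakk>u \<in> carrier U; w \<in> carrier W; linear_map K X V g\<rbrakk> \<Longrightarrow> linear_map K X Y (\<lambda>x. \<phi> u (g x) w)"
    and "\<lbrakk>u \<in> carrier U; v \<in> carrier V; linear_map K X W h\<rbrakk> \<Longrightarrow> linear_map K X Y (\<lambda>x. \<phi> u v (h x))"
  using linear_map_compose[OF bilinear_map_left[OF trilinear_map_left[OF assms]]]
    linear_map_compose[OF bilinear_map_left[OF trilinear_map_right[OF assms]]]
    linear_map_compose[OF bilinear_map_right[OF trilinear_map_right[OF assms]]] by blast+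

text \<open>
  The sum over the components of an element of \<open>U \<otimes> (V \<otimes> W)\<close>; the other bracketing is reached through
  \<open>tensor_assoc\<close>.
\<close>

definition tensor_lift3 where
  "tensor_lift3 K U V W X \<phi> = tensor_lift K U (tensor K V W) X (\<lambda>u. tensor_lift K V W X (\<phi> u))"

context algebra_pair
begin

text \<open>
  \<open>(s t)\<^sub>1 \<otimes> (s t)\<^sub>2 = s\<^sub>1 t\<^sub>1 \<otimes> s\<^sub>2 t\<^sub>2\<close>: a sum over a product of tensors is a double sum.
\<close>

lemma tensor_lift_mult:
  assumes U: "module K U" and \<phi>: "bilinear_map K A B U \<phi>"
    and s: "s \<in> carrier (tensor K A B)" and t: "t \<in> carrier (tensor K A B)"
  shows "tensor_lift K A B U \<phi> (s \<otimes>\<^bsub>tensor_algebra K A B\<^esub> t)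
    = tensor_lift K A B U (\<lambda>a b. tensor_lift K A B U (\<lambda>a' b'. \<phi> (a \<otimes>\<^bsub>A\<^esub> a') (b \<otimes>\<^bsub>B\<^esub> b')) t) s"
proof (rule tensor_map_unique[OF _ _ _ s])
  note lin = linear_intros linear_map_tensor_mult linear_map_bilinear_left[OF \<phi>] linear_map_bilinear_right[OF \<phi>]
  show "linear_map K (tensor K A B) U (\<lambda>s. tensor_lift K A B U \<phi> (s \<otimes>\<^bsub>tensor_algebra K A B\<^esub> t))"
    by (intro lin; simp add: U \<phi> t)
  show "linear_map K (tensor K A B) U (\<lambda>s. tensor_lift K A B U
      (\<lambda>a b. tensor_lift K A B U (\<lambda>a' b'. \<phi> (a \<otimes>\<^bsub>A\<^esub> a') (b \<otimes>\<^bsub>B\<^esub> b')) t) s)"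
    by (intro lin; simp add: U \<phi> t)
  fix a b assume ab: "a \<in> carrier A" "b \<in> carrier B"
  have "tensor_lift K A B U \<phi> (pure_tensor K A B a b \<otimes>\<^bsub>tensor_algebra K A B\<^esub> t)
      = tensor_lift K A B U (\<lambda>a' b'. \<phi> (a \<otimes>\<^bsub>A\<^esub> a') (b \<otimes>\<^bsub>B\<^esub> b')) t"
  proof (rule tensor_map_unique[OF _ _ _ t])
    show "linear_map K (tensor K A B) U
        (\<lambda>t. tensor_lift K A B U \<phi> (pure_tensor K A B a b \<otimes>\<^bsub>tensor_algebra K A B\<^esub> t))"
      by (intro lin; simp add: U \<phi> ab)
    show "linear_map K (tensor K A B) U
        (\<lambda>t. tensor_lift K A B U (\<lambda>a' b'. \<phi> (a \<otimes>\<^bsub>A\<^esub> a') (b \<otimes>\<^bsub>B\<^esub> b')) t)"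
      by (intro lin; simp add: U \<phi> ab)
    fix a' b' assume ab': "a' \<in> carrier A" "b' \<in> carrier B"
    have "tensor_lift K A B U (\<lambda>a' b'. \<phi> (a \<otimes>\<^bsub>A\<^esub> a') (b \<otimes>\<^bsub>B\<^esub> b')) (pure_tensor K A B a' b')
        = \<phi> (a \<otimes>\<^bsub>A\<^esub> a') (b \<otimes>\<^bsub>B\<^esub> b')"
      by (rule tensor_lift_pure; (intro lin)?; simp add: U ab ab')
    then show "tensor_lift K A B U \<phi>
          (pure_tensor K A B a b \<otimes>\<^bsub>tensor_algebra K A B\<^esub> pure_tensor K A B a' b')
        = tensor_lift K A B U (\<lambda>a' b'. \<phi> (a \<otimes>\<^bsub>A\<^esub> a') (b \<otimes>\<^bsub>B\<^esub> b')) (pure_tensor K A B a' b')"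
      by (simp add: ab ab' tensor_lift_pure U \<phi>)
  qed
  also have "\<dots> = tensor_lift K A B U
      (\<lambda>a b. tensor_lift K A B U (\<lambda>a' b'. \<phi> (a \<otimes>\<^bsub>A\<^esub> a') (b \<otimes>\<^bsub>B\<^esub> b')) t) (pure_tensor K A B a b)"
    by (rule tensor_lift_pure[symmetric]; (intro lin)?; simp add: U ab t)
  finally show "tensor_lift K A B U \<phi> (pure_tensor K A B a b \<otimes>\<^bsub>tensor_algebra K A B\<^esub> t)
      = tensor_lift K A B U
          (\<lambda>a b. tensor_lift K A B U (\<lambda>a' b'. \<phi> (a \<otimes>\<^bsub>A\<^esub> a') (b \<otimes>\<^bsub>B\<^esub> b')) t) (pure_tensor K A B a b)" .
qed

end

section \<open>Sweedler calculus in a Hopf algebra\<close>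

context hopf_algebra
begin

sublocale HH: algebra_pair K H H
  by (intro algebra_pair.intro assoc_algebra_axioms)

abbreviation "TT \<equiv> tensor K H H"
abbreviation "HH \<equiv> tensor_algebra K H H"

text \<open>
  The two bracketings of \<open>H \<otimes> H \<otimes> H\<close> as algebras. The rewrites replace the algebra \<open>H \<otimes> H\<close> by its
  underlying module wherever only the latter matters, so that each space has a single name.
\<close>

sublocale HHr: algebra_pair K H HH
  rewrites "tensor K H HH = tensor K H TT" and "pure_tensor K H HH = pure_tensor K H TT"
    and "carrier HH = carrier TT" and "add HH = add TT"
  by (intro algebra_pair.intro assoc_algebra_axioms HH.tensor_algebra_assoc_algebra) simp_all

sublocale HHl: algebra_pair K HH H
  rewrites "tensor K HH H = tensor K TT H" and "pure_tensor K HH H = pure_tensor K TT H"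
    and "carrier HH = carrier TT" and "add HH = add TT"
  by (intro algebra_pair.intro assoc_algebra_axioms HH.tensor_algebra_assoc_algebra) simp_all

abbreviation "Tr \<equiv> tensor K H TT"
abbreviation "Tl \<equiv> tensor K TT H"
abbreviation "HHr \<equiv> tensor_algebra K H HH"
abbreviation "HHl \<equiv> tensor_algebra K HH H"

lemma mult_closed_H [simp]: "\<lbrakk>x \<in> carrier H; y \<in> carrier H\<rbrakk> \<Longrightarrow> x \<otimes>\<^bsub>H\<^esub> y \<in> carrier H"
  by (rule monoid.m_closed[OF ring.is_monoid[OF assoc_algebra_ring[OF assoc_algebra_axioms]]])

lemma smult_closed_H [simp]: "\<lbrakk>c \<in> carrier K; x \<in> carrier H\<rbrakk> \<Longrightarrow> c \<odot>\<^bsub>H\<^esub> x \<in> carrier H"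
  by (rule module.smult_closed[OF assoc_algebra_module[OF assoc_algebra_axioms]])

lemma smult_smult_H:
  "\<lbrakk>c \<in> carrier K; d \<in> carrier K; x \<in> carrier H\<rbrakk>
    \<Longrightarrow> (c \<otimes>\<^bsub>K\<^esub> d) \<odot>\<^bsub>H\<^esub> x = c \<odot>\<^bsub>H\<^esub> (d \<odot>\<^bsub>H\<^esub> x)"
  by (rule module.smult_assoc1[OF assoc_algebra_module[OF assoc_algebra_axioms]])

lemma comult_closed [simp]: "h \<in> carrier H \<Longrightarrow> comult H h \<in> carrier TT"
  by (rule linear_map_closed[OF comult_linear])

lemma antipode_closed [simp]: "h \<in> carrier H \<Longrightarrow> antipode H h \<in> carrier H"
  by (rule linear_map_closed[OF antipode_linear])

lemma counit_closed [simp]: "h \<in> carrier H \<Longrightarrow> counit H h \<in> carrier K"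
  using counit_hom by (auto simp: ring_hom_def)

lemma comult_mult:
  "\<lbrakk>x \<in> carrier H; y \<in> carrier H\<rbrakk> \<Longrightarrow> comult H (x \<otimes>\<^bsub>H\<^esub> y) = comult H x \<otimes>\<^bsub>HH\<^esub> comult H y"
  using ring_hom_mult[OF comult_hom] by simp

lemma comult_one: "comult H \<one>\<^bsub>H\<^esub> = pure_tensor K H H \<one>\<^bsub>H\<^esub> \<one>\<^bsub>H\<^esub>"
  using ring_hom_one[OF comult_hom] by simp

lemma linear_map_comult:
  "linear_map K X H f \<Longrightarrow> linear_map K X TT (\<lambda>x. comult H (f x))"
  by (rule linear_map_compose[OF comult_linear])

lemma linear_map_antipode:
  "linear_map K X H f \<Longrightarrow> linear_map K X H (\<lambda>x. antipode H (f x))"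
  by (rule linear_map_compose[OF antipode_linear])

lemma linear_map_counit:
  assumes "module K V" "v \<in> carrier V" "linear_map K X H f"
  shows "linear_map K X V (\<lambda>x. counit H (f x) \<odot>\<^bsub>V\<^esub> v)"
proof -
  interpret V: module K V by fact
  show ?thesis
    by (rule linear_mapI)
      (use assms ring_hom_add[OF counit_hom] in
        \<open>auto simp: linear_map_def Pi_iff counit_smult V.smult_l_distr V.smult_assoc1\<close>)
qed

lemmas hopf_linear_intros =
  trilinear_mapI linear_intros linear_map_tensor_mult linear_map_comult linear_map_antipode linear_map_counit
  mult_closed_H smult_closed_H

lemma comult_left_pure: 
  "\<lbrakk>a \<in> carrier H; b \<in> carrier H\<rbrakk>
    \<Longrightarrow> comult_left K H (pure_tensor K H H a b) = pure_tensor K TT H (comult H a) b"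
  unfolding comult_left_def tensor_map_def
  by (rule tensor_lift_pure'; (intro hopf_linear_intros)?; simp)

lemma comult_left_linear: "linear_map K TT Tl (comult_left K H)"
  unfolding comult_left_def tensor_map_def
  by (intro hopf_linear_intros; simp)

lemma comult_right_pure:
  "\<lbrakk>a \<in> carrier H; b \<in> carrier H\<rbrakk>
    \<Longrightarrow> comult_right K H (pure_tensor K H H a b) = pure_tensor K H TT a (comult H b)"
  unfolding comult_right_def tensor_map_def
  by (rule tensor_lift_pure'; (intro hopf_linear_intros)?; simp)

lemma comult_right_linear: "linear_map K TT Tr (comult_right K H)"
  unfolding comult_right_def tensor_map_def
  by (intro hopf_linear_intros; simp)

lemma tensor_assoc_pure:
  assumes "a \<in> carrier H" "b \<in> carrier H" "c \<in> carrier H"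
  shows "tensor_assoc K H H H (pure_tensor K TT H (pure_tensor K H H a b) c)
    = pure_tensor K H TT a (pure_tensor K H H b c)"
proof -
  have "tensor_assoc K H H H (pure_tensor K TT H (pure_tensor K H H a b) c)
      = tensor_lift K H H Tr (\<lambda>u v. pure_tensor K H TT u (pure_tensor K H H v c)) (pure_tensor K H H a b)"
    unfolding tensor_assoc_def Let_def
    by (rule tensor_lift_pure'; (intro hopf_linear_intros)?; simp add: assms)
  also have "\<dots> = pure_tensor K H TT a (pure_tensor K H H b c)"
    by (rule tensor_lift_pure'; (intro hopf_linear_intros)?; simp add: assms)
  finally show ?thesis .
qed

lemma tensor_assoc_linear: "linear_map K Tl Tr (tensor_assoc K H H H)"
  unfolding tensor_assoc_def Let_def
  by (intro hopf_linear_intros; simp)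

lemmas hopf_map_closed [simp] =
  linear_map_closed[OF comult_left_linear] linear_map_closed[OF comult_right_linear]
  linear_map_closed[OF tensor_assoc_linear]

lemmas hopf_map_add =
  linear_map_add[OF comult_left_linear] linear_map_add[OF comult_right_linear]
  linear_map_add[OF tensor_assoc_linear] linear_map_add[OF comult_linear]

lemma tensor_assoc_mult:
  assumes x: "x \<in> carrier Tl" and y: "y \<in> carrier Tl"
  shows "tensor_assoc K H H H (x \<otimes>\<^bsub>HHl\<^esub> y)
    = tensor_assoc K H H H x \<otimes>\<^bsub>HHr\<^esub> tensor_assoc K H H H y"
proof -
  have pp: "tensor_assoc K H H H (pure_tensor K TT H (s \<otimes>\<^bsub>HH\<^esub> t) (c \<otimes>\<^bsub>H\<^esub> d))
      = tensor_assoc K H H H (pure_tensor K TT H s c) \<otimes>\<^bsub>HHr\<^esub> tensor_assoc K H H H (pure_tensor K TT H t d)"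
    if s: "s \<in> carrier TT" and t: "t \<in> carrier TT" and c: "c \<in> carrier H" and d: "d \<in> carrier H" for s t c d
    using s
  proof (induction s rule: HH.tensor_induct)
    case (pure a b)
    note ab = this
    from t show ?case
    proof (induction t rule: HH.tensor_induct)
      case (add t t')
      then show ?case
        using ab c d by (simp add: HHl.pure_tensor_add HH.pure_tensor_add hopf_map_add)
    qed (simp add: ab c d tensor_assoc_pure)
  next
    case (add s s')
    then show ?case
      using t c d by (simp add: HHl.pure_tensor_add HH.pure_tensor_add hopf_map_add)
  qed
  from x show ?thesis
  proof (induction x rule: HHl.tensor_induct)
    case (pure s c)
    note sc = this
    from y show ?case
      by (induction y rule: HHl.tensor_induct) (use sc in \<open>simp_all add: pp hopf_map_add\<close>)
  qed (simp add: y hopf_map_add)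
qed

lemma comult_left_mult:
  assumes "x \<in> carrier TT" and y: "y \<in> carrier TT"
  shows "comult_left K H (x \<otimes>\<^bsub>HH\<^esub> y) = comult_left K H x \<otimes>\<^bsub>HHl\<^esub> comult_left K H y"
  using assms(1)
proof (induction x rule: HH.tensor_induct)
  case (pure a b)
  from y show ?case
    by (induction y rule: HH.tensor_induct) (use pure in \<open>simp_all add: comult_left_pure comult_mult hopf_map_add\<close>)
qed (simp add: y hopf_map_add)

lemma comult_right_mult:
  assumes "x \<in> carrier TT" and y: "y \<in> carrier TT"
  shows "comult_right K H (x \<otimes>\<^bsub>HH\<^esub> y) = comult_right K H x \<otimes>\<^bsub>HHr\<^esub> comult_right K H y"
  using assms(1)
proof (induction x rule: HH.tensor_induct)
  case (pure a b)
  from y show ?case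
    by (induction y rule: HH.tensor_induct) (use pure in \<open>simp_all add: comult_right_pure comult_mult hopf_map_add\<close>)
qed (simp add: y hopf_map_add)

context
  fixes X :: "('k, 'x, 'r) module_scheme" and \<phi> :: "'h \<Rightarrow> 'h \<Rightarrow> 'h \<Rightarrow> 'x"
  assumes X: "module K X" and \<phi>: "trilinear_map K H H H X \<phi>"
begin

lemmas lin_\<phi> = hopf_linear_intros linear_map_trilinear[OF \<phi>]

lemma tensor_lift3_linear: "linear_map K Tr X (tensor_lift3 K H H H X \<phi>)"
  unfolding tensor_lift3_def by (intro lin_\<phi>; simp add: X)

lemma tensor_lift3_pure:
  "\<lbrakk>a \<in> carrier H; s \<in> carrier TT\<rbrakk>
    \<Longrightarrow> tensor_lift3 K H H H X \<phi> (pure_tensor K H TT a s) = tensor_lift K H H X (\<phi> a) s"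
  unfolding tensor_lift3_def by (rule tensor_lift_pure'; (intro lin_\<phi>)?; simp add: X)

lemma tensor_lift3_assoc_pure:
  assumes "s \<in> carrier TT" "c \<in> carrier H"
  shows "tensor_lift3 K H H H X \<phi> (tensor_assoc K H H H (pure_tensor K TT H s c))
    = tensor_lift K H H X (\<lambda>a b. \<phi> a b c) s"
proof (rule HH.tensor_map_unique[OF _ _ _ assms(1)])
  show "linear_map K TT X (\<lambda>s. tensor_lift3 K H H H X \<phi> (tensor_assoc K H H H (pure_tensor K TT H s c)))"
    by (rule linear_map_compose[OF tensor_lift3_linear] linear_map_compose[OF tensor_assoc_linear])+
      (intro lin_\<phi>; simp add: assms)
  show "linear_map K TT X (tensor_lift K H H X (\<lambda>a b. \<phi> a b c))"
    by (intro lin_\<phi>; simp add: X assms)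
  fix a b assume ab: "a \<in> carrier H" "b \<in> carrier H"
  have "tensor_lift K H H X (\<phi> a) (pure_tensor K H H b c) = \<phi> a b c"
    by (rule tensor_lift_pure'; (intro lin_\<phi>)?; simp add: X assms ab)
  moreover have "tensor_lift K H H X (\<lambda>a b. \<phi> a b c) (pure_tensor K H H a b) = \<phi> a b c"
    by (rule tensor_lift_pure'; (intro lin_\<phi>)?; simp add: X assms ab)
  ultimately show "tensor_lift3 K H H H X \<phi>
        (tensor_assoc K H H H (pure_tensor K TT H (pure_tensor K H H a b) c))
      = tensor_lift K H H X (\<lambda>a b. \<phi> a b c) (pure_tensor K H H a b)"
    by (simp add: tensor_assoc_pure ab assms tensor_lift3_pure)
qed

lemma tensor_lift3_comult_right:
  assumes t: "t \<in> carrier TT"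
  shows "tensor_lift3 K H H H X \<phi> (comult_right K H t)
    = tensor_lift K H H X (\<lambda>a b. tensor_lift K H H X (\<phi> a) (comult H b)) t"
proof (rule HH.tensor_map_unique[OF _ _ _ t])
  show "linear_map K TT X (\<lambda>t. tensor_lift3 K H H H X \<phi> (comult_right K H t))"
    by (rule linear_map_compose[OF tensor_lift3_linear comult_right_linear])
  show lin: "linear_map K TT X (tensor_lift K H H X (\<lambda>a b. tensor_lift K H H X (\<phi> a) (comult H b)))"
    by (intro lin_\<phi>; simp add: X)
  fix a b assume ab: "a \<in> carrier H" "b \<in> carrier H"
  have "tensor_lift K H H X (\<lambda>a b. tensor_lift K H H X (\<phi> a) (comult H b)) (pure_tensor K H H a b)
      = tensor_lift K H H X (\<phi> a) (comult H b)"
    by (rule tensor_lift_pure'; (intro lin_\<phi>)?; simp add: X ab)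
  then show "tensor_lift3 K H H H X \<phi> (comult_right K H (pure_tensor K H H a b))
      = tensor_lift K H H X (\<lambda>a b. tensor_lift K H H X (\<phi> a) (comult H b)) (pure_tensor K H H a b)"
    by (simp add: comult_right_pure ab tensor_lift3_pure)
qed

lemma tensor_lift3_comult_left:
  assumes t: "t \<in> carrier TT"
  shows "tensor_lift3 K H H H X \<phi> (tensor_assoc K H H H (comult_left K H t))
    = tensor_lift K H H X (\<lambda>a b. tensor_lift K H H X (\<lambda>p q. \<phi> p q b) (comult H a)) t"
proof (rule HH.tensor_map_unique[OF _ _ _ t])
  show "linear_map K TT X (\<lambda>t. tensor_lift3 K H H H X \<phi> (tensor_assoc K H H H (comult_left K H t)))"
    by (intro linear_map_compose[OF tensor_lift3_linear] linear_map_compose[OF tensor_assoc_linear]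
        comult_left_linear)
  show lin: "linear_map K TT X
      (tensor_lift K H H X (\<lambda>a b. tensor_lift K H H X (\<lambda>p q. \<phi> p q b) (comult H a)))"
    by (intro lin_\<phi>; simp add: X)
  fix a b assume ab: "a \<in> carrier H" "b \<in> carrier H"
  have "tensor_lift K H H X (\<lambda>a b. tensor_lift K H H X (\<lambda>p q. \<phi> p q b) (comult H a))
        (pure_tensor K H H a b)
      = tensor_lift K H H X (\<lambda>p q. \<phi> p q b) (comult H a)"
    by (rule tensor_lift_pure'; (intro lin_\<phi>)?; simp add: X ab)
  then show "tensor_lift3 K H H H X \<phi>
        (tensor_assoc K H H H (comult_left K H (pure_tensor K H H a b)))
      = tensor_lift K H H X (\<lambda>a b. tensor_lift K H H X (\<lambda>p q. \<phi> p q b) (comult H a))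
          (pure_tensor K H H a b)"
    by (simp add: comult_left_pure ab tensor_lift3_assoc_pure)
qed

text \<open>
  Coassociativity in Sweedler's notation: a trilinear sum over \<open>h\<^sub>1 \<otimes> h\<^sub>2 \<otimes> h\<^sub>3\<close> does not depend on
  which component of \<open>\<Delta> h\<close> is split.
\<close>

lemma coassoc_sum:
  assumes "h \<in> carrier H"
  shows "tensor_lift K H H X (\<lambda>a b. tensor_lift K H H X (\<lambda>p q. \<phi> p q b) (comult H a)) (comult H h)
    = tensor_lift K H H X (\<lambda>a b. tensor_lift K H H X (\<phi> a) (comult H b)) (comult H h)"
  using tensor_lift3_comult_left[of "comult H h"] tensor_lift3_comult_right[of "comult H h"]
    coassoc[OF assms] assms by simp

lemma tensor_lift3_mult:
  assumes x: "x \<in> carrier Tr" and y: "y \<in> carrier Tr"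
  shows "tensor_lift3 K H H H X \<phi> (x \<otimes>\<^bsub>HHr\<^esub> y)
    = tensor_lift3 K H H H X (\<lambda>a b c. tensor_lift3 K H H H X
        (\<lambda>a' b' c'. \<phi> (a \<otimes>\<^bsub>H\<^esub> a') (b \<otimes>\<^bsub>H\<^esub> b') (c \<otimes>\<^bsub>H\<^esub> c')) y) x"
proof -
  let ?L = "tensor_lift K H H X" and ?L' = "tensor_lift K H TT X"
  have bil: "bilinear_map K H TT X (\<lambda>a. ?L (\<phi> a))"
    by (intro lin_\<phi>; simp add: X)
  have "?L' (\<lambda>a. ?L (\<phi> a)) (x \<otimes>\<^bsub>HHr\<^esub> y)
      = ?L' (\<lambda>a s. ?L' (\<lambda>a' s'. ?L (\<phi> (a \<otimes>\<^bsub>H\<^esub> a')) (s \<otimes>\<^bsub>HH\<^esub> s')) y) x"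
    using HHr.tensor_lift_mult[OF X, of "\<lambda>a. ?L (\<phi> a)"] bil x y by simp
  \<comment> \<open>The inner product is expanded and its first sum moved out past the sum over \<open>y\<close>.\<close>
  also have "\<dots> = ?L' (\<lambda>a s. ?L (\<lambda>b c. ?L' (\<lambda>a' s'.
      ?L (\<lambda>b' c'. \<phi> (a \<otimes>\<^bsub>H\<^esub> a') (b \<otimes>\<^bsub>H\<^esub> b') (c \<otimes>\<^bsub>H\<^esub> c')) s') y) s) x"
  proof (rule tensor_lift_cong)
    fix a s assume as: "a \<in> carrier H" "s \<in> carrier TT"
    have "?L' (\<lambda>a' s'. ?L (\<phi> (a \<otimes>\<^bsub>H\<^esub> a')) (s \<otimes>\<^bsub>HH\<^esub> s')) y
        = ?L' (\<lambda>a' s'. ?L (\<lambda>b c. ?L (\<lambda>b' c'. \<phi> (a \<otimes>\<^bsub>H\<^esub> a') (b \<otimes>\<^bsub>H\<^esub> b') (c \<otimes>\<^bsub>H\<^esub> c')) s') s) y"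
    proof (rule tensor_lift_cong)
      fix a' s' assume as': "a' \<in> carrier H" "s' \<in> carrier TT"
      show "?L (\<phi> (a \<otimes>\<^bsub>H\<^esub> a')) (s \<otimes>\<^bsub>HH\<^esub> s')
          = ?L (\<lambda>b c. ?L (\<lambda>b' c'. \<phi> (a \<otimes>\<^bsub>H\<^esub> a') (b \<otimes>\<^bsub>H\<^esub> b') (c \<otimes>\<^bsub>H\<^esub> c')) s') s"
        by (rule HH.tensor_lift_mult[OF X]) (simp_all add: as as' trilinear_map_right[OF \<phi>])
    next
      show "bilinear_map K H TT X (\<lambda>a' s'. ?L (\<phi> (a \<otimes>\<^bsub>H\<^esub> a')) (s \<otimes>\<^bsub>HH\<^esub> s'))"
        by (intro lin_\<phi>; simp add: X as)
    qed (simp_all add: X y)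
    also have "\<dots> = ?L (\<lambda>b c. ?L' (\<lambda>a' s'.
        ?L (\<lambda>b' c'. \<phi> (a \<otimes>\<^bsub>H\<^esub> a') (b \<otimes>\<^bsub>H\<^esub> b') (c \<otimes>\<^bsub>H\<^esub> c')) s') y) s"
      by (rule tensor_lift_swap; (intro lin_\<phi>)?; simp add: X as y)
    finally show "?L' (\<lambda>a' s'. ?L (\<phi> (a \<otimes>\<^bsub>H\<^esub> a')) (s \<otimes>\<^bsub>HH\<^esub> s')) y
        = ?L (\<lambda>b c. ?L' (\<lambda>a' s'.
            ?L (\<lambda>b' c'. \<phi> (a \<otimes>\<^bsub>H\<^esub> a') (b \<otimes>\<^bsub>H\<^esub> b') (c \<otimes>\<^bsub>H\<^esub> c')) s') y) s" .
  next
    show "bilinear_map K H TT X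
        (\<lambda>a s. ?L' (\<lambda>a' s'. ?L (\<phi> (a \<otimes>\<^bsub>H\<^esub> a')) (s \<otimes>\<^bsub>HH\<^esub> s')) y)"
      by (intro lin_\<phi>; simp add: X y)
  qed (simp_all add: X x)
  finally show ?thesis
    unfolding tensor_lift3_def .
qed

end

section \<open>The antipode reverses products\<close>

lemma counit_one: "counit H \<one>\<^bsub>H\<^esub> = \<one>\<^bsub>K\<^esub>"
  by (rule ring_hom_one[OF counit_hom])

lemma counit_mult:
  "\<lbrakk>x \<in> carrier H; y \<in> carrier H\<rbrakk> \<Longrightarrow> counit H (x \<otimes>\<^bsub>H\<^esub> y) = counit H x \<otimes>\<^bsub>K\<^esub> counit H y"
  by (rule ring_hom_mult[OF counit_hom])

lemma smult_one_mult:
  assumes "c \<in> carrier K" "x \<in> carrier H"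
  shows "(c \<odot>\<^bsub>H\<^esub> \<one>\<^bsub>H\<^esub>) \<otimes>\<^bsub>H\<^esub> x = c \<odot>\<^bsub>H\<^esub> x" "x \<otimes>\<^bsub>H\<^esub> (c \<odot>\<^bsub>H\<^esub> \<one>\<^bsub>H\<^esub>) = c \<odot>\<^bsub>H\<^esub> x"
  using assms by (simp_all add: smult_mult_left smult_mult_right)

lemma antipode_one: "antipode H \<one>\<^bsub>H\<^esub> = \<one>\<^bsub>H\<^esub>"
proof -
  have "tensor_lift K H H H (\<lambda>x y. antipode H x \<otimes>\<^bsub>H\<^esub> y) (pure_tensor K H H \<one>\<^bsub>H\<^esub> \<one>\<^bsub>H\<^esub>)
      = antipode H \<one>\<^bsub>H\<^esub> \<otimes>\<^bsub>H\<^esub> \<one>\<^bsub>H\<^esub>"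
    by (rule tensor_lift_pure'; (intro hopf_linear_intros)?; simp)
  then show ?thesis
    using antipode_left[of "\<one>\<^bsub>H\<^esub>"] by (simp add: comult_one counit_one)
qed

text \<open>
  In \<open>S(h\<^sub>1 g\<^sub>1) h\<^sub>2 g\<^sub>2 S(g\<^sub>3)\<close> the last two factors collapse to \<open>\<epsilon>(g\<^sub>2)\<close>, which leaves \<open>S(h\<^sub>1 g) h\<^sub>2\<close>,
  and the first three collapse to \<open>\<epsilon>(h g\<^sub>1)\<close>, which leaves \<open>\<epsilon>(h) S(g)\<close>.
\<close>

lemma antipode_mult_left_cancel:
  assumes g: "g \<in> carrier H" and h: "h \<in> carrier H"
  shows "tensor_lift K H H H (\<lambda>p q. antipode H (p \<otimes>\<^bsub>H\<^esub> g) \<otimes>\<^bsub>H\<^esub> q) (comult H h)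
    = counit H h \<odot>\<^bsub>H\<^esub> antipode H g"
proof -
  let ?L = "tensor_lift K H H H" and ?S = "antipode H"
  let ?\<phi> = "\<lambda>a b c. ?L (\<lambda>p q. ?S (p \<otimes>\<^bsub>H\<^esub> a) \<otimes>\<^bsub>H\<^esub> (q \<otimes>\<^bsub>H\<^esub> (b \<otimes>\<^bsub>H\<^esub> ?S c))) (comult H h)"
  note lin = hopf_linear_intros
  have \<phi>: "trilinear_map K H H H H ?\<phi>"
    by (intro lin; simp add: h)
  have "?L (\<lambda>p q. ?S (p \<otimes>\<^bsub>H\<^esub> g) \<otimes>\<^bsub>H\<^esub> q) (comult H h)
      = ?L (\<lambda>p q. ?S (p \<otimes>\<^bsub>H\<^esub> ?L (\<lambda>a b. counit H b \<odot>\<^bsub>H\<^esub> a) (comult H g)) \<otimes>\<^bsub>H\<^esub> q) (comult H h)"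
    using counit_right[OF g] by (simp add: counit_right_def)
  also have "\<dots> = ?L (\<lambda>a b. ?L (\<lambda>p q. ?S (p \<otimes>\<^bsub>H\<^esub> (counit H b \<odot>\<^bsub>H\<^esub> a)) \<otimes>\<^bsub>H\<^esub> q) (comult H h)) (comult H g)"
    by (rule linear_map_tensor_lift[where g = "\<lambda>x. ?L (\<lambda>p q. ?S (p \<otimes>\<^bsub>H\<^esub> x) \<otimes>\<^bsub>H\<^esub> q) (comult H h)"];
        (intro lin)?; simp add: g h)
  also have "\<dots> = ?L (\<lambda>a b. ?L (?\<phi> a) (comult H b)) (comult H g)"
  proof (rule tensor_lift_cong)
    fix a b assume ab: "a \<in> carrier H" "b \<in> carrier H"
    have "?L (?\<phi> a) (comult H b)
        = ?L (\<lambda>p q. ?S (p \<otimes>\<^bsub>H\<^esub> a) \<otimes>\<^bsub>H\<^esub> (q \<otimes>\<^bsub>H\<^esub> ?L (\<lambda>b c. b \<otimes>\<^bsub>H\<^esub> ?S c) (comult H b))) (comult H h)"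
      by (rule linear_map_tensor_lift[symmetric, where
            g = "\<lambda>x. ?L (\<lambda>p q. ?S (p \<otimes>\<^bsub>H\<^esub> a) \<otimes>\<^bsub>H\<^esub> (q \<otimes>\<^bsub>H\<^esub> x)) (comult H h)"];
          (intro lin)?; simp add: ab h)
    also have "\<dots> = ?L (\<lambda>p q. ?S (p \<otimes>\<^bsub>H\<^esub> (counit H b \<odot>\<^bsub>H\<^esub> a)) \<otimes>\<^bsub>H\<^esub> q) (comult H h)"
      unfolding antipode_right[OF ab(2)]
      by (rule tensor_lift_cong; (intro lin)?;
          simp add: ab h smult_one_mult smult_mult_right smult_mult_left linear_map_smult[OF antipode_linear])
    finally show "?L (\<lambda>p q. ?S (p \<otimes>\<^bsub>H\<^esub> (counit H b \<odot>\<^bsub>H\<^esub> a)) \<otimes>\<^bsub>H\<^esub> q) (comult H h)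
        = ?L (?\<phi> a) (comult H b)" ..
  qed ((intro lin)?; simp add: g h)+
  also have "\<dots> = ?L (\<lambda>a b. ?L (\<lambda>p q. ?\<phi> p q b) (comult H a)) (comult H g)"
    by (rule coassoc_sum[symmetric]) (simp_all add: \<phi> g)
  also have "\<dots> = ?L (\<lambda>a b. counit H h \<odot>\<^bsub>H\<^esub> ?S (counit H a \<odot>\<^bsub>H\<^esub> b)) (comult H g)"
  proof (rule tensor_lift_cong)
    fix a b assume ab: "a \<in> carrier H" "b \<in> carrier H"
    have "?L (\<lambda>p q. ?\<phi> p q b) (comult H a)
        = ?L (\<lambda>p q. ?L (\<lambda>p' q'. ?S (p \<otimes>\<^bsub>H\<^esub> p') \<otimes>\<^bsub>H\<^esub> (q \<otimes>\<^bsub>H\<^esub> (q' \<otimes>\<^bsub>H\<^esub> ?S b))) (comult H a)) (comult H h)"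
      by (rule tensor_lift_swap; (intro lin)?; simp add: ab h)
    also have "\<dots> = ?L (\<lambda>p q. ?L (\<lambda>p' q'. (?S (p \<otimes>\<^bsub>H\<^esub> p') \<otimes>\<^bsub>H\<^esub> (q \<otimes>\<^bsub>H\<^esub> q')) \<otimes>\<^bsub>H\<^esub> ?S b) (comult H a)) (comult H h)"
    proof (rule tensor_lift_cong)
      fix p q assume pq: "p \<in> carrier H" "q \<in> carrier H"
      show "?L (\<lambda>p' q'. ?S (p \<otimes>\<^bsub>H\<^esub> p') \<otimes>\<^bsub>H\<^esub> (q \<otimes>\<^bsub>H\<^esub> (q' \<otimes>\<^bsub>H\<^esub> ?S b))) (comult H a)
          = ?L (\<lambda>p' q'. (?S (p \<otimes>\<^bsub>H\<^esub> p') \<otimes>\<^bsub>H\<^esub> (q \<otimes>\<^bsub>H\<^esub> q')) \<otimes>\<^bsub>H\<^esub> ?S b) (comult H a)"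
        by (rule tensor_lift_cong; (intro lin)?; simp add: ab pq alg_assoc)
    qed ((intro lin)?; simp add: ab h)+
    also have "\<dots> = ?L (\<lambda>p q. (?S p \<otimes>\<^bsub>H\<^esub> q) \<otimes>\<^bsub>H\<^esub> ?S b) (comult H h \<otimes>\<^bsub>HH\<^esub> comult H a)"
      by (rule HH.tensor_lift_mult[symmetric]; (intro lin)?; simp add: ab h)
    also have "\<dots> = ?L (\<lambda>p q. ?S p \<otimes>\<^bsub>H\<^esub> q) (comult H (h \<otimes>\<^bsub>H\<^esub> a)) \<otimes>\<^bsub>H\<^esub> ?S b"
      unfolding comult_mult[OF h ab(1), symmetric]
      by (rule linear_map_tensor_lift[symmetric, where g = "\<lambda>x. x \<otimes>\<^bsub>H\<^esub> ?S b"]; (intro lin)?; simp add: ab h)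
    also have "\<dots> = counit H h \<odot>\<^bsub>H\<^esub> ?S (counit H a \<odot>\<^bsub>H\<^esub> b)"
      using ab h by (simp add: antipode_left smult_one_mult counit_mult smult_smult_H smult_mult_left
          linear_map_smult[OF antipode_linear])
    finally show "?L (\<lambda>p q. ?\<phi> p q b) (comult H a) = counit H h \<odot>\<^bsub>H\<^esub> ?S (counit H a \<odot>\<^bsub>H\<^esub> b)" .
  qed ((intro lin)?; simp add: g h)+
  also have "\<dots> = counit H h \<odot>\<^bsub>H\<^esub> ?S (?L (\<lambda>a b. counit H a \<odot>\<^bsub>H\<^esub> b) (comult H g))"
    by (rule linear_map_tensor_lift[symmetric, where g = "\<lambda>x. counit H h \<odot>\<^bsub>H\<^esub> ?S x"];
        (intro lin)?; simp add: g h)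
  also have "\<dots> = counit H h \<odot>\<^bsub>H\<^esub> ?S g"
    using counit_left[OF g] by (simp add: counit_left_def)
  finally show ?thesis .
qed

text \<open>
  In \<open>S(h\<^sub>1 g) h\<^sub>2 S(h\<^sub>3)\<close> the last two factors collapse to \<open>\<epsilon>(h\<^sub>2)\<close>, which leaves \<open>S(h g)\<close>, and the
  first two collapse to \<open>\<epsilon>(h\<^sub>1) S(g)\<close> by \<open>antipode_mult_left_cancel\<close>, which leaves \<open>S(g) S(h)\<close>.
\<close>

lemma antipode_mult:
  assumes g: "g \<in> carrier H" and h: "h \<in> carrier H"
  shows "antipode H (h \<otimes>\<^bsub>H\<^esub> g) = antipode H g \<otimes>\<^bsub>H\<^esub> antipode H h"
proof -
  let ?L = "tensor_lift K H H H" and ?S = "antipode H"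
  let ?\<phi> = "\<lambda>a b c. ?S (a \<otimes>\<^bsub>H\<^esub> g) \<otimes>\<^bsub>H\<^esub> (b \<otimes>\<^bsub>H\<^esub> ?S c)"
  note lin = hopf_linear_intros
  have \<phi>: "trilinear_map K H H H H ?\<phi>"
    by (intro lin; simp add: g)
  have "?S (h \<otimes>\<^bsub>H\<^esub> g) = ?S (?L (\<lambda>a b. counit H b \<odot>\<^bsub>H\<^esub> a) (comult H h) \<otimes>\<^bsub>H\<^esub> g)"
    using counit_right[OF h] by (simp add: counit_right_def)
  also have "\<dots> = ?L (\<lambda>a b. ?S ((counit H b \<odot>\<^bsub>H\<^esub> a) \<otimes>\<^bsub>H\<^esub> g)) (comult H h)"
    by (rule linear_map_tensor_lift[where g = "\<lambda>x. ?S (x \<otimes>\<^bsub>H\<^esub> g)"]; (intro lin)?; simp add: g h)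
  also have "\<dots> = ?L (\<lambda>a b. ?L (?\<phi> a) (comult H b)) (comult H h)"
  proof (rule tensor_lift_cong)
    fix a b assume ab: "a \<in> carrier H" "b \<in> carrier H"
    have "?L (?\<phi> a) (comult H b)
        = ?S (a \<otimes>\<^bsub>H\<^esub> g) \<otimes>\<^bsub>H\<^esub> ?L (\<lambda>b c. b \<otimes>\<^bsub>H\<^esub> ?S c) (comult H b)"
      by (rule linear_map_tensor_lift[symmetric, where g = "\<lambda>x. ?S (a \<otimes>\<^bsub>H\<^esub> g) \<otimes>\<^bsub>H\<^esub> x"];
          (intro lin)?; simp add: ab g)
    also have "\<dots> = ?S ((counit H b \<odot>\<^bsub>H\<^esub> a) \<otimes>\<^bsub>H\<^esub> g)"
      using ab g by (simp add: antipode_right smult_one_mult smult_mult_left linear_map_smult[OF antipode_linear])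
    finally show "?S ((counit H b \<odot>\<^bsub>H\<^esub> a) \<otimes>\<^bsub>H\<^esub> g) = ?L (?\<phi> a) (comult H b)" ..
  qed ((intro lin)?; simp add: g h)+
  also have "\<dots> = ?L (\<lambda>a b. ?L (\<lambda>p q. ?\<phi> p q b) (comult H a)) (comult H h)"
    by (rule coassoc_sum[symmetric]) (simp_all add: \<phi> h)
  also have "\<dots> = ?L (\<lambda>a b. ?S g \<otimes>\<^bsub>H\<^esub> ?S (counit H a \<odot>\<^bsub>H\<^esub> b)) (comult H h)"
  proof (rule tensor_lift_cong)
    fix a b assume ab: "a \<in> carrier H" "b \<in> carrier H"
    have "?L (\<lambda>p q. ?\<phi> p q b) (comult H a)
        = ?L (\<lambda>p q. (?S (p \<otimes>\<^bsub>H\<^esub> g) \<otimes>\<^bsub>H\<^esub> q) \<otimes>\<^bsub>H\<^esub> ?S b) (comult H a)"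
      by (rule tensor_lift_cong; (intro lin)?; simp add: ab g alg_assoc)
    also have "\<dots> = ?L (\<lambda>p q. ?S (p \<otimes>\<^bsub>H\<^esub> g) \<otimes>\<^bsub>H\<^esub> q) (comult H a) \<otimes>\<^bsub>H\<^esub> ?S b"
      by (rule linear_map_tensor_lift[symmetric, where g = "\<lambda>x. x \<otimes>\<^bsub>H\<^esub> ?S b"]; (intro lin)?; simp add: ab g)
    also have "\<dots> = ?S g \<otimes>\<^bsub>H\<^esub> ?S (counit H a \<odot>\<^bsub>H\<^esub> b)"
      using ab g by (simp add: antipode_mult_left_cancel smult_mult_left smult_mult_right
          linear_map_smult[OF antipode_linear])
    finally show "?L (\<lambda>p q. ?\<phi> p q b) (comult H a) = ?S g \<otimes>\<^bsub>H\<^esub> ?S (counit H a \<odot>\<^bsub>H\<^esub> b)" .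
  qed ((intro lin)?; simp add: g h)+
  also have "\<dots> = ?S g \<otimes>\<^bsub>H\<^esub> ?S (?L (\<lambda>a b. counit H a \<odot>\<^bsub>H\<^esub> b) (comult H h))"
    by (rule linear_map_tensor_lift[symmetric, where g = "\<lambda>x. ?S g \<otimes>\<^bsub>H\<^esub> ?S x"];
        (intro lin)?; simp add: g h)
  also have "\<dots> = ?S g \<otimes>\<^bsub>H\<^esub> ?S h"
    using counit_left[OF h] by (simp add: counit_left_def)
  finally show ?thesis .
qed

end

section \<open>Consequences of the cocycle identity\<close>

text \<open>
  The cocycle identity has the form \<open>p x = q y\<close> with all four factors invertible; these are the
  forms in which it is used.
\<close>

lemma (in monoid) invertible_square:
  assumes "p \<in> carrier G" "x \<in> carrier G" "q \<in> carrier G" "y \<in> carrier G"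
    and "p' \<in> carrier G" "x' \<in> carrier G" "q' \<in> carrier G" "y' \<in> carrier G"
    and p: "p' \<otimes> p = \<one>" and q: "q \<otimes> q' = \<one>" "q' \<otimes> q = \<one>"
    and x: "x \<otimes> x' = \<one>" "x' \<otimes> x = \<one>" and y: "y \<otimes> y' = \<one>"
    and eq: "p \<otimes> x = q \<otimes> y"
  shows "q' \<otimes> p = y \<otimes> x'" and "p' \<otimes> q = x \<otimes> y'" and "x' \<otimes> p' = y' \<otimes> q'"
proof -
  have "q' \<otimes> p = q' \<otimes> (p \<otimes> x) \<otimes> x'"
    using assms(1-8) by (simp add: m_assoc x)
  also have "\<dots> = (q' \<otimes> q) \<otimes> y \<otimes> x'"
    unfolding eq using assms(1-8) by (simp add: m_assoc)
  finally show "q' \<otimes> p = y \<otimes> x'"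
    using assms(1-8) by (simp add: q)
  have "p' \<otimes> q = p' \<otimes> (q \<otimes> y) \<otimes> y'"
    using assms(1-8) by (simp add: m_assoc y)
  also have "\<dots> = (p' \<otimes> p) \<otimes> x \<otimes> y'"
    unfolding eq[symmetric] using assms(1-8) by (simp add: m_assoc)
  finally show pq: "p' \<otimes> q = x \<otimes> y'"
    using assms(1-8) by (simp add: p)
  have "x' \<otimes> p' = x' \<otimes> (p' \<otimes> q) \<otimes> q'"
    using assms(1-8) by (simp add: m_assoc q)
  also have "\<dots> = (x' \<otimes> x) \<otimes> y' \<otimes> q'"
    unfolding pq using assms(1-8) by (simp add: m_assoc)
  finally show "x' \<otimes> p' = y' \<otimes> q'"
    using assms(1-8) by (simp add: x)
qed

context hopf_algebra
begin

context
  fixes X :: "('k, 'x, 'r) module_scheme" and \<phi> :: "'h \<Rightarrow> 'h \<Rightarrow> 'h \<Rightarrow> 'x"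
    and s t :: "('k, 'h, 'h) tensor"
  assumes X: "module K X" and \<phi>: "trilinear_map K H H H X \<phi>"
    and s: "s \<in> carrier TT" and t: "t \<in> carrier TT"
begin

interpretation X: module K X by (rule X)

private lemmas lin = hopf_linear_intros linear_map_trilinear[OF \<phi>]

private abbreviation "LX \<equiv> tensor_lift K H H X"

private lemma translate_trilinear:
  assumes "a \<in> carrier H" "b \<in> carrier H" "c \<in> carrier H"
  shows "trilinear_map K H H H X (\<lambda>a' b' c'. \<phi> (a \<otimes>\<^bsub>H\<^esub> a') (b \<otimes>\<^bsub>H\<^esub> b') (c \<otimes>\<^bsub>H\<^esub> c'))"
  by (intro lin; simp add: assms)

private lemma translate_sum_trilinear:
  assumes "y \<in> carrier Tr"
  shows "trilinear_map K H H H X (\<lambda>a b c. tensor_lift3 K H H H X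
    (\<lambda>a' b' c'. \<phi> (a \<otimes>\<^bsub>H\<^esub> a') (b \<otimes>\<^bsub>H\<^esub> b') (c \<otimes>\<^bsub>H\<^esub> c')) y)"
  unfolding tensor_lift3_def by (intro lin; simp add: assms X)

text \<open>
  The triple sums over the products of two factors that occur in the rearranged cocycle identity. A
  factor is \<open>F\<close> or \<open>F'\<close> placed in the left or the right two legs, or with its left or right leg
  split by \<open>\<Delta>\<close>. In each case the sum over the product is a sum over its first factor of a sum over
  its second factor, and the two sums are evaluated in turn.
\<close>

lemma sum_right_left:
  "tensor_lift3 K H H H X \<phi>
      (pure_tensor K H TT \<one>\<^bsub>H\<^esub> s \<otimes>\<^bsub>HHr\<^esub> tensor_assoc K H H H (pure_tensor K TT H t \<one>\<^bsub>H\<^esub>))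
    = LX (\<lambda>b c. LX (\<lambda>a' b'. \<phi> a' (b \<otimes>\<^bsub>H\<^esub> b') c) t) s"
  apply (subst tensor_lift3_mult[OF X \<phi>]; (simp add: s t)?)
  apply (subst tensor_lift3_pure[OF X translate_sum_trilinear]; (simp add: s t)?)
  apply (rule tensor_lift_cong; (rule trilinear_map_right[OF translate_sum_trilinear])?; (simp add: s t X)?)
  apply (subst tensor_lift3_assoc_pure[OF X translate_trilinear]; (simp add: t)?)
  apply (rule tensor_lift_cong; (intro lin)?; (simp add: t X)?)
  done

lemma sum_left_right:
  "tensor_lift3 K H H H X \<phi>
      (tensor_assoc K H H H (pure_tensor K TT H s \<one>\<^bsub>H\<^esub>) \<otimes>\<^bsub>HHr\<^esub> pure_tensor K H TT \<one>\<^bsub>H\<^esub> t)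
    = LX (\<lambda>a b. LX (\<lambda>b' c'. \<phi> a (b \<otimes>\<^bsub>H\<^esub> b') c') t) s"
  apply (subst tensor_lift3_mult[OF X \<phi>]; (simp add: s t)?)
  apply (subst tensor_lift3_assoc_pure[OF X translate_sum_trilinear]; (simp add: s t)?)
  apply (rule tensor_lift_cong; (rule trilinear_map_left[OF translate_sum_trilinear])?; (simp add: s t X)?)
  apply (subst tensor_lift3_pure[OF X translate_trilinear]; (simp add: t)?)
  apply (rule tensor_lift_cong; (intro lin)?; (simp add: t X)?)
  done

lemma sum_comult_right_left:
  "tensor_lift3 K H H H X \<phi>
      (comult_right K H s \<otimes>\<^bsub>HHr\<^esub> tensor_assoc K H H H (comult_left K H t))
    = LX (\<lambda>a b. LX (\<lambda>p q. LX (\<lambda>c d. LX (\<lambda>p' q'. \<phi> (a \<otimes>\<^bsub>H\<^esub> p') (p \<otimes>\<^bsub>H\<^esub> q') (q \<otimes>\<^bsub>H\<^esub> d))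
        (comult H c)) t) (comult H b)) s"
  apply (subst tensor_lift3_mult[OF X \<phi>]; (simp add: s t)?)
  apply (subst tensor_lift3_comult_right[OF X translate_sum_trilinear]; (simp add: s t)?)
  apply (rule tensor_lift_cong; (unfold tensor_lift3_def, intro lin)?; (simp add: s t X flip: tensor_lift3_def)?)
  apply (rule tensor_lift_cong; (rule trilinear_map_right[OF translate_sum_trilinear])?; (simp add: s t X)?)
  apply (subst tensor_lift3_comult_left[OF X translate_trilinear]; (simp add: t)?)
  done

lemma sum_comult_left_right:
  "tensor_lift3 K H H H X \<phi>
      (tensor_assoc K H H H (comult_left K H s) \<otimes>\<^bsub>HHr\<^esub> comult_right K H t)
    = LX (\<lambda>a b. LX (\<lambda>p q. LX (\<lambda>c d. LX (\<lambda>p' q'. \<phi> (p \<otimes>\<^bsub>H\<^esub> c) (q \<otimes>\<^bsub>H\<^esub> p') (b \<otimes>\<^bsub>H\<^esub> q'))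
        (comult H d)) t) (comult H a)) s"
  apply (subst tensor_lift3_mult[OF X \<phi>]; (simp add: s t)?)
  apply (subst tensor_lift3_comult_left[OF X translate_sum_trilinear]; (simp add: s t)?)
  apply (rule tensor_lift_cong; (unfold tensor_lift3_def, intro lin)?; (simp add: s t X flip: tensor_lift3_def)?)
  apply (rule tensor_lift_cong; (rule trilinear_map_left[OF translate_sum_trilinear])?; (simp add: s t X)?)
  apply (subst tensor_lift3_comult_right[OF X translate_trilinear]; (simp add: t)?)
  done

lemma sum_comult_left_left:
  "tensor_lift3 K H H H X \<phi>
      (tensor_assoc K H H H (comult_left K H s) \<otimes>\<^bsub>HHr\<^esub> tensor_assoc K H H H (pure_tensor K TT H t \<one>\<^bsub>H\<^esub>))
    = LX (\<lambda>a b. LX (\<lambda>p q. LX (\<lambda>c d. \<phi> (p \<otimes>\<^bsub>H\<^esub> c) (q \<otimes>\<^bsub>H\<^esub> d) b) t) (comult H a)) s"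
  apply (subst tensor_lift3_mult[OF X \<phi>]; (simp add: s t)?)
  apply (subst tensor_lift3_comult_left[OF X translate_sum_trilinear]; (simp add: s t)?)
  apply (rule tensor_lift_cong; (unfold tensor_lift3_def, intro lin)?; (simp add: s t X flip: tensor_lift3_def)?)
  apply (rule tensor_lift_cong; (rule trilinear_map_left[OF translate_sum_trilinear])?; (simp add: s t X)?)
  apply (subst tensor_lift3_assoc_pure[OF X translate_trilinear]; (simp add: t)?)
  done

lemma sum_comult_right_right:
  "tensor_lift3 K H H H X \<phi> (comult_right K H s \<otimes>\<^bsub>HHr\<^esub> pure_tensor K H TT \<one>\<^bsub>H\<^esub> t)
    = LX (\<lambda>a b. LX (\<lambda>p q. LX (\<lambda>c d. \<phi> a (p \<otimes>\<^bsub>H\<^esub> c) (q \<otimes>\<^bsub>H\<^esub> d)) t) (comult H b)) s"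
  apply (subst tensor_lift3_mult[OF X \<phi>]; (simp add: s t)?)
  apply (subst tensor_lift3_comult_right[OF X translate_sum_trilinear]; (simp add: s t)?)
  apply (rule tensor_lift_cong; (unfold tensor_lift3_def, intro lin)?; (simp add: s t X flip: tensor_lift3_def)?)
  apply (rule tensor_lift_cong; (rule trilinear_map_right[OF translate_sum_trilinear])?; (simp add: s t X)?)
  apply (subst tensor_lift3_pure[OF X translate_trilinear]; (simp add: t)?)
  done

end

end

section \<open>The element \<open>U\<close> and its inverse\<close>

context hopf_algebra
begin

lemma monoid_H: "monoid H"
  by (rule ring.is_monoid[OF assoc_algebra_ring[OF assoc_algebra_axioms]])

lemma monoid_HH: "monoid HH"
  by (rule ring.is_monoid[OF assoc_algebra_ring[OF HH.tensor_algebra_assoc_algebra]])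

lemma monoid_HHr: "monoid HHr"
  by (rule ring.is_monoid[OF assoc_algebra_ring[OF HHr.tensor_algebra_assoc_algebra]])

lemma counit_left_pure:
  "\<lbrakk>a \<in> carrier H; b \<in> carrier H\<rbrakk> \<Longrightarrow> counit_left K H (pure_tensor K H H a b) = counit H a \<odot>\<^bsub>H\<^esub> b"
  unfolding counit_left_def by (rule tensor_lift_pure'; (intro hopf_linear_intros)?; simp)

lemma counit_right_pure:
  "\<lbrakk>a \<in> carrier H; b \<in> carrier H\<rbrakk> \<Longrightarrow> counit_right K H (pure_tensor K H H a b) = counit H b \<odot>\<^bsub>H\<^esub> a"
  unfolding counit_right_def by (rule tensor_lift_pure'; (intro hopf_linear_intros)?; simp)

lemma counit_left_linear: "linear_map K TT H (counit_left K H)"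
  unfolding counit_left_def by (intro hopf_linear_intros; simp)

lemma counit_right_linear: "linear_map K TT H (counit_right K H)"
  unfolding counit_right_def by (intro hopf_linear_intros; simp)

lemmas counit_map_closed [simp] =
  linear_map_closed[OF counit_left_linear] linear_map_closed[OF counit_right_linear]

lemmas counit_map_add = linear_map_add[OF counit_left_linear] linear_map_add[OF counit_right_linear]

lemma smult_left_commute_H:
  "\<lbrakk>c \<in> carrier K; d \<in> carrier K; x \<in> carrier H\<rbrakk> \<Longrightarrow> c \<odot>\<^bsub>H\<^esub> (d \<odot>\<^bsub>H\<^esub> x) = d \<odot>\<^bsub>H\<^esub> (c \<odot>\<^bsub>H\<^esub> x)"
proof -
  assume cd: "c \<in> carrier K" "d \<in> carrier K" and x: "x \<in> carrier H"
  have "cring K"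
    using assoc_algebra_module[OF assoc_algebra_axioms] by (simp add: module_def)
  then have "c \<otimes>\<^bsub>K\<^esub> d = d \<otimes>\<^bsub>K\<^esub> c"
    using cd by (rule cring.cring_simprules(14))
  then show ?thesis
    using cd x by (simp add: smult_smult_H[symmetric])
qed

lemma counit_left_mult:
  assumes "x \<in> carrier TT" and y: "y \<in> carrier TT"
  shows "counit_left K H (x \<otimes>\<^bsub>HH\<^esub> y) = counit_left K H x \<otimes>\<^bsub>H\<^esub> counit_left K H y"
  using assms(1)
proof (induction x rule: HH.tensor_induct)
  case (pure a b)
  from y show ?case
    by (induction y rule: HH.tensor_induct)
      (use pure in \<open>simp_all add: counit_left_pure counit_mult smult_mult_left smult_mult_right
        smult_smult_H smult_left_commute_H counit_map_add alg_r_distr\<close>)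
qed (simp add: y counit_map_add alg_l_distr)

lemma counit_right_mult:
  assumes "x \<in> carrier TT" and y: "y \<in> carrier TT"
  shows "counit_right K H (x \<otimes>\<^bsub>HH\<^esub> y) = counit_right K H x \<otimes>\<^bsub>H\<^esub> counit_right K H y"
  using assms(1)
proof (induction x rule: HH.tensor_induct)
  case (pure a b)
  from y show ?case
    by (induction y rule: HH.tensor_induct)
      (use pure in \<open>simp_all add: counit_right_pure counit_mult smult_mult_left smult_mult_right
        smult_smult_H smult_left_commute_H counit_map_add alg_r_distr\<close>)
qed (simp add: y counit_map_add alg_l_distr)

lemma antipode_smult:
  "\<lbrakk>c \<in> carrier K; x \<in> carrier H\<rbrakk> \<Longrightarrow> antipode H (c \<odot>\<^bsub>H\<^esub> x) = c \<odot>\<^bsub>H\<^esub> antipode H x"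
  by (rule linear_map_smult[OF antipode_linear])

end

locale hopf_cocycle = hopf_algebra K H
  for K :: "('k, 'm) ring_scheme" (structure) and H :: "('k, 'h) hopf" (structure) +
  fixes F :: "('k, 'h, 'h) tensor"
  assumes cocycle: "two_cocycle K H F"
begin

abbreviation "F' \<equiv> inv\<^bsub>HH\<^esub> F"

lemma F_Units: "F \<in> Units HH"
  using cocycle by (simp add: two_cocycle_def Let_def)

lemma F_closed [simp]: "F \<in> carrier TT" and F'_closed [simp]: "F' \<in> carrier TT"
  using monoid.Units_closed[OF monoid_HH F_Units] monoid.Units_inv_closed[OF monoid_HH F_Units]
  by simp_all

lemma F_inverse: "F \<otimes>\<^bsub>HH\<^esub> F' = \<one>\<^bsub>HH\<^esub>" "F' \<otimes>\<^bsub>HH\<^esub> F = \<one>\<^bsub>HH\<^esub>"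
  by (rule monoid.Units_r_inv[OF monoid_HH F_Units] monoid.Units_l_inv[OF monoid_HH F_Units])+

lemma counit_F: "counit_left K H F = \<one>\<^bsub>H\<^esub>" "counit_right K H F = \<one>\<^bsub>H\<^esub>"
  using cocycle by (simp_all add: two_cocycle_def Let_def)

lemma counit_F': "counit_left K H F' = \<one>\<^bsub>H\<^esub>" "counit_right K H F' = \<one>\<^bsub>H\<^esub>"
proof -
  show "counit_left K H F' = \<one>\<^bsub>H\<^esub>"
    using counit_left_mult[of F F'] by (simp add: F_inverse counit_F counit_left_pure counit_one)
  show "counit_right K H F' = \<one>\<^bsub>H\<^esub>"
    using counit_right_mult[of F F'] by (simp add: F_inverse counit_F counit_right_pure counit_one)
qed

lemma cocycle_eq:
  "tensor_assoc K H H H (pure_tensor K TT H F \<one>\<^bsub>H\<^esub>) \<otimes>\<^bsub>HHr\<^esub> tensor_assoc K H H H (comult_left K H F)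
    = pure_tensor K H TT \<one>\<^bsub>H\<^esub> F \<otimes>\<^bsub>HHr\<^esub> comult_right K H F"
  using cocycle by (simp add: two_cocycle_def Let_def tensor_assoc_mult[symmetric])

lemma leg_inverses:
  "pure_tensor K TT H F \<one>\<^bsub>H\<^esub> \<otimes>\<^bsub>HHl\<^esub> pure_tensor K TT H F' \<one>\<^bsub>H\<^esub> = \<one>\<^bsub>HHl\<^esub>"
  "pure_tensor K TT H F' \<one>\<^bsub>H\<^esub> \<otimes>\<^bsub>HHl\<^esub> pure_tensor K TT H F \<one>\<^bsub>H\<^esub> = \<one>\<^bsub>HHl\<^esub>"
  "pure_tensor K H TT \<one>\<^bsub>H\<^esub> F \<otimes>\<^bsub>HHr\<^esub> pure_tensor K H TT \<one>\<^bsub>H\<^esub> F' = \<one>\<^bsub>HHr\<^esub>"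
  "pure_tensor K H TT \<one>\<^bsub>H\<^esub> F' \<otimes>\<^bsub>HHr\<^esub> pure_tensor K H TT \<one>\<^bsub>H\<^esub> F = \<one>\<^bsub>HHr\<^esub>"
  by (simp_all add: F_inverse)

lemma comult_inverses:
  "comult_left K H F \<otimes>\<^bsub>HHl\<^esub> comult_left K H F' = \<one>\<^bsub>HHl\<^esub>"
  "comult_left K H F' \<otimes>\<^bsub>HHl\<^esub> comult_left K H F = \<one>\<^bsub>HHl\<^esub>"
  "comult_right K H F \<otimes>\<^bsub>HHr\<^esub> comult_right K H F' = \<one>\<^bsub>HHr\<^esub>"
  "comult_right K H F' \<otimes>\<^bsub>HHr\<^esub> comult_right K H F = \<one>\<^bsub>HHr\<^esub>"
  by (simp_all add: comult_left_mult[symmetric] comult_right_mult[symmetric] F_inverse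
      comult_left_pure comult_right_pure comult_one)

lemma tensor_assoc_inverse:
  assumes "x \<in> carrier Tl" "y \<in> carrier Tl" "x \<otimes>\<^bsub>HHl\<^esub> y = \<one>\<^bsub>HHl\<^esub>"
  shows "tensor_assoc K H H H x \<otimes>\<^bsub>HHr\<^esub> tensor_assoc K H H H y = \<one>\<^bsub>HHr\<^esub>"
  using assms by (simp add: tensor_assoc_mult[symmetric] tensor_assoc_pure)

lemmas cocycle_forms =
  monoid.invertible_square[OF monoid_HHr _ _ _ _ _ _ _ _
    tensor_assoc_inverse[OF _ _ leg_inverses(2)] leg_inverses(3,4)
    tensor_assoc_inverse[OF _ _ comult_inverses(1)] tensor_assoc_inverse[OF _ _ comult_inverses(2)]
    comult_inverses(3) cocycle_eq, simplified]

abbreviation "U \<equiv> twist_unit K H F"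

text \<open>The inverse of \<open>U\<close> is \<open>S (F'\<^sub>1) F'\<^sub>2\<close>, where \<open>F'\<close> is the inverse of \<open>F\<close>.\<close>

definition V :: 'h where
  "V = tensor_lift K H H H (\<lambda>f g. antipode H f \<otimes>\<^bsub>H\<^esub> g) F'"

lemma U_closed [simp]: "U \<in> carrier H"
  unfolding twist_unit_def by (intro hopf_linear_intros; simp)

lemma V_closed [simp]: "V \<in> carrier H"
  unfolding V_def by (intro hopf_linear_intros; simp)

abbreviation "SH \<equiv> antipode H"
abbreviation "LH \<equiv> tensor_lift K H H H"

text \<open>
  \<open>U V = F\<^sub>1 S(F'\<^sub>1 F\<^sub>2) F'\<^sub>2\<close> is the image of \<open>(1 \<otimes> F') (F \<otimes> 1)\<close> under \<open>a \<otimes> b \<otimes> c \<mapsto> a S(b) c\<close>. By the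
  cocycle identity this product is \<open>(id \<otimes> \<Delta>)(F) (\<Delta> \<otimes> id)(F')\<close>, on whose image the antipode axioms
  and then the counit conditions on \<open>F'\<close> and \<open>F\<close> remove one sum after the other.
\<close>

lemma U_V: "U \<otimes>\<^bsub>H\<^esub> V = \<one>\<^bsub>H\<^esub>"
proof -
  let ?\<phi> = "\<lambda>a b c. a \<otimes>\<^bsub>H\<^esub> (SH b \<otimes>\<^bsub>H\<^esub> c)"
  note lin = hopf_linear_intros
  have \<phi>: "trilinear_map K H H H H ?\<phi>"
    by (intro lin; simp)
  have mod: "module K H" by simp
  have "U \<otimes>\<^bsub>H\<^esub> V = LH (\<lambda>b c. U \<otimes>\<^bsub>H\<^esub> (SH b \<otimes>\<^bsub>H\<^esub> c)) F'"
    unfolding V_def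
    by (rule linear_map_tensor_lift[where g = "\<lambda>x. U \<otimes>\<^bsub>H\<^esub> x"]; (intro lin)?; simp)
  also have "\<dots> = LH (\<lambda>b c. LH (\<lambda>a' b'. ?\<phi> a' (b \<otimes>\<^bsub>H\<^esub> b') c) F) F'"
  proof (rule tensor_lift_cong)
    fix b c assume bc: "b \<in> carrier H" "c \<in> carrier H"
    have "U \<otimes>\<^bsub>H\<^esub> (SH b \<otimes>\<^bsub>H\<^esub> c) = LH (\<lambda>a' b'. (a' \<otimes>\<^bsub>H\<^esub> SH b') \<otimes>\<^bsub>H\<^esub> (SH b \<otimes>\<^bsub>H\<^esub> c)) F"
      unfolding twist_unit_def
      by (rule linear_map_tensor_lift[where g = "\<lambda>x. x \<otimes>\<^bsub>H\<^esub> (SH b \<otimes>\<^bsub>H\<^esub> c)"]; (intro lin)?; simp add: bc)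
    also have "\<dots> = LH (\<lambda>a' b'. ?\<phi> a' (b \<otimes>\<^bsub>H\<^esub> b') c) F"
      by (rule tensor_lift_cong; (intro lin)?; simp add: bc antipode_mult alg_assoc)
    finally show "U \<otimes>\<^bsub>H\<^esub> (SH b \<otimes>\<^bsub>H\<^esub> c) = LH (\<lambda>a' b'. ?\<phi> a' (b \<otimes>\<^bsub>H\<^esub> b') c) F" .
  qed ((intro lin)?; simp)+
  also have "\<dots> = tensor_lift3 K H H H H ?\<phi> (pure_tensor K H TT \<one>\<^bsub>H\<^esub> F'
      \<otimes>\<^bsub>HHr\<^esub> tensor_assoc K H H H (pure_tensor K TT H F \<one>\<^bsub>H\<^esub>))"
    by (rule sum_right_left[OF mod \<phi>, symmetric]) simp_all
  also have "\<dots> = tensor_lift3 K H H H H ?\<phi>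
      (comult_right K H F \<otimes>\<^bsub>HHr\<^esub> tensor_assoc K H H H (comult_left K H F'))"
    by (simp only: cocycle_forms(1))
  also have "\<dots> = LH (\<lambda>a b. LH (\<lambda>p q. LH (\<lambda>c d. LH (\<lambda>p' q'.
      ?\<phi> (a \<otimes>\<^bsub>H\<^esub> p') (p \<otimes>\<^bsub>H\<^esub> q') (q \<otimes>\<^bsub>H\<^esub> d)) (comult H c)) F') (comult H b)) F"
    by (rule sum_comult_right_left[OF mod \<phi>]) simp_all
  also have "\<dots> = LH (\<lambda>a b. counit H b \<odot>\<^bsub>H\<^esub> a) F"
  proof (rule tensor_lift_cong)
    fix a b assume ab: "a \<in> carrier H" "b \<in> carrier H"
    have "LH (\<lambda>p q. LH (\<lambda>c d. LH (\<lambda>p' q'. ?\<phi> (a \<otimes>\<^bsub>H\<^esub> p') (p \<otimes>\<^bsub>H\<^esub> q') (q \<otimes>\<^bsub>H\<^esub> d)) (comult H c)) F') (comult H b)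
        = LH (\<lambda>p q. a \<otimes>\<^bsub>H\<^esub> (SH p \<otimes>\<^bsub>H\<^esub> q)) (comult H b)"
    proof (rule tensor_lift_cong)
      fix p q assume pq: "p \<in> carrier H" "q \<in> carrier H"
      have "LH (\<lambda>c d. LH (\<lambda>p' q'. ?\<phi> (a \<otimes>\<^bsub>H\<^esub> p') (p \<otimes>\<^bsub>H\<^esub> q') (q \<otimes>\<^bsub>H\<^esub> d)) (comult H c)) F'
          = LH (\<lambda>c d. (a \<otimes>\<^bsub>H\<^esub> (SH p \<otimes>\<^bsub>H\<^esub> q)) \<otimes>\<^bsub>H\<^esub> (counit H c \<odot>\<^bsub>H\<^esub> d)) F'"
      proof (rule tensor_lift_cong)
        fix c d assume cd: "c \<in> carrier H" "d \<in> carrier H"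
        have "LH (\<lambda>p' q'. ?\<phi> (a \<otimes>\<^bsub>H\<^esub> p') (p \<otimes>\<^bsub>H\<^esub> q') (q \<otimes>\<^bsub>H\<^esub> d)) (comult H c)
            = LH (\<lambda>p' q'. a \<otimes>\<^bsub>H\<^esub> ((p' \<otimes>\<^bsub>H\<^esub> SH q') \<otimes>\<^bsub>H\<^esub> ((SH p \<otimes>\<^bsub>H\<^esub> q) \<otimes>\<^bsub>H\<^esub> d))) (comult H c)"
          by (rule tensor_lift_cong; (intro lin)?; simp add: ab pq cd antipode_mult alg_assoc)
        also have "\<dots> = a \<otimes>\<^bsub>H\<^esub> (LH (\<lambda>p' q'. p' \<otimes>\<^bsub>H\<^esub> SH q') (comult H c) \<otimes>\<^bsub>H\<^esub> ((SH p \<otimes>\<^bsub>H\<^esub> q) \<otimes>\<^bsub>H\<^esub> d))"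
          by (rule linear_map_tensor_lift[symmetric, where
                g = "\<lambda>x. a \<otimes>\<^bsub>H\<^esub> (x \<otimes>\<^bsub>H\<^esub> ((SH p \<otimes>\<^bsub>H\<^esub> q) \<otimes>\<^bsub>H\<^esub> d))"]; (intro lin)?; simp add: ab pq cd)
        also have "\<dots> = (a \<otimes>\<^bsub>H\<^esub> (SH p \<otimes>\<^bsub>H\<^esub> q)) \<otimes>\<^bsub>H\<^esub> (counit H c \<odot>\<^bsub>H\<^esub> d)"
          using ab pq cd by (simp add: antipode_right smult_mult_left smult_mult_right alg_assoc)
        finally show "LH (\<lambda>p' q'. ?\<phi> (a \<otimes>\<^bsub>H\<^esub> p') (p \<otimes>\<^bsub>H\<^esub> q') (q \<otimes>\<^bsub>H\<^esub> d)) (comult H c)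
            = (a \<otimes>\<^bsub>H\<^esub> (SH p \<otimes>\<^bsub>H\<^esub> q)) \<otimes>\<^bsub>H\<^esub> (counit H c \<odot>\<^bsub>H\<^esub> d)" .
      qed ((intro lin)?; simp add: ab pq)+
      also have "\<dots> = (a \<otimes>\<^bsub>H\<^esub> (SH p \<otimes>\<^bsub>H\<^esub> q)) \<otimes>\<^bsub>H\<^esub> LH (\<lambda>c d. counit H c \<odot>\<^bsub>H\<^esub> d) F'"
        by (rule linear_map_tensor_lift[symmetric, where g = "\<lambda>x. (a \<otimes>\<^bsub>H\<^esub> (SH p \<otimes>\<^bsub>H\<^esub> q)) \<otimes>\<^bsub>H\<^esub> x"];
            (intro lin)?; simp add: ab pq)
      also have "\<dots> = a \<otimes>\<^bsub>H\<^esub> (SH p \<otimes>\<^bsub>H\<^esub> q)"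
        using counit_F'(1) ab pq by (simp add: counit_left_def)
      finally show "LH (\<lambda>c d. LH (\<lambda>p' q'. ?\<phi> (a \<otimes>\<^bsub>H\<^esub> p') (p \<otimes>\<^bsub>H\<^esub> q') (q \<otimes>\<^bsub>H\<^esub> d)) (comult H c)) F'
          = a \<otimes>\<^bsub>H\<^esub> (SH p \<otimes>\<^bsub>H\<^esub> q)" .
    qed ((intro lin)?; simp add: ab)+
    also have "\<dots> = a \<otimes>\<^bsub>H\<^esub> LH (\<lambda>p q. SH p \<otimes>\<^bsub>H\<^esub> q) (comult H b)"
      by (rule linear_map_tensor_lift[symmetric, where g = "\<lambda>x. a \<otimes>\<^bsub>H\<^esub> x"]; (intro lin)?; simp add: ab)
    also have "\<dots> = counit H b \<odot>\<^bsub>H\<^esub> a"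
      using ab by (simp add: antipode_left smult_one_mult)
    finally show "LH (\<lambda>p q. LH (\<lambda>c d. LH (\<lambda>p' q'.
        ?\<phi> (a \<otimes>\<^bsub>H\<^esub> p') (p \<otimes>\<^bsub>H\<^esub> q') (q \<otimes>\<^bsub>H\<^esub> d)) (comult H c)) F') (comult H b) = counit H b \<odot>\<^bsub>H\<^esub> a" .
  qed ((intro lin)?; simp)+
  also have "\<dots> = \<one>\<^bsub>H\<^esub>"
    using counit_F(2) by (simp add: counit_right_def)
  finally show ?thesis .
qed

text \<open>
  \<open>V U = S(F'\<^sub>1) F'\<^sub>2 F\<^sub>1 S(F\<^sub>2)\<close> is the image of \<open>(F' \<otimes> 1) (1 \<otimes> F) = (\<Delta> \<otimes> id)(F) (id \<otimes> \<Delta>)(F')\<close>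
  under \<open>a \<otimes> b \<otimes> c \<mapsto> S(a) b S(c)\<close>, and the sums are removed as for \<open>U V\<close>.
\<close>

lemma V_U: "V \<otimes>\<^bsub>H\<^esub> U = \<one>\<^bsub>H\<^esub>"
proof -
  let ?\<phi> = "\<lambda>a b c. SH a \<otimes>\<^bsub>H\<^esub> (b \<otimes>\<^bsub>H\<^esub> SH c)"
  note lin = hopf_linear_intros
  have \<phi>: "trilinear_map K H H H H ?\<phi>"
    by (intro lin; simp)
  have mod: "module K H" by simp
  have "V \<otimes>\<^bsub>H\<^esub> U = LH (\<lambda>a b. (SH a \<otimes>\<^bsub>H\<^esub> b) \<otimes>\<^bsub>H\<^esub> U) F'"
    unfolding V_def
    by (rule linear_map_tensor_lift[where g = "\<lambda>x. x \<otimes>\<^bsub>H\<^esub> U"]; (intro lin)?; simp)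
  also have "\<dots> = LH (\<lambda>a b. LH (\<lambda>b' c'. ?\<phi> a (b \<otimes>\<^bsub>H\<^esub> b') c') F) F'"
  proof (rule tensor_lift_cong)
    fix a b assume ab: "a \<in> carrier H" "b \<in> carrier H"
    have "(SH a \<otimes>\<^bsub>H\<^esub> b) \<otimes>\<^bsub>H\<^esub> U = LH (\<lambda>b' c'. (SH a \<otimes>\<^bsub>H\<^esub> b) \<otimes>\<^bsub>H\<^esub> (b' \<otimes>\<^bsub>H\<^esub> SH c')) F"
      unfolding twist_unit_def
      by (rule linear_map_tensor_lift[where g = "\<lambda>x. (SH a \<otimes>\<^bsub>H\<^esub> b) \<otimes>\<^bsub>H\<^esub> x"]; (intro lin)?; simp add: ab)
    also have "\<dots> = LH (\<lambda>b' c'. ?\<phi> a (b \<otimes>\<^bsub>H\<^esub> b') c') F"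
      by (rule tensor_lift_cong; (intro lin)?; simp add: ab alg_assoc)
    finally show "(SH a \<otimes>\<^bsub>H\<^esub> b) \<otimes>\<^bsub>H\<^esub> U = LH (\<lambda>b' c'. ?\<phi> a (b \<otimes>\<^bsub>H\<^esub> b') c') F" .
  qed ((intro lin)?; simp)+
  also have "\<dots> = tensor_lift3 K H H H H ?\<phi>
      (tensor_assoc K H H H (pure_tensor K TT H F' \<one>\<^bsub>H\<^esub>) \<otimes>\<^bsub>HHr\<^esub> pure_tensor K H TT \<one>\<^bsub>H\<^esub> F)"
    by (rule sum_left_right[OF mod \<phi>, symmetric]) simp_all
  also have "\<dots> = tensor_lift3 K H H H H ?\<phi>
      (tensor_assoc K H H H (comult_left K H F) \<otimes>\<^bsub>HHr\<^esub> comult_right K H F')"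
    by (simp only: cocycle_forms(2))
  also have "\<dots> = LH (\<lambda>a b. LH (\<lambda>p q. LH (\<lambda>c d. LH (\<lambda>p' q'.
      ?\<phi> (p \<otimes>\<^bsub>H\<^esub> c) (q \<otimes>\<^bsub>H\<^esub> p') (b \<otimes>\<^bsub>H\<^esub> q')) (comult H d)) F') (comult H a)) F"
    by (rule sum_comult_left_right[OF mod \<phi>]) simp_all
  also have "\<dots> = LH (\<lambda>a b. SH (counit H a \<odot>\<^bsub>H\<^esub> b)) F"
  proof (rule tensor_lift_cong)
    fix a b assume ab: "a \<in> carrier H" "b \<in> carrier H"
    have "LH (\<lambda>p q. LH (\<lambda>c d. LH (\<lambda>p' q'. ?\<phi> (p \<otimes>\<^bsub>H\<^esub> c) (q \<otimes>\<^bsub>H\<^esub> p') (b \<otimes>\<^bsub>H\<^esub> q')) (comult H d)) F') (comult H a)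
        = LH (\<lambda>p q. (SH p \<otimes>\<^bsub>H\<^esub> q) \<otimes>\<^bsub>H\<^esub> SH b) (comult H a)"
    proof (rule tensor_lift_cong)
      fix p q assume pq: "p \<in> carrier H" "q \<in> carrier H"
      have "LH (\<lambda>c d. LH (\<lambda>p' q'. ?\<phi> (p \<otimes>\<^bsub>H\<^esub> c) (q \<otimes>\<^bsub>H\<^esub> p') (b \<otimes>\<^bsub>H\<^esub> q')) (comult H d)) F'
          = LH (\<lambda>c d. SH (counit H d \<odot>\<^bsub>H\<^esub> c) \<otimes>\<^bsub>H\<^esub> ((SH p \<otimes>\<^bsub>H\<^esub> q) \<otimes>\<^bsub>H\<^esub> SH b)) F'"
      proof (rule tensor_lift_cong)
        fix c d assume cd: "c \<in> carrier H" "d \<in> carrier H"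
        have "LH (\<lambda>p' q'. ?\<phi> (p \<otimes>\<^bsub>H\<^esub> c) (q \<otimes>\<^bsub>H\<^esub> p') (b \<otimes>\<^bsub>H\<^esub> q')) (comult H d)
            = LH (\<lambda>p' q'. SH c \<otimes>\<^bsub>H\<^esub> ((SH p \<otimes>\<^bsub>H\<^esub> q) \<otimes>\<^bsub>H\<^esub> ((p' \<otimes>\<^bsub>H\<^esub> SH q') \<otimes>\<^bsub>H\<^esub> SH b))) (comult H d)"
          by (rule tensor_lift_cong; (intro lin)?; simp add: ab pq cd antipode_mult alg_assoc)
        also have "\<dots> = SH c \<otimes>\<^bsub>H\<^esub> ((SH p \<otimes>\<^bsub>H\<^esub> q) \<otimes>\<^bsub>H\<^esub> (LH (\<lambda>p' q'. p' \<otimes>\<^bsub>H\<^esub> SH q') (comult H d) \<otimes>\<^bsub>H\<^esub> SH b))"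
          by (rule linear_map_tensor_lift[symmetric, where
                g = "\<lambda>x. SH c \<otimes>\<^bsub>H\<^esub> ((SH p \<otimes>\<^bsub>H\<^esub> q) \<otimes>\<^bsub>H\<^esub> (x \<otimes>\<^bsub>H\<^esub> SH b))"]; (intro lin)?; simp add: ab pq cd)
        also have "\<dots> = SH (counit H d \<odot>\<^bsub>H\<^esub> c) \<otimes>\<^bsub>H\<^esub> ((SH p \<otimes>\<^bsub>H\<^esub> q) \<otimes>\<^bsub>H\<^esub> SH b)"
          using ab pq cd
          by (simp add: antipode_right smult_mult_left smult_mult_right antipode_smult)
        finally show "LH (\<lambda>p' q'. ?\<phi> (p \<otimes>\<^bsub>H\<^esub> c) (q \<otimes>\<^bsub>H\<^esub> p') (b \<otimes>\<^bsub>H\<^esub> q')) (comult H d)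
            = SH (counit H d \<odot>\<^bsub>H\<^esub> c) \<otimes>\<^bsub>H\<^esub> ((SH p \<otimes>\<^bsub>H\<^esub> q) \<otimes>\<^bsub>H\<^esub> SH b)" .
      qed ((intro lin)?; simp add: ab pq)+
      also have "\<dots> = SH (LH (\<lambda>c d. counit H d \<odot>\<^bsub>H\<^esub> c) F') \<otimes>\<^bsub>H\<^esub> ((SH p \<otimes>\<^bsub>H\<^esub> q) \<otimes>\<^bsub>H\<^esub> SH b)"
        by (rule linear_map_tensor_lift[symmetric, where g = "\<lambda>x. SH x \<otimes>\<^bsub>H\<^esub> ((SH p \<otimes>\<^bsub>H\<^esub> q) \<otimes>\<^bsub>H\<^esub> SH b)"];
            (intro lin)?; simp add: ab pq)
      also have "\<dots> = (SH p \<otimes>\<^bsub>H\<^esub> q) \<otimes>\<^bsub>H\<^esub> SH b"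
        using counit_F'(2) ab pq by (simp add: counit_right_def antipode_one)
      finally show "LH (\<lambda>c d. LH (\<lambda>p' q'. ?\<phi> (p \<otimes>\<^bsub>H\<^esub> c) (q \<otimes>\<^bsub>H\<^esub> p') (b \<otimes>\<^bsub>H\<^esub> q')) (comult H d)) F'
          = (SH p \<otimes>\<^bsub>H\<^esub> q) \<otimes>\<^bsub>H\<^esub> SH b" .
    qed ((intro lin)?; simp add: ab)+
    also have "\<dots> = LH (\<lambda>p q. SH p \<otimes>\<^bsub>H\<^esub> q) (comult H a) \<otimes>\<^bsub>H\<^esub> SH b"
      by (rule linear_map_tensor_lift[symmetric, where g = "\<lambda>x. x \<otimes>\<^bsub>H\<^esub> SH b"]; (intro lin)?; simp add: ab)
    also have "\<dots> = SH (counit H a \<odot>\<^bsub>H\<^esub> b)"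
      using ab by (simp add: antipode_left smult_one_mult antipode_smult)
    finally show "LH (\<lambda>p q. LH (\<lambda>c d. LH (\<lambda>p' q'.
        ?\<phi> (p \<otimes>\<^bsub>H\<^esub> c) (q \<otimes>\<^bsub>H\<^esub> p') (b \<otimes>\<^bsub>H\<^esub> q')) (comult H d)) F') (comult H a)
        = SH (counit H a \<odot>\<^bsub>H\<^esub> b)" .
  qed ((intro lin)?; simp)+
  also have "\<dots> = SH (LH (\<lambda>a b. counit H a \<odot>\<^bsub>H\<^esub> b) F)"
    by (rule linear_map_tensor_lift[symmetric, where g = SH]; (intro lin)?; simp add: antipode_linear)
  also have "\<dots> = \<one>\<^bsub>H\<^esub>"
    using counit_F(1) by (simp add: counit_left_def antipode_one)
  finally show ?thesis .
qed

lemma inv_U: "inv\<^bsub>H\<^esub> U = V"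
  by (rule monoid.inv_char[OF monoid_H]) (simp_all add: U_V V_U)

end

section \<open>The twisted Hopf algebra\<close>

lemma assoc_algebraI:
  assumes "field K" and mod: "module K A"
    and "\<And>x y. \<lbrakk>x \<in> carrier A; y \<in> carrier A\<rbrakk> \<Longrightarrow> x \<otimes>\<^bsub>A\<^esub> y \<in> carrier A" and "\<one>\<^bsub>A\<^esub> \<in> carrier A"
    and "\<And>x y z. \<lbrakk>x \<in> carrier A; y \<in> carrier A; z \<in> carrier A\<rbrakk> \<Longrightarrow> x \<otimes>\<^bsub>A\<^esub> y \<otimes>\<^bsub>A\<^esub> z = x \<otimes>\<^bsub>A\<^esub> (y \<otimes>\<^bsub>A\<^esub> z)"
    and "\<And>x. x \<in> carrier A \<Longrightarrow> \<one>\<^bsub>A\<^esub> \<otimes>\<^bsub>A\<^esub> x = x" and "\<And>x. x \<in> carrier A \<Longrightarrow> x \<otimes>\<^bsub>A\<^esub> \<one>\<^bsub>A\<^esub> = x"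
    and bil: "bilinear_map K A A A (mult A)"
  shows "assoc_algebra K A"
proof -
  interpret module K A by (rule mod)
  have "ring A"
    by (intro ringI monoidI M.abelian_group_axioms)
      (simp_all add: assms linear_map_add[OF bilinear_map_left[OF bil]] linear_map_add[OF bilinear_map_right[OF bil]])
  with assms(1) mod show ?thesis
    by (intro assoc_algebra.intro assoc_algebra_axioms.intro)
      (simp_all add: linear_map_smult[OF bilinear_map_left[OF bil]] linear_map_smult[OF bilinear_map_right[OF bil]])
qed

lemma assoc_algebra_mult_bilinear:
  assumes "assoc_algebra K A"
  shows "bilinear_map K A A A (mult A)"
  by (intro bilinear_mapI linear_map_mult_left linear_map_mult_right linear_map_ident assms)

lemma assoc_algebra_same_module:
  assumes same: "same_module A A'" "mult A = mult A'" "one A = one A'" and A': "assoc_algebra K A'"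
  shows "assoc_algebra K A"
proof -
  interpret assoc_algebra K A' by fact
  interpret monoid A'
    by (rule ring.is_monoid[OF assoc_algebra_ring[OF A']])
  have c: "carrier A = carrier A'"
    using same(1) by (simp add: same_module_def)
  have "bilinear_map K A A A = bilinear_map K A' A' A'"
    by (rule bilinear_map_same_module[OF same(1) same(1) same(1)])
  then have "bilinear_map K A A A (mult A)"
    using assoc_algebra_mult_bilinear[OF A'] by (simp add: same(2))
  then show ?thesis
    by (intro assoc_algebraI field_axioms same_module_module[OF same(1) module_axioms])
      (simp_all add: c same(2,3) alg_assoc)
qed

lemma tensor_algebra_same_module:
  assumes "same_module A A'" "mult A = mult A'" "one A = one A'"
    and "same_module B B'" "mult B = mult B'" "one B = one B'"
  shows "tensor_algebra K A B = tensor_algebra K A' B'"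
  by (simp only: tensor_algebra_def Let_def tensor_same_module[OF assms(1,4)]
      pure_tensor_same_module[OF assms(1,4)] assms(2,3,5,6)
      tensor_lift_same_module[OF same_module_refl, where V = A and V' = A' and W = B and W' = B'])

context hopf_cocycle
begin

abbreviation "HF \<equiv> hopf_twist K H F"

lemma hopf_twist_simps [simp]:
  "carrier HF = carrier H" "mult HF = mult H" "one HF = one H" "add HF = add H" "zero HF = zero H"
  "smult HF = smult H" "counit HF = counit H"
  by (simp_all add: hopf_twist_def Let_def)

lemma comult_twist: "comult HF h = F \<otimes>\<^bsub>HH\<^esub> comult H h \<otimes>\<^bsub>HH\<^esub> F'"
  by (simp add: hopf_twist_def Let_def)

lemma antipode_twist: "antipode HF h = U \<otimes>\<^bsub>H\<^esub> antipode H h \<otimes>\<^bsub>H\<^esub> V"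
  by (simp add: hopf_twist_def Let_def inv_U)

lemma same_module_twist: "same_module HF H"
  by (simp add: same_module_def)

lemma hopf_twist_as_module [simp]:
  "tensor K HF W = tensor K H W" "tensor K M HF = tensor K M H"
  "pure_tensor K HF W = pure_tensor K H W" "pure_tensor K M HF = pure_tensor K M H"
  "linear_map K HF W = linear_map K H W" "linear_map K M HF = linear_map K M H"
  by (auto intro!: tensor_same_module pure_tensor_same_module linear_map_same_module
      same_module_refl same_module_twist)

lemma tensor_lift_twist [simp]:
  "tensor_lift K HF W X = tensor_lift K H W X" "tensor_lift K M HF X = tensor_lift K M H X"
  "tensor_lift K M W HF = tensor_lift K M W H"
  by (auto intro!: ext tensor_lift_same_module[THEN fun_cong, THEN fun_cong] same_module_refl
      same_module_twist)

lemma tensor_algebra_twist [simp]: "tensor_algebra K HF HF = HH"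
  by (rule tensor_algebra_same_module) (simp_all add: same_module_twist)

lemma tensor_assoc_twist [simp]: "tensor_assoc K HF HF HF = tensor_assoc K H H H"
  by (simp add: tensor_assoc_def Let_def fun_eq_iff)

lemma counit_maps_twist [simp]:
  "counit_left K HF = counit_left K H" "counit_right K HF = counit_right K H"
  by (simp_all add: counit_left_def counit_right_def)

lemma comult_twist_linear: "linear_map K H TT (comult HF)"
  unfolding comult_twist[abs_def] by (intro hopf_linear_intros; simp)

lemma comult_twist_closed [simp]: "h \<in> carrier H \<Longrightarrow> comult HF h \<in> carrier TT"
  by (rule linear_map_closed[OF comult_twist_linear])

text \<open>
  On a pure tensor \<open>a \<otimes> b\<close> both sides are \<open>F (\<Delta> a) F' \<otimes> b\<close>.
\<close>

lemma comult_left_twist: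
  assumes "t \<in> carrier TT"
  shows "comult_left K HF t
    = pure_tensor K TT H F \<one>\<^bsub>H\<^esub> \<otimes>\<^bsub>HHl\<^esub> comult_left K H t \<otimes>\<^bsub>HHl\<^esub> pure_tensor K TT H F' \<one>\<^bsub>H\<^esub>"
proof -
  have eq: "comult_left K HF = tensor_lift K H H Tl (\<lambda>a b. pure_tensor K TT H (comult HF a) b)"
    by (simp add: comult_left_def tensor_map_def fun_eq_iff)
  have bil: "bilinear_map K H H Tl (\<lambda>a b. pure_tensor K TT H (comult HF a) b)"
    by (intro hopf_linear_intros; simp add: comult_twist_linear)
  show ?thesis
    unfolding eq
  proof (rule HH.tensor_map_unique[OF _ _ _ assms])
    show "linear_map K TT Tl (tensor_lift K H H Tl (\<lambda>a b. pure_tensor K TT H (comult HF a) b))"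
      by (rule HH.tensor_lift_linear) (simp_all add: bil)
    show "linear_map K TT Tl (\<lambda>t. pure_tensor K TT H F \<one>\<^bsub>H\<^esub> \<otimes>\<^bsub>HHl\<^esub> comult_left K H t
        \<otimes>\<^bsub>HHl\<^esub> pure_tensor K TT H F' \<one>\<^bsub>H\<^esub>)"
      by (intro linear_map_mult_left[OF HHl.tensor_algebra_assoc_algebra, simplified]
          linear_map_mult_right[OF HHl.tensor_algebra_assoc_algebra, simplified] comult_left_linear) simp_all
  qed (subst HH.tensor_lift_pure[OF HHl.tensor_module bil], simp_all add: comult_left_pure comult_twist)
qed

lemma comult_right_twist:
  assumes "t \<in> carrier TT"
  shows "comult_right K HF t
    = pure_tensor K H TT \<one>\<^bsub>H\<^esub> F \<otimes>\<^bsub>HHr\<^esub> comult_right K H t \<otimes>\<^bsub>HHr\<^esub> pure_tensor K H TT \<one>\<^bsub>H\<^esub> F'"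
proof -
  have eq: "comult_right K HF = tensor_lift K H H Tr (\<lambda>a b. pure_tensor K H TT a (comult HF b))"
    by (simp add: comult_right_def tensor_map_def fun_eq_iff)
  have bil: "bilinear_map K H H Tr (\<lambda>a b. pure_tensor K H TT a (comult HF b))"
    by (intro hopf_linear_intros; simp add: comult_twist_linear)
  show ?thesis
    unfolding eq
  proof (rule HH.tensor_map_unique[OF _ _ _ assms])
    show "linear_map K TT Tr (tensor_lift K H H Tr (\<lambda>a b. pure_tensor K H TT a (comult HF b)))"
      by (rule HH.tensor_lift_linear) (simp_all add: bil)
    show "linear_map K TT Tr (\<lambda>t. pure_tensor K H TT \<one>\<^bsub>H\<^esub> F \<otimes>\<^bsub>HHr\<^esub> comult_right K H t
        \<otimes>\<^bsub>HHr\<^esub> pure_tensor K H TT \<one>\<^bsub>H\<^esub> F')"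
      by (intro linear_map_mult_left[OF HHr.tensor_algebra_assoc_algebra, simplified]
          linear_map_mult_right[OF HHr.tensor_algebra_assoc_algebra, simplified] comult_right_linear) simp_all
  qed (subst HH.tensor_lift_pure[OF HHr.tensor_module bil], simp_all add: comult_right_pure comult_twist)
qed

text \<open>
  Both iterated coproducts of \<open>HF\<close> conjugate that of \<open>H\<close>; the cocycle identity says that they
  conjugate by the same element.
\<close>

lemma coassoc_twist:
  assumes h: "h \<in> carrier H"
  shows "tensor_assoc K H H H (comult_left K HF (comult HF h)) = comult_right K HF (comult HF h)"
proof -
  let ?a = "tensor_assoc K H H H"
  let ?p = "?a (pure_tensor K TT H F \<one>\<^bsub>H\<^esub>)" and ?p' = "?a (pure_tensor K TT H F' \<one>\<^bsub>H\<^esub>)"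
    and ?x = "?a (comult_left K H F)" and ?x' = "?a (comult_left K H F')"
    and ?q = "pure_tensor K H TT \<one>\<^bsub>H\<^esub> F" and ?q' = "pure_tensor K H TT \<one>\<^bsub>H\<^esub> F'"
    and ?y = "comult_right K H F" and ?y' = "comult_right K H F'"
    and ?d = "comult_right K H (comult H h)"
  have "?a (comult_left K HF (comult HF h)) = ?p \<otimes>\<^bsub>HHr\<^esub> (?x \<otimes>\<^bsub>HHr\<^esub> ?d \<otimes>\<^bsub>HHr\<^esub> ?x') \<otimes>\<^bsub>HHr\<^esub> ?p'"
    using h by (simp add: comult_left_twist comult_twist comult_left_mult tensor_assoc_mult coassoc)
  also have "\<dots> = (?p \<otimes>\<^bsub>HHr\<^esub> ?x) \<otimes>\<^bsub>HHr\<^esub> ?d \<otimes>\<^bsub>HHr\<^esub> (?x' \<otimes>\<^bsub>HHr\<^esub> ?p')"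
    using h by (simp add: HHr.tensor_mult_assoc)
  also have "\<dots> = (?q \<otimes>\<^bsub>HHr\<^esub> ?y) \<otimes>\<^bsub>HHr\<^esub> ?d \<otimes>\<^bsub>HHr\<^esub> (?y' \<otimes>\<^bsub>HHr\<^esub> ?q')"
    by (simp only: cocycle_eq cocycle_forms(3))
  also have "\<dots> = ?q \<otimes>\<^bsub>HHr\<^esub> (?y \<otimes>\<^bsub>HHr\<^esub> ?d \<otimes>\<^bsub>HHr\<^esub> ?y') \<otimes>\<^bsub>HHr\<^esub> ?q'"
    using h by (simp add: HHr.tensor_mult_assoc)
  also have "\<dots> = comult_right K HF (comult HF h)"
    using h by (simp add: comult_right_twist comult_twist comult_right_mult)
  finally show ?thesis .
qed

lemma HH_cancel:
  assumes "x \<in> carrier TT"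
  shows "F' \<otimes>\<^bsub>HH\<^esub> (F \<otimes>\<^bsub>HH\<^esub> x) = x" "F \<otimes>\<^bsub>HH\<^esub> (F' \<otimes>\<^bsub>HH\<^esub> x) = x"
  using assms by (simp_all add: HH.tensor_mult_assoc[symmetric] F_inverse HH.tensor_one)

lemma comult_twist_mult:
  assumes "x \<in> carrier H" "y \<in> carrier H"
  shows "comult HF (x \<otimes>\<^bsub>H\<^esub> y) = comult HF x \<otimes>\<^bsub>HH\<^esub> comult HF y"
  using assms by (simp add: comult_twist comult_mult HH.tensor_mult_assoc HH_cancel)

lemma comult_twist_one: "comult HF \<one>\<^bsub>H\<^esub> = \<one>\<^bsub>HH\<^esub>"
  using F_inverse(1) by (simp add: comult_twist comult_one HH.tensor_one)

lemma counit_twist: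
  assumes "h \<in> carrier H"
  shows "counit_left K H (comult HF h) = h" and "counit_right K H (comult HF h) = h"
  using assms by (simp_all add: comult_twist counit_left_mult counit_right_mult counit_F counit_F'
      counit_left counit_right)

lemma lift_F'_F:
  assumes "bilinear_map K H H H \<phi>"
  shows "LH (\<lambda>c d. LH (\<lambda>f g. \<phi> (c \<otimes>\<^bsub>H\<^esub> f) (d \<otimes>\<^bsub>H\<^esub> g)) F) F' = \<phi> \<one>\<^bsub>H\<^esub> \<one>\<^bsub>H\<^esub>"
  using HH.tensor_lift_mult[of H \<phi> F' F] assms by (simp add: F_inverse HH.tensor_lift_pure)

context
  fixes X assumes X: "X \<in> carrier TT"
begin

private lemmas lin = hopf_linear_intros

text \<open>
  \<open>S(F\<^sub>1 X\<^sub>1) V F\<^sub>2 X\<^sub>2 = S(X\<^sub>1) (S(F\<^sub>1) V F\<^sub>2) X\<^sub>2\<close>, and \<open>S(F\<^sub>1) V F\<^sub>2 = S(F'\<^sub>1 F\<^sub>1) F'\<^sub>2 F\<^sub>2 = 1\<close> because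
  \<open>F' F = 1\<close>.
\<close>

lemma antipode_left_F:
  "LH (\<lambda>x y. SH x \<otimes>\<^bsub>H\<^esub> (V \<otimes>\<^bsub>H\<^esub> y)) (F \<otimes>\<^bsub>HH\<^esub> X) = LH (\<lambda>x y. SH x \<otimes>\<^bsub>H\<^esub> y) X"
proof -
  have one: "LH (\<lambda>f g. SH f \<otimes>\<^bsub>H\<^esub> (V \<otimes>\<^bsub>H\<^esub> g)) F = \<one>\<^bsub>H\<^esub>"
  proof -
    have "LH (\<lambda>f g. SH f \<otimes>\<^bsub>H\<^esub> (V \<otimes>\<^bsub>H\<^esub> g)) F
        = LH (\<lambda>f g. LH (\<lambda>c d. SH (c \<otimes>\<^bsub>H\<^esub> f) \<otimes>\<^bsub>H\<^esub> (d \<otimes>\<^bsub>H\<^esub> g)) F') F"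
    proof (rule tensor_lift_cong)
      fix f g assume fg: "f \<in> carrier H" "g \<in> carrier H"
      have "SH f \<otimes>\<^bsub>H\<^esub> (V \<otimes>\<^bsub>H\<^esub> g) = LH (\<lambda>c d. SH f \<otimes>\<^bsub>H\<^esub> ((SH c \<otimes>\<^bsub>H\<^esub> d) \<otimes>\<^bsub>H\<^esub> g)) F'"
        unfolding V_def
        by (rule linear_map_tensor_lift[where g = "\<lambda>x. SH f \<otimes>\<^bsub>H\<^esub> (x \<otimes>\<^bsub>H\<^esub> g)"]; (intro lin)?; simp add: fg)
      also have "\<dots> = LH (\<lambda>c d. SH (c \<otimes>\<^bsub>H\<^esub> f) \<otimes>\<^bsub>H\<^esub> (d \<otimes>\<^bsub>H\<^esub> g)) F'"
        by (rule tensor_lift_cong; (intro lin)?; simp add: fg antipode_mult alg_assoc)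
      finally show "SH f \<otimes>\<^bsub>H\<^esub> (V \<otimes>\<^bsub>H\<^esub> g) = LH (\<lambda>c d. SH (c \<otimes>\<^bsub>H\<^esub> f) \<otimes>\<^bsub>H\<^esub> (d \<otimes>\<^bsub>H\<^esub> g)) F'" .
    qed ((intro lin)?; simp)+
    also have "\<dots> = LH (\<lambda>c d. LH (\<lambda>f g. SH (c \<otimes>\<^bsub>H\<^esub> f) \<otimes>\<^bsub>H\<^esub> (d \<otimes>\<^bsub>H\<^esub> g)) F) F'"
      by (rule tensor_lift_swap; (intro lin)?; simp)
    also have "\<dots> = SH \<one>\<^bsub>H\<^esub> \<otimes>\<^bsub>H\<^esub> \<one>\<^bsub>H\<^esub>"
      by (rule lift_F'_F; (intro lin)?; simp)
    finally show ?thesis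
      by (simp add: antipode_one)
  qed
  have "LH (\<lambda>x y. SH x \<otimes>\<^bsub>H\<^esub> (V \<otimes>\<^bsub>H\<^esub> y)) (F \<otimes>\<^bsub>HH\<^esub> X)
      = LH (\<lambda>f g. LH (\<lambda>x y. SH (f \<otimes>\<^bsub>H\<^esub> x) \<otimes>\<^bsub>H\<^esub> (V \<otimes>\<^bsub>H\<^esub> (g \<otimes>\<^bsub>H\<^esub> y))) X) F"
    by (rule HH.tensor_lift_mult; (intro lin)?; simp add: X)
  also have "\<dots> = LH (\<lambda>x y. LH (\<lambda>f g. SH (f \<otimes>\<^bsub>H\<^esub> x) \<otimes>\<^bsub>H\<^esub> (V \<otimes>\<^bsub>H\<^esub> (g \<otimes>\<^bsub>H\<^esub> y))) F) X"
    by (rule tensor_lift_swap; (intro lin)?; simp add: X)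
  also have "\<dots> = LH (\<lambda>x y. SH x \<otimes>\<^bsub>H\<^esub> y) X"
  proof (rule tensor_lift_cong)
    fix x y assume xy: "x \<in> carrier H" "y \<in> carrier H"
    have "LH (\<lambda>f g. SH (f \<otimes>\<^bsub>H\<^esub> x) \<otimes>\<^bsub>H\<^esub> (V \<otimes>\<^bsub>H\<^esub> (g \<otimes>\<^bsub>H\<^esub> y))) F
        = LH (\<lambda>f g. SH x \<otimes>\<^bsub>H\<^esub> ((SH f \<otimes>\<^bsub>H\<^esub> (V \<otimes>\<^bsub>H\<^esub> g)) \<otimes>\<^bsub>H\<^esub> y)) F"
      by (rule tensor_lift_cong; (intro lin)?; simp add: xy antipode_mult alg_assoc)
    also have "\<dots> = SH x \<otimes>\<^bsub>H\<^esub> (LH (\<lambda>f g. SH f \<otimes>\<^bsub>H\<^esub> (V \<otimes>\<^bsub>H\<^esub> g)) F \<otimes>\<^bsub>H\<^esub> y)"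
      by (rule linear_map_tensor_lift[symmetric, where g = "\<lambda>z. SH x \<otimes>\<^bsub>H\<^esub> (z \<otimes>\<^bsub>H\<^esub> y)"];
          (intro lin)?; simp add: xy)
    also have "\<dots> = SH x \<otimes>\<^bsub>H\<^esub> y"
      by (simp add: one xy)
    finally show "LH (\<lambda>f g. SH (f \<otimes>\<^bsub>H\<^esub> x) \<otimes>\<^bsub>H\<^esub> (V \<otimes>\<^bsub>H\<^esub> (g \<otimes>\<^bsub>H\<^esub> y))) F = SH x \<otimes>\<^bsub>H\<^esub> y" .
  qed ((intro lin)?; simp add: X)+
  finally show ?thesis .
qed

text \<open>
  \<open>X\<^sub>1 F'\<^sub>1 U S(X\<^sub>2 F'\<^sub>2) = X\<^sub>1 (F'\<^sub>1 U S(F'\<^sub>2)) S(X\<^sub>2)\<close>, and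
  \<open>F'\<^sub>1 U S(F'\<^sub>2) = F'\<^sub>1 F\<^sub>1 S(F'\<^sub>2 F\<^sub>2) = 1\<close> because \<open>F' F = 1\<close>.
\<close>

lemma antipode_right_F':
  "LH (\<lambda>x y. x \<otimes>\<^bsub>H\<^esub> (U \<otimes>\<^bsub>H\<^esub> SH y)) (X \<otimes>\<^bsub>HH\<^esub> F') = LH (\<lambda>x y. x \<otimes>\<^bsub>H\<^esub> SH y) X"
proof -
  have one: "LH (\<lambda>c d. c \<otimes>\<^bsub>H\<^esub> (U \<otimes>\<^bsub>H\<^esub> SH d)) F' = \<one>\<^bsub>H\<^esub>"
  proof -
    have "LH (\<lambda>c d. c \<otimes>\<^bsub>H\<^esub> (U \<otimes>\<^bsub>H\<^esub> SH d)) F'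
        = LH (\<lambda>c d. LH (\<lambda>f g. (c \<otimes>\<^bsub>H\<^esub> f) \<otimes>\<^bsub>H\<^esub> SH (d \<otimes>\<^bsub>H\<^esub> g)) F) F'"
    proof (rule tensor_lift_cong)
      fix c d assume cd: "c \<in> carrier H" "d \<in> carrier H"
      have "c \<otimes>\<^bsub>H\<^esub> (U \<otimes>\<^bsub>H\<^esub> SH d) = LH (\<lambda>f g. c \<otimes>\<^bsub>H\<^esub> ((f \<otimes>\<^bsub>H\<^esub> SH g) \<otimes>\<^bsub>H\<^esub> SH d)) F"
        unfolding twist_unit_def
        by (rule linear_map_tensor_lift[where g = "\<lambda>x. c \<otimes>\<^bsub>H\<^esub> (x \<otimes>\<^bsub>H\<^esub> SH d)"]; (intro lin)?; simp add: cd)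
      also have "\<dots> = LH (\<lambda>f g. (c \<otimes>\<^bsub>H\<^esub> f) \<otimes>\<^bsub>H\<^esub> SH (d \<otimes>\<^bsub>H\<^esub> g)) F"
        by (rule tensor_lift_cong; (intro lin)?; simp add: cd antipode_mult alg_assoc)
      finally show "c \<otimes>\<^bsub>H\<^esub> (U \<otimes>\<^bsub>H\<^esub> SH d) = LH (\<lambda>f g. (c \<otimes>\<^bsub>H\<^esub> f) \<otimes>\<^bsub>H\<^esub> SH (d \<otimes>\<^bsub>H\<^esub> g)) F" .
    qed ((intro lin)?; simp)+
    also have "\<dots> = \<one>\<^bsub>H\<^esub> \<otimes>\<^bsub>H\<^esub> SH \<one>\<^bsub>H\<^esub>"
      by (rule lift_F'_F; (intro lin)?; simp)
    finally show ?thesis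
      by (simp add: antipode_one)
  qed
  have "LH (\<lambda>x y. x \<otimes>\<^bsub>H\<^esub> (U \<otimes>\<^bsub>H\<^esub> SH y)) (X \<otimes>\<^bsub>HH\<^esub> F')
      = LH (\<lambda>x y. LH (\<lambda>c d. (x \<otimes>\<^bsub>H\<^esub> c) \<otimes>\<^bsub>H\<^esub> (U \<otimes>\<^bsub>H\<^esub> SH (y \<otimes>\<^bsub>H\<^esub> d))) F') X"
    by (rule HH.tensor_lift_mult; (intro lin)?; simp add: X)
  also have "\<dots> = LH (\<lambda>x y. x \<otimes>\<^bsub>H\<^esub> SH y) X"
  proof (rule tensor_lift_cong)
    fix x y assume xy: "x \<in> carrier H" "y \<in> carrier H"
    have "LH (\<lambda>c d. (x \<otimes>\<^bsub>H\<^esub> c) \<otimes>\<^bsub>H\<^esub> (U \<otimes>\<^bsub>H\<^esub> SH (y \<otimes>\<^bsub>H\<^esub> d))) F'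
        = LH (\<lambda>c d. x \<otimes>\<^bsub>H\<^esub> ((c \<otimes>\<^bsub>H\<^esub> (U \<otimes>\<^bsub>H\<^esub> SH d)) \<otimes>\<^bsub>H\<^esub> SH y)) F'"
      by (rule tensor_lift_cong; (intro lin)?; simp add: xy antipode_mult alg_assoc)
    also have "\<dots> = x \<otimes>\<^bsub>H\<^esub> (LH (\<lambda>c d. c \<otimes>\<^bsub>H\<^esub> (U \<otimes>\<^bsub>H\<^esub> SH d)) F' \<otimes>\<^bsub>H\<^esub> SH y)"
      by (rule linear_map_tensor_lift[symmetric, where g = "\<lambda>z. x \<otimes>\<^bsub>H\<^esub> (z \<otimes>\<^bsub>H\<^esub> SH y)"];
          (intro lin)?; simp add: xy)
    also have "\<dots> = x \<otimes>\<^bsub>H\<^esub> SH y"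
      by (simp add: one xy)
    finally show "LH (\<lambda>c d. (x \<otimes>\<^bsub>H\<^esub> c) \<otimes>\<^bsub>H\<^esub> (U \<otimes>\<^bsub>H\<^esub> SH (y \<otimes>\<^bsub>H\<^esub> d))) F' = x \<otimes>\<^bsub>H\<^esub> SH y" .
  qed ((intro lin)?; simp add: X)+
  finally show ?thesis .
qed

end

text \<open>
  \<open>S(h\<^sub>1 F'\<^sub>1) h\<^sub>2 F'\<^sub>2 = S(F'\<^sub>1) (S(h\<^sub>1) h\<^sub>2) F'\<^sub>2\<close>, and the bracket is \<open>\<epsilon>(h)\<close>. The mirror image of this
  calculation is \<open>antipode_right_F_comult\<close>.
\<close>

lemma antipode_left_comult_F':
  assumes h: "h \<in> carrier H"
  shows "LH (\<lambda>x y. SH x \<otimes>\<^bsub>H\<^esub> y) (comult H h \<otimes>\<^bsub>HH\<^esub> F') = counit H h \<odot>\<^bsub>H\<^esub> V"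
proof -
  note lin = hopf_linear_intros
  have "LH (\<lambda>x y. SH x \<otimes>\<^bsub>H\<^esub> y) (comult H h \<otimes>\<^bsub>HH\<^esub> F')
      = LH (\<lambda>x y. LH (\<lambda>c d. SH (x \<otimes>\<^bsub>H\<^esub> c) \<otimes>\<^bsub>H\<^esub> (y \<otimes>\<^bsub>H\<^esub> d)) F') (comult H h)"
    by (rule HH.tensor_lift_mult; (intro lin)?; simp add: h)
  also have "\<dots> = LH (\<lambda>c d. LH (\<lambda>x y. SH (x \<otimes>\<^bsub>H\<^esub> c) \<otimes>\<^bsub>H\<^esub> (y \<otimes>\<^bsub>H\<^esub> d)) (comult H h)) F'"
    by (rule tensor_lift_swap; (intro lin)?; simp add: h)
  also have "\<dots> = LH (\<lambda>c d. counit H h \<odot>\<^bsub>H\<^esub> (SH c \<otimes>\<^bsub>H\<^esub> d)) F'"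
  proof (rule tensor_lift_cong)
    fix c d assume cd: "c \<in> carrier H" "d \<in> carrier H"
    have "LH (\<lambda>x y. SH (x \<otimes>\<^bsub>H\<^esub> c) \<otimes>\<^bsub>H\<^esub> (y \<otimes>\<^bsub>H\<^esub> d)) (comult H h)
        = LH (\<lambda>x y. SH c \<otimes>\<^bsub>H\<^esub> ((SH x \<otimes>\<^bsub>H\<^esub> y) \<otimes>\<^bsub>H\<^esub> d)) (comult H h)"
      by (rule tensor_lift_cong; (intro lin)?; simp add: cd h antipode_mult alg_assoc)
    also have "\<dots> = SH c \<otimes>\<^bsub>H\<^esub> (LH (\<lambda>x y. SH x \<otimes>\<^bsub>H\<^esub> y) (comult H h) \<otimes>\<^bsub>H\<^esub> d)"
      by (rule linear_map_tensor_lift[symmetric, where g = "\<lambda>z. SH c \<otimes>\<^bsub>H\<^esub> (z \<otimes>\<^bsub>H\<^esub> d)"];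
          (intro lin)?; simp add: cd h)
    also have "\<dots> = counit H h \<odot>\<^bsub>H\<^esub> (SH c \<otimes>\<^bsub>H\<^esub> d)"
      using cd h by (simp add: antipode_left smult_mult_left smult_mult_right)
    finally show "LH (\<lambda>x y. SH (x \<otimes>\<^bsub>H\<^esub> c) \<otimes>\<^bsub>H\<^esub> (y \<otimes>\<^bsub>H\<^esub> d)) (comult H h)
        = counit H h \<odot>\<^bsub>H\<^esub> (SH c \<otimes>\<^bsub>H\<^esub> d)" .
  qed ((intro lin)?; simp add: h)+
  also have "\<dots> = counit H h \<odot>\<^bsub>H\<^esub> V"
    unfolding V_def
    by (rule linear_map_tensor_lift[symmetric, where g = "\<lambda>z. counit H h \<odot>\<^bsub>H\<^esub> z"]; (intro lin)?; simp add: h)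
  finally show ?thesis .
qed

lemma antipode_right_F_comult:
  assumes h: "h \<in> carrier H"
  shows "LH (\<lambda>x y. x \<otimes>\<^bsub>H\<^esub> SH y) (F \<otimes>\<^bsub>HH\<^esub> comult H h) = counit H h \<odot>\<^bsub>H\<^esub> U"
proof -
  note lin = hopf_linear_intros
  have "LH (\<lambda>x y. x \<otimes>\<^bsub>H\<^esub> SH y) (F \<otimes>\<^bsub>HH\<^esub> comult H h)
      = LH (\<lambda>f g. LH (\<lambda>x y. (f \<otimes>\<^bsub>H\<^esub> x) \<otimes>\<^bsub>H\<^esub> SH (g \<otimes>\<^bsub>H\<^esub> y)) (comult H h)) F"
    by (rule HH.tensor_lift_mult; (intro lin)?; simp add: h)
  also have "\<dots> = LH (\<lambda>f g. counit H h \<odot>\<^bsub>H\<^esub> (f \<otimes>\<^bsub>H\<^esub> SH g)) F"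
  proof (rule tensor_lift_cong)
    fix f g assume fg: "f \<in> carrier H" "g \<in> carrier H"
    have "LH (\<lambda>x y. (f \<otimes>\<^bsub>H\<^esub> x) \<otimes>\<^bsub>H\<^esub> SH (g \<otimes>\<^bsub>H\<^esub> y)) (comult H h)
        = LH (\<lambda>x y. f \<otimes>\<^bsub>H\<^esub> ((x \<otimes>\<^bsub>H\<^esub> SH y) \<otimes>\<^bsub>H\<^esub> SH g)) (comult H h)"
      by (rule tensor_lift_cong; (intro lin)?; simp add: fg h antipode_mult alg_assoc)
    also have "\<dots> = f \<otimes>\<^bsub>H\<^esub> (LH (\<lambda>x y. x \<otimes>\<^bsub>H\<^esub> SH y) (comult H h) \<otimes>\<^bsub>H\<^esub> SH g)"
      by (rule linear_map_tensor_lift[symmetric, where g = "\<lambda>z. f \<otimes>\<^bsub>H\<^esub> (z \<otimes>\<^bsub>H\<^esub> SH g)"];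
          (intro lin)?; simp add: fg h)
    also have "\<dots> = counit H h \<odot>\<^bsub>H\<^esub> (f \<otimes>\<^bsub>H\<^esub> SH g)"
      using fg h by (simp add: antipode_right smult_mult_left smult_mult_right)
    finally show "LH (\<lambda>x y. (f \<otimes>\<^bsub>H\<^esub> x) \<otimes>\<^bsub>H\<^esub> SH (g \<otimes>\<^bsub>H\<^esub> y)) (comult H h)
        = counit H h \<odot>\<^bsub>H\<^esub> (f \<otimes>\<^bsub>H\<^esub> SH g)" .
  qed ((intro lin)?; simp add: h)+
  also have "\<dots> = counit H h \<odot>\<^bsub>H\<^esub> U"
    unfolding twist_unit_def
    by (rule linear_map_tensor_lift[symmetric, where g = "\<lambda>z. counit H h \<odot>\<^bsub>H\<^esub> z"]; (intro lin)?; simp add: h)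
  finally show ?thesis .
qed

text \<open>
  With \<open>\<Delta>\<^sub>F h = F (\<Delta> h) F'\<close>, the factor \<open>F\<close> cancels against \<open>V\<close> and the factor \<open>F'\<close> turns
  \<open>\<epsilon>(h)\<close> into \<open>\<epsilon>(h) V\<close>, which cancels against \<open>U\<close>.
\<close>

lemma antipode_left_twist:
  assumes h: "h \<in> carrier H"
  shows "LH (\<lambda>x y. antipode HF x \<otimes>\<^bsub>H\<^esub> y) (comult HF h) = counit H h \<odot>\<^bsub>H\<^esub> \<one>\<^bsub>H\<^esub>"
proof -
  note lin = hopf_linear_intros
  have "LH (\<lambda>x y. antipode HF x \<otimes>\<^bsub>H\<^esub> y) (comult HF h)
      = LH (\<lambda>x y. U \<otimes>\<^bsub>H\<^esub> (SH x \<otimes>\<^bsub>H\<^esub> (V \<otimes>\<^bsub>H\<^esub> y))) (comult HF h)"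
    unfolding antipode_twist by (rule tensor_lift_cong; (intro lin)?; simp add: h alg_assoc)
  also have "\<dots> = U \<otimes>\<^bsub>H\<^esub> LH (\<lambda>x y. SH x \<otimes>\<^bsub>H\<^esub> (V \<otimes>\<^bsub>H\<^esub> y)) (comult HF h)"
    by (rule linear_map_tensor_lift[symmetric, where g = "\<lambda>z. U \<otimes>\<^bsub>H\<^esub> z"]; (intro lin)?; simp add: h)
  also have "\<dots> = U \<otimes>\<^bsub>H\<^esub> LH (\<lambda>x y. SH x \<otimes>\<^bsub>H\<^esub> (V \<otimes>\<^bsub>H\<^esub> y)) (F \<otimes>\<^bsub>HH\<^esub> (comult H h \<otimes>\<^bsub>HH\<^esub> F'))"
    using h by (simp add: comult_twist HH.tensor_mult_assoc)
  also have "\<dots> = counit H h \<odot>\<^bsub>H\<^esub> \<one>\<^bsub>H\<^esub>"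
    using h by (simp add: antipode_left_F antipode_left_comult_F' smult_mult_right U_V)
  finally show ?thesis .
qed

lemma antipode_right_twist:
  assumes h: "h \<in> carrier H"
  shows "LH (\<lambda>x y. x \<otimes>\<^bsub>H\<^esub> antipode HF y) (comult HF h) = counit H h \<odot>\<^bsub>H\<^esub> \<one>\<^bsub>H\<^esub>"
proof -
  note lin = hopf_linear_intros
  have "LH (\<lambda>x y. x \<otimes>\<^bsub>H\<^esub> antipode HF y) (comult HF h)
      = LH (\<lambda>x y. (x \<otimes>\<^bsub>H\<^esub> (U \<otimes>\<^bsub>H\<^esub> SH y)) \<otimes>\<^bsub>H\<^esub> V) (comult HF h)"
    unfolding antipode_twist by (rule tensor_lift_cong; (intro lin)?; simp add: h alg_assoc)
  also have "\<dots> = LH (\<lambda>x y. x \<otimes>\<^bsub>H\<^esub> (U \<otimes>\<^bsub>H\<^esub> SH y)) (comult HF h) \<otimes>\<^bsub>H\<^esub> V"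
    by (rule linear_map_tensor_lift[symmetric, where g = "\<lambda>z. z \<otimes>\<^bsub>H\<^esub> V"]; (intro lin)?; simp add: h)
  finally show ?thesis
    using h by (simp add: comult_twist antipode_right_F' antipode_right_F_comult smult_mult_left U_V)
qed

lemma hopf_algebra_twist: "hopf_algebra K HF"
proof (intro hopf_algebra.intro hopf_algebra_axioms.intro)
  show "assoc_algebra K HF"
    by (rule assoc_algebra_same_module[OF same_module_twist _ _ assoc_algebra_axioms]) simp_all
  show "linear_map K HF (tensor K HF HF) (comult HF)"
    by (simp add: comult_twist_linear)
  show "comult HF \<in> ring_hom HF (tensor_algebra K HF HF)"
    by (rule ring_hom_memI)
      (simp_all add: comult_twist_mult comult_twist_one linear_map_add[OF comult_twist_linear])
  show "counit HF \<in> ring_hom HF K"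
    using counit_hom by (simp add: ring_hom_def)
  show "linear_map K HF HF (antipode HF)"
    unfolding antipode_twist[abs_def] by (simp, intro hopf_linear_intros; simp)
qed (simp_all add: counit_smult coassoc_twist antipode_left_twist antipode_right_twist counit_twist)

end

section \<open>Actions on tensor products of module algebras\<close>

context h_module_algebra
begin

lemma act_closed [simp]: "\<lbrakk>h \<in> carrier H; x \<in> carrier A\<rbrakk> \<Longrightarrow> act A h x \<in> carrier A"
  by (rule linear_map_closed[OF act_linear_right])

lemma linear_map_act_right:
  "\<lbrakk>h \<in> carrier H; linear_map K X A f\<rbrakk> \<Longrightarrow> linear_map K X A (\<lambda>x. act A h (f x))"
  by (rule linear_map_compose[OF act_linear_right])

lemma linear_map_act_left:
  "\<lbrakk>x \<in> carrier A; linear_map K X H f\<rbrakk> \<Longrightarrow> linear_map K X A (\<lambda>h. act A (f h) x)"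
  by (rule linear_map_compose[OF act_linear_left])

end

locale h_module_algebra_pair = M: h_module_algebra K H M + N: h_module_algebra K H N
  for K :: "('k, 'm) ring_scheme" (structure) and H :: "('k, 'h) hopf"
    and M :: "('k, 'v, 'h) hopf_module" and N :: "('k, 'w, 'h) hopf_module"
begin

sublocale MN: algebra_pair K M N
  by (intro algebra_pair.intro M.A.assoc_algebra_axioms N.A.assoc_algebra_axioms)

lemmas act_linear_intros = M.H.hopf_linear_intros M.linear_map_act_left M.linear_map_act_right
  N.linear_map_act_left N.linear_map_act_right

lemma tensor_act_eq:
  "tensor_act K H M N X t = tensor_lift K H H (tensor K M N)
     (\<lambda>g h. tensor_lift K M N (tensor K M N) (\<lambda>v w. pure_tensor K M N (act M g v) (act N h w)) t) X"
  by (simp add: tensor_act_def tensor_map_def)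

lemma tensor_act_bilinear:
  "bilinear_map K (tensor K H H) (tensor K M N) (tensor K M N) (tensor_act K H M N)"
  unfolding tensor_act_eq[abs_def] by (intro act_linear_intros; simp)

lemma tensor_act_closed [simp]:
  "\<lbrakk>X \<in> carrier (tensor K H H); t \<in> carrier (tensor K M N)\<rbrakk>
    \<Longrightarrow> tensor_act K H M N X t \<in> carrier (tensor K M N)"
  by (rule bilinear_map_closed[OF tensor_act_bilinear])

lemmas tensor_act_add =
  linear_map_add[OF bilinear_map_left[OF tensor_act_bilinear]]
  linear_map_add[OF bilinear_map_right[OF tensor_act_bilinear]]

lemma tensor_act_pure_right:
  assumes "X \<in> carrier (tensor K H H)" "v \<in> carrier M" "w \<in> carrier N"
  shows "tensor_act K H M N X (pure_tensor K M N v w)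
    = tensor_lift K H H (tensor K M N) (\<lambda>g h. pure_tensor K M N (act M g v) (act N h w)) X"
  unfolding tensor_act_eq
proof (rule tensor_lift_cong)
  fix g h assume "g \<in> carrier H" "h \<in> carrier H"
  then show "tensor_lift K M N (tensor K M N) (\<lambda>v w. pure_tensor K M N (act M g v) (act N h w))
        (pure_tensor K M N v w)
      = pure_tensor K M N (act M g v) (act N h w)"
    by (intro tensor_lift_pure'; (intro act_linear_intros)?; simp add: assms)
qed ((intro act_linear_intros)?; simp add: assms)+

lemma tensor_act_pure [simp]:
  assumes "g \<in> carrier H" "h \<in> carrier H" "v \<in> carrier M" "w \<in> carrier N"
  shows "tensor_act K H M N (pure_tensor K H H g h) (pure_tensor K M N v w)
    = pure_tensor K M N (act M g v) (act N h w)"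
  by (subst tensor_act_pure_right; (simp add: assms)?)
    (rule tensor_lift_pure'; (intro act_linear_intros)?; simp add: assms)

lemma tensor_act_one:
  assumes "t \<in> carrier (tensor K M N)"
  shows "tensor_act K H M N \<one>\<^bsub>tensor_algebra K H H\<^esub> t = t"
  using assms by (induction t rule: MN.tensor_induct)
    (simp_all add: M.act_one N.act_one tensor_act_add)

lemma tensor_act_mult:
  assumes X: "X \<in> carrier (tensor K H H)" and Y: "Y \<in> carrier (tensor K H H)"
    and t: "t \<in> carrier (tensor K M N)"
  shows "tensor_act K H M N (X \<otimes>\<^bsub>tensor_algebra K H H\<^esub> Y) t
    = tensor_act K H M N X (tensor_act K H M N Y t)"
  using X
proof (induction X rule: M.H.HH.tensor_induct)
  case (pure g h)
  note gh = this
  from Y show ?case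
  proof (induction Y rule: M.H.HH.tensor_induct)
    case (pure g' h')
    from t show ?case
      by (induction t rule: MN.tensor_induct)
        (use gh pure in \<open>simp_all add: M.act_mult N.act_mult tensor_act_add\<close>)
  qed (use gh t in \<open>simp add: tensor_act_add\<close>)
qed (simp add: Y t tensor_act_add)

end

text \<open>
  The factors \<open>A\<close> and \<open>B\<close> are records of their own, possibly different from \<open>C\<close> outside their
  carriers, so agreement with \<open>C\<close> has to be invoked explicitly. The case \<open>A = B = C\<close> covers the
  product of a single module algebra.
\<close>

locale h_module_subalgebra_pair = h_module_algebra_pair K H A B + C: h_module_algebra K H C
  for K :: "('k, 'm) ring_scheme" (structure) and H :: "('k, 'h) hopf"
    and A B C :: "('k, 'c, 'h) hopf_module" +
  assumes A: "is_h_module_subalgebra K H A C" and B: "is_h_module_subalgebra K H B C"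
begin

lemma inclusion_linear:
  "linear_map K X A f \<Longrightarrow> linear_map K X C f" "linear_map K X B g \<Longrightarrow> linear_map K X C g"
  using A B by (auto simp: is_h_module_subalgebra_def is_subalgebra_def linear_map_def Pi_iff subset_iff)

lemma inclusion [simp]: "x \<in> carrier A \<Longrightarrow> x \<in> carrier C" "x \<in> carrier B \<Longrightarrow> x \<in> carrier C"
  using A B by (auto simp: is_h_module_subalgebra_def is_subalgebra_def)

lemma act_restrict:
  "\<lbrakk>h \<in> carrier H; x \<in> carrier A\<rbrakk> \<Longrightarrow> act A h x = act C h x"
  "\<lbrakk>h \<in> carrier H; x \<in> carrier B\<rbrakk> \<Longrightarrow> act B h x = act C h x"
  using A B by (auto simp: is_h_module_subalgebra_def)

lemma C_module [simp]: "module K C" and C_algebra [simp]: "assoc_algebra K C"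
  using C.A.module_axioms C.A.assoc_algebra_axioms by simp_all

lemma mult_C_bilinear: "bilinear_map K A B C (mult C)"
  by (intro bilinear_mapI linear_map_mult_right linear_map_mult_left inclusion_linear linear_map_ident)
    simp_all

lemma mult_map_linear: "linear_map K (tensor K A B) C (mult_map K A B C)"
  unfolding mult_map_def by (rule MN.tensor_lift_linear) (simp_all add: mult_C_bilinear)

lemma mult_map_closed [simp]: "t \<in> carrier (tensor K A B) \<Longrightarrow> mult_map K A B C t \<in> carrier C"
  by (rule linear_map_closed[OF mult_map_linear])

lemma mult_map_pure [simp]:
  "\<lbrakk>a \<in> carrier A; b \<in> carrier B\<rbrakk> \<Longrightarrow> mult_map K A B C (pure_tensor K A B a b) = a \<otimes>\<^bsub>C\<^esub> b"
  unfolding mult_map_def by (rule MN.tensor_lift_pure) (simp_all add: mult_C_bilinear)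

lemma mult_map_act_pure:
  assumes X: "X \<in> carrier (tensor K H H)" and ab: "a \<in> carrier A" "b \<in> carrier B"
  shows "mult_map K A B C (tensor_act K H A B X (pure_tensor K A B a b))
    = tensor_lift K H H C (\<lambda>g h. act C g a \<otimes>\<^bsub>C\<^esub> act C h b) X"
proof -
  note lin = act_linear_intros C.linear_map_act_left C.linear_map_act_right
  have "mult_map K A B C (tensor_act K H A B X (pure_tensor K A B a b))
      = tensor_lift K H H C (\<lambda>g h. mult_map K A B C (pure_tensor K A B (act A g a) (act B h b))) X"
    unfolding tensor_act_pure_right[OF assms]
    by (rule linear_map_tensor_lift[OF _ _ _ _ mult_map_linear]; (intro lin)?; simp add: assms)
  also have "\<dots> = tensor_lift K H H C (\<lambda>g h. act C g a \<otimes>\<^bsub>C\<^esub> act C h b) X"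
    by (rule tensor_lift_cong[symmetric]; (intro lin)?; simp add: assms act_restrict[symmetric])
  finally show ?thesis .
qed

end

lemma is_h_module_subalgebra_refl:
  assumes "h_module_algebra K H A"
  shows "is_h_module_subalgebra K H A A"
proof -
  interpret h_module_algebra K H A by fact
  show ?thesis
    by (simp add: is_h_module_subalgebra_def is_subalgebra_def assms A.assoc_algebra_axioms)
qed

section \<open>Twisting a module algebra\<close>

lemma cocycle_twist_simps [simp]:
  fixes A :: "('k, 'a, 'h) hopf_module"
  shows "carrier (cocycle_twist K H F A) = carrier A" "one (cocycle_twist K H F A) = one A"
    "add (cocycle_twist K H F A) = add A" "zero (cocycle_twist K H F A) = zero A"
    "smult (cocycle_twist K H F A) = smult A" "act (cocycle_twist K H F A) = act A"
  by (simp_all add: cocycle_twist_def)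

lemma same_module_cocycle_twist: "same_module (cocycle_twist K H F A) A"
  by (simp add: same_module_def)

lemma cocycle_twist_as_module [simp]:
  "tensor K (cocycle_twist K H F A) N = tensor K A N"
  "tensor K M (cocycle_twist K H F A) = tensor K M A"
  "pure_tensor K (cocycle_twist K H F A) N = pure_tensor K A N"
  "pure_tensor K M (cocycle_twist K H F A) = pure_tensor K M A"
  "linear_map K (cocycle_twist K H F A) N = linear_map K A N"
  "linear_map K M (cocycle_twist K H F A) = linear_map K M A"
  by (auto intro!: tensor_same_module pure_tensor_same_module linear_map_same_module
      same_module_refl same_module_cocycle_twist)

lemma tensor_lift_cocycle_twist [simp]:
  "tensor_lift K (cocycle_twist K H F A) N X = tensor_lift K A N X"
  "tensor_lift K M (cocycle_twist K H F A) X = tensor_lift K M A X"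
  "tensor_lift K M N (cocycle_twist K H F A) = tensor_lift K M N A"
  by (auto intro!: ext tensor_lift_same_module[THEN fun_cong, THEN fun_cong] same_module_refl
      same_module_cocycle_twist)

locale twisted_module_algebra = hopf_cocycle K H F + MA: h_module_algebra K H A
  for K :: "('k, 'm) ring_scheme" (structure) and H :: "('k, 'h) hopf" (structure)
    and F :: "('k, 'h, 'h) tensor" and A :: "('k, 'a, 'h) hopf_module"
begin

sublocale AA: h_module_subalgebra_pair K H A A A
  by (intro h_module_subalgebra_pair.intro h_module_algebra_pair.intro
      h_module_subalgebra_pair_axioms.intro is_h_module_subalgebra_refl
      MA.h_module_algebra_axioms)

abbreviation "AF \<equiv> cocycle_twist K H F A"

lemmas lin_A = hopf_linear_intros MA.linear_map_act_left MA.linear_map_act_right MA.act_closed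

lemma twisted_mult:
  "\<lbrakk>x \<in> carrier A; y \<in> carrier A\<rbrakk>
    \<Longrightarrow> x \<otimes>\<^bsub>AF\<^esub> y = tensor_lift K H H A (\<lambda>g h. act A g x \<otimes>\<^bsub>A\<^esub> act A h y) F'"
  by (simp add: cocycle_twist_def AA.mult_map_act_pure)

lemma mult_closed_A [simp]: "\<lbrakk>x \<in> carrier A; y \<in> carrier A\<rbrakk> \<Longrightarrow> x \<otimes>\<^bsub>A\<^esub> y \<in> carrier A"
  by (rule monoid.m_closed[OF ring.is_monoid[OF assoc_algebra_ring[OF MA.A.assoc_algebra_axioms]]])

lemma twisted_mult_closed [simp]: "\<lbrakk>x \<in> carrier A; y \<in> carrier A\<rbrakk> \<Longrightarrow> x \<otimes>\<^bsub>AF\<^esub> y \<in> carrier A"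
  by (simp add: twisted_mult) (intro lin_A; simp)

lemma act_mult_map:
  assumes h: "h \<in> carrier H" and t: "t \<in> carrier (tensor K A A)"
  shows "act A h (mult_map K A A A t) = mult_map K A A A (tensor_act K H A A (comult H h) t)"
  using t
proof (induction t rule: AA.MN.tensor_induct)
  case (pure x y)
  then show ?case
    using h by (simp add: MA.act_prod)
next
  case (add s t)
  then show ?case
    using h by (simp add: linear_map_add[OF AA.mult_map_linear] linear_map_add[OF MA.act_linear_right]
        AA.tensor_act_add)
qed

text \<open>
  If \<open>X\<close> and then \<open>h\<close> act, the result is the action of \<open>(\<Delta> h) X\<close>; so nested actions on a product
  combine into one element of \<open>H \<otimes> H\<close>.
\<close>

lemma act_lift_mult:
  assumes h: "h \<in> carrier H" and X: "X \<in> carrier TT" and xy: "x \<in> carrier A" "y \<in> carrier A"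
  shows "act A h (tensor_lift K H H A (\<lambda>g h. act A g x \<otimes>\<^bsub>A\<^esub> act A h y) X)
    = tensor_lift K H H A (\<lambda>g h. act A g x \<otimes>\<^bsub>A\<^esub> act A h y) (comult H h \<otimes>\<^bsub>HH\<^esub> X)"
  using assms
  by (simp add: AA.mult_map_act_pure[symmetric] act_mult_map AA.tensor_act_mult)

text \<open>
  Both sides are sums of \<open>(a \<rhd> x) (b \<rhd> y) (c \<rhd> z)\<close>: the left one over the components
  \<open>a \<otimes> b \<otimes> c\<close> of \<open>(\<Delta> \<otimes> id)(F') (F' \<otimes> 1)\<close>, the right one over those of
  \<open>(id \<otimes> \<Delta>)(F') (1 \<otimes> F')\<close>.
\<close>

lemma twisted_mult_assoc:
  assumes xyz: "x \<in> carrier A" "y \<in> carrier A" "z \<in> carrier A"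
  shows "x \<otimes>\<^bsub>AF\<^esub> y \<otimes>\<^bsub>AF\<^esub> z = x \<otimes>\<^bsub>AF\<^esub> (y \<otimes>\<^bsub>AF\<^esub> z)"
proof -
  let ?L = "tensor_lift K H H A"
  let ?\<phi> = "\<lambda>a b c. act A a x \<otimes>\<^bsub>A\<^esub> (act A b y \<otimes>\<^bsub>A\<^esub> act A c z)"
  have \<phi>: "trilinear_map K H H H A ?\<phi>"
    by (intro lin_A; simp add: xyz)
  have mod: "module K A" by simp
  have "x \<otimes>\<^bsub>AF\<^esub> y \<otimes>\<^bsub>AF\<^esub> z
      = ?L (\<lambda>a b. act A a (?L (\<lambda>g h. act A g x \<otimes>\<^bsub>A\<^esub> act A h y) F') \<otimes>\<^bsub>A\<^esub> act A b z) F'"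
    by (subst twisted_mult[OF twisted_mult_closed[OF xyz(1,2)] xyz(3)])
      (simp only: twisted_mult[OF xyz(1,2)])
  also have "\<dots> = ?L (\<lambda>a b. ?L (\<lambda>p q. ?L (\<lambda>c d. ?\<phi> (p \<otimes>\<^bsub>H\<^esub> c) (q \<otimes>\<^bsub>H\<^esub> d) b) F') (comult H a)) F'"
  proof (rule tensor_lift_cong)
    fix a b assume ab: "a \<in> carrier H" "b \<in> carrier H"
    have "act A a (?L (\<lambda>g h. act A g x \<otimes>\<^bsub>A\<^esub> act A h y) F') \<otimes>\<^bsub>A\<^esub> act A b z
        = ?L (\<lambda>g h. act A g x \<otimes>\<^bsub>A\<^esub> act A h y) (comult H a \<otimes>\<^bsub>HH\<^esub> F') \<otimes>\<^bsub>A\<^esub> act A b z"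
      by (simp add: act_lift_mult ab xyz)
    also have "\<dots> = ?L (\<lambda>g h. (act A g x \<otimes>\<^bsub>A\<^esub> act A h y) \<otimes>\<^bsub>A\<^esub> act A b z) (comult H a \<otimes>\<^bsub>HH\<^esub> F')"
      by (rule linear_map_tensor_lift[where g = "\<lambda>w. w \<otimes>\<^bsub>A\<^esub> act A b z"]; (intro lin_A)?; simp add: ab xyz)
    also have "\<dots> = ?L (\<lambda>g h. ?\<phi> g h b) (comult H a \<otimes>\<^bsub>HH\<^esub> F')"
      by (rule tensor_lift_cong; (intro lin_A)?; simp add: ab xyz MA.A.alg_assoc)
    also have "\<dots> = ?L (\<lambda>p q. ?L (\<lambda>c d. ?\<phi> (p \<otimes>\<^bsub>H\<^esub> c) (q \<otimes>\<^bsub>H\<^esub> d) b) F') (comult H a)"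
      by (rule HH.tensor_lift_mult; (intro lin_A)?; simp add: ab xyz)
    finally show "act A a (?L (\<lambda>g h. act A g x \<otimes>\<^bsub>A\<^esub> act A h y) F') \<otimes>\<^bsub>A\<^esub> act A b z
        = ?L (\<lambda>p q. ?L (\<lambda>c d. ?\<phi> (p \<otimes>\<^bsub>H\<^esub> c) (q \<otimes>\<^bsub>H\<^esub> d) b) F') (comult H a)" .
  qed ((intro lin_A)?; simp add: xyz)+
  also have "\<dots> = tensor_lift3 K H H H A ?\<phi> (tensor_assoc K H H H (comult_left K H F')
      \<otimes>\<^bsub>HHr\<^esub> tensor_assoc K H H H (pure_tensor K TT H F' \<one>\<^bsub>H\<^esub>))"
    by (rule sum_comult_left_left[OF mod \<phi>, symmetric]) simp_all
  also have "\<dots> = tensor_lift3 K H H H A ?\<phi> (comult_right K H F' \<otimes>\<^bsub>HHr\<^esub> pure_tensor K H TT \<one>\<^bsub>H\<^esub> F')"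
    by (simp only: cocycle_forms(3))
  also have "\<dots> = ?L (\<lambda>a b. ?L (\<lambda>p q. ?L (\<lambda>c d. ?\<phi> a (p \<otimes>\<^bsub>H\<^esub> c) (q \<otimes>\<^bsub>H\<^esub> d)) F') (comult H b)) F'"
    by (rule sum_comult_right_right[OF mod \<phi>]) simp_all
  also have "\<dots> = ?L (\<lambda>a b. act A a x \<otimes>\<^bsub>A\<^esub> act A b (?L (\<lambda>g h. act A g y \<otimes>\<^bsub>A\<^esub> act A h z) F')) F'"
  proof (rule tensor_lift_cong)
    fix a b assume ab: "a \<in> carrier H" "b \<in> carrier H"
    have "act A a x \<otimes>\<^bsub>A\<^esub> act A b (?L (\<lambda>g h. act A g y \<otimes>\<^bsub>A\<^esub> act A h z) F')
        = act A a x \<otimes>\<^bsub>A\<^esub> ?L (\<lambda>g h. act A g y \<otimes>\<^bsub>A\<^esub> act A h z) (comult H b \<otimes>\<^bsub>HH\<^esub> F')"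
      by (simp add: act_lift_mult ab xyz)
    also have "\<dots> = ?L (?\<phi> a) (comult H b \<otimes>\<^bsub>HH\<^esub> F')"
      by (rule linear_map_tensor_lift[where g = "\<lambda>w. act A a x \<otimes>\<^bsub>A\<^esub> w"]; (intro lin_A)?; simp add: ab xyz)
    also have "\<dots> = ?L (\<lambda>p q. ?L (\<lambda>c d. ?\<phi> a (p \<otimes>\<^bsub>H\<^esub> c) (q \<otimes>\<^bsub>H\<^esub> d)) F') (comult H b)"
      by (rule HH.tensor_lift_mult; (intro lin_A)?; simp add: ab xyz)
    finally show "?L (\<lambda>p q. ?L (\<lambda>c d. ?\<phi> a (p \<otimes>\<^bsub>H\<^esub> c) (q \<otimes>\<^bsub>H\<^esub> d)) F') (comult H b)
        = act A a x \<otimes>\<^bsub>A\<^esub> act A b (?L (\<lambda>g h. act A g y \<otimes>\<^bsub>A\<^esub> act A h z) F')" ..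
  qed ((intro lin_A)?; simp add: xyz)+
  also have "\<dots> = x \<otimes>\<^bsub>AF\<^esub> (y \<otimes>\<^bsub>AF\<^esub> z)"
    by (subst twisted_mult[OF xyz(1) twisted_mult_closed[OF xyz(2,3)]])
      (simp only: twisted_mult[OF xyz(2,3)])
  finally show ?thesis .
qed

lemma one_closed_A [simp]: "\<one>\<^bsub>A\<^esub> \<in> carrier A"
  by (rule monoid.one_closed[OF ring.is_monoid[OF assoc_algebra_ring[OF MA.A.assoc_algebra_axioms]]])

lemma one_mult_A [simp]:
  assumes "x \<in> carrier A"
  shows "\<one>\<^bsub>A\<^esub> \<otimes>\<^bsub>A\<^esub> x = x" "x \<otimes>\<^bsub>A\<^esub> \<one>\<^bsub>A\<^esub> = x"
  using assms monoid.l_one[OF ring.is_monoid[OF assoc_algebra_ring[OF MA.A.assoc_algebra_axioms]]]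
    monoid.r_one[OF ring.is_monoid[OF assoc_algebra_ring[OF MA.A.assoc_algebra_axioms]]] by simp_all

lemma act_smult:
  "\<lbrakk>c \<in> carrier K; h \<in> carrier H; x \<in> carrier A\<rbrakk> \<Longrightarrow> act A (c \<odot>\<^bsub>H\<^esub> h) x = c \<odot>\<^bsub>A\<^esub> act A h x"
  by (rule linear_map_smult[OF MA.act_linear_left])

text \<open>
  \<open>H\<close> acts on \<open>1\<close> through \<open>\<epsilon>\<close>, which leaves \<open>(id \<otimes> \<epsilon>)(F') = 1\<close> acting on \<open>x\<close>.
\<close>

lemma twisted_one_right:
  assumes x: "x \<in> carrier A"
  shows "x \<otimes>\<^bsub>AF\<^esub> \<one>\<^bsub>A\<^esub> = x"
proof -
  have "x \<otimes>\<^bsub>AF\<^esub> \<one>\<^bsub>A\<^esub> = tensor_lift K H H A (\<lambda>g h. act A (counit H h \<odot>\<^bsub>H\<^esub> g) x) F'"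
    unfolding twisted_mult[OF x one_closed_A]
    by (rule tensor_lift_cong; (intro lin_A)?;
        simp add: x MA.act_unit MA.A.smult_mult_right act_smult)
  also have "\<dots> = act A (LH (\<lambda>g h. counit H h \<odot>\<^bsub>H\<^esub> g) F') x"
    by (rule linear_map_tensor_lift[symmetric, where g = "\<lambda>h. act A h x"]; (intro lin_A)?; simp add: x)
  also have "\<dots> = x"
    using counit_F'(2) x by (simp add: counit_right_def MA.act_one)
  finally show ?thesis .
qed

lemma twisted_one_left:
  assumes x: "x \<in> carrier A"
  shows "\<one>\<^bsub>A\<^esub> \<otimes>\<^bsub>AF\<^esub> x = x"
proof -
  have "\<one>\<^bsub>A\<^esub> \<otimes>\<^bsub>AF\<^esub> x = tensor_lift K H H A (\<lambda>g h. act A (counit H g \<odot>\<^bsub>H\<^esub> h) x) F'"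
    unfolding twisted_mult[OF one_closed_A x]
    by (rule tensor_lift_cong; (intro lin_A)?;
        simp add: x MA.act_unit MA.A.smult_mult_left act_smult)
  also have "\<dots> = act A (LH (\<lambda>g h. counit H g \<odot>\<^bsub>H\<^esub> h) F') x"
    by (rule linear_map_tensor_lift[symmetric, where g = "\<lambda>h. act A h x"]; (intro lin_A)?; simp add: x)
  also have "\<dots> = x"
    using counit_F'(1) x by (simp add: counit_left_def MA.act_one)
  finally show ?thesis .
qed

lemma twisted_mult_bilinear: "bilinear_map K A A A (mult AF)"
proof -
  have "bilinear_map K A A A (\<lambda>x y. tensor_lift K H H A (\<lambda>g h. act A g x \<otimes>\<^bsub>A\<^esub> act A h y) F')"
    by (intro lin_A; simp)
  then show ?thesis
    unfolding bilinear_map_def linear_map_def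
    by (simp add: Pi_iff twisted_mult[symmetric])
qed

lemma twisted_assoc_algebra: "assoc_algebra K AF"
proof (rule assoc_algebraI)
  have "bilinear_map K AF AF AF = bilinear_map K A A A"
    by (intro bilinear_map_same_module same_module_cocycle_twist)
  then show "bilinear_map K AF AF AF (mult AF)"
    by (simp add: twisted_mult_bilinear)
  show "module K AF"
    by (rule same_module_module[OF same_module_cocycle_twist]) simp
qed (simp_all add: field_axioms twisted_mult_assoc twisted_one_left twisted_one_right)

end

section \<open>Twisting a factorisation\<close>

locale twisted_factors = hopf_cocycle K H F + AB: h_module_subalgebra_pair K H A B C
  for K :: "('k, 'm) ring_scheme" (structure) and H :: "('k, 'h) hopf" (structure)
    and F :: "('k, 'h, 'h) tensor" and A B C :: "('k, 'c, 'h) hopf_module"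
begin

sublocale C: twisted_module_algebra K H F C
  by (intro twisted_module_algebra.intro hopf_cocycle_axioms AB.C.h_module_algebra_axioms)

lemma tensor_act_twist [simp]:
  "tensor_act K HF (cocycle_twist K H F A) (cocycle_twist K H F B) = tensor_act K H A B"
  by (intro ext) (simp add: tensor_act_def tensor_map_def)

text \<open>
  Both sides are linear in \<open>t\<close>, and on a pure tensor \<open>a \<otimes> b\<close> they are the twisted product of \<open>a\<close> and
  \<open>b\<close> by definition.
\<close>

lemma mult_map_twist:
  assumes t: "t \<in> carrier (tensor K A B)"
  shows "mult_map K (cocycle_twist K H F A) (cocycle_twist K H F B) (cocycle_twist K H F C) t
    = mult_map K A B C (tensor_act K H A B F' t)"
proof -
  have bil: "bilinear_map K A B C (mult (cocycle_twist K H F C))"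
    by (intro bilinear_mapI linear_map_bilinear_left[OF C.twisted_mult_bilinear]
        linear_map_bilinear_right[OF C.twisted_mult_bilinear] AB.inclusion_linear linear_map_ident)
      simp_all
  have "tensor_lift K A B C (mult (cocycle_twist K H F C)) t = mult_map K A B C (tensor_act K H A B F' t)"
  proof (rule AB.MN.tensor_map_unique[OF _ _ _ t])
    show "linear_map K (tensor K A B) C (tensor_lift K A B C (mult (cocycle_twist K H F C)))"
      by (rule AB.MN.tensor_lift_linear) (simp_all add: bil)
    show "linear_map K (tensor K A B) C (\<lambda>t. mult_map K A B C (tensor_act K H A B F' t))"
      by (rule linear_map_compose[OF AB.mult_map_linear bilinear_map_right[OF AB.tensor_act_bilinear]]) simp
  qed (simp add: AB.MN.tensor_lift_pure bil AB.mult_map_act_pure C.twisted_mult)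
  then show ?thesis
    by (simp add: mult_map_def)
qed

lemma tensor_act_F_bij:
  "bij_betw (tensor_act K H A B F') (carrier (tensor K A B)) (carrier (tensor K A B))"
  by (rule bij_betwI[where g = "tensor_act K H A B F"])
    (auto simp: AB.tensor_act_mult[symmetric] F_inverse AB.tensor_act_one simp del: tensor_algebra_simps)

end

lemma (in hopf_cocycle) twisted_h_module_algebra:
  assumes "h_module_algebra K H A"
  shows "h_module_algebra K HF (cocycle_twist K H F A)"
proof -
  interpret A: twisted_module_algebra K H F A
    by (intro twisted_module_algebra.intro hopf_cocycle_axioms assms)
  interpret AA: twisted_factors K H F A A A
    by (intro twisted_factors.intro hopf_cocycle_axioms A.AA.h_module_subalgebra_pair_axioms)
  \<comment> \<open>Compatibility with the product: \<open>(\<Delta> h) F' = F' (F (\<Delta> h) F')\<close>, so moving \<open>\<Delta> h\<close> past the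
    twisting element \<open>F'\<close> turns it into the twisted coproduct of \<open>h\<close>.\<close>
  have prod: "act A h (x \<otimes>\<^bsub>A.AF\<^esub> y)
      = mult_map K A.AF A.AF A.AF (tensor_act K H A A (comult HF h) (pure_tensor K A A x y))"
    if h: "h \<in> carrier H" and xy: "x \<in> carrier A" "y \<in> carrier A" for h x y
  proof -
    have "act A h (x \<otimes>\<^bsub>A.AF\<^esub> y)
        = mult_map K A A A (tensor_act K H A A (comult H h) (tensor_act K H A A F' (pure_tensor K A A x y)))"
      using h xy by (simp add: cocycle_twist_def A.act_mult_map)
    also have "\<dots> = mult_map K A A A (tensor_act K H A A F'
        (tensor_act K H A A (comult HF h) (pure_tensor K A A x y)))"
      using h xy by (simp add: A.AA.tensor_act_mult[symmetric] comult_twist HH.tensor_mult_assoc HH_cancel)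
    also have "\<dots> = mult_map K A.AF A.AF A.AF (tensor_act K H A A (comult HF h) (pure_tensor K A A x y))"
      using h xy by (simp add: AA.mult_map_twist)
    finally show ?thesis .
  qed
  show ?thesis
    by (intro h_module_algebra.intro h_module_algebra_axioms.intro hopf_algebra_twist
        A.twisted_assoc_algebra)
      (simp_all add: prod A.MA.act_linear_right A.MA.act_linear_left A.MA.act_one A.MA.act_mult
        A.MA.act_unit)
qed

lemma (in hopf_cocycle) twisted_h_module_subalgebra:
  assumes sub: "is_h_module_subalgebra K H A C"
  shows "is_h_module_subalgebra K HF (cocycle_twist K H F A) (cocycle_twist K H F C)"
proof -
  have mods: "h_module_algebra K H A" "h_module_algebra K H C"
    using sub by (simp_all add: is_h_module_subalgebra_def)
  interpret A: twisted_module_algebra K H F A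
    by (intro twisted_module_algebra.intro hopf_cocycle_axioms mods)
  interpret C: twisted_module_algebra K H F C
    by (intro twisted_module_algebra.intro hopf_cocycle_axioms mods)
  have incl: "linear_map K A C (\<lambda>x. x)"
    using sub by (auto simp: is_h_module_subalgebra_def is_subalgebra_def linear_map_def)
  have mult: "x \<otimes>\<^bsub>A\<^esub> y = x \<otimes>\<^bsub>C\<^esub> y" if "x \<in> carrier A" "y \<in> carrier A" for x y
    using sub that by (simp add: is_h_module_subalgebra_def is_subalgebra_def)
  have act: "act C h x = act A h x" if "h \<in> carrier H" "x \<in> carrier A" for h x
    using sub that by (simp add: is_h_module_subalgebra_def)
  \<comment> \<open>The twisted products agree since the sum over \<open>F'\<close> may be taken in \<open>A\<close> or in \<open>C\<close>.\<close>
  have eq: "x \<otimes>\<^bsub>A.AF\<^esub> y = x \<otimes>\<^bsub>cocycle_twist K H F C\<^esub> y" if xy: "x \<in> carrier A" "y \<in> carrier A" for x y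
  proof -
    have xyC: "x \<in> carrier C" "y \<in> carrier C"
      using xy linear_map_closed[OF incl] by auto
    have "x \<otimes>\<^bsub>A.AF\<^esub> y = tensor_lift K H H C (\<lambda>g h. act A g x \<otimes>\<^bsub>A\<^esub> act A h y) F'"
      unfolding A.twisted_mult[OF xy]
      by (rule linear_map_tensor_lift[OF _ _ _ _ incl]; (intro A.lin_A)?; simp add: xy)
    also have "\<dots> = tensor_lift K H H C (\<lambda>g h. act C g x \<otimes>\<^bsub>C\<^esub> act C h y) F'"
      by (rule tensor_lift_cong[symmetric]; (intro C.lin_A)?; simp add: xy xyC mult act)
    finally show ?thesis
      by (simp add: C.twisted_mult xyC)
  qed
  show ?thesis
    unfolding is_h_module_subalgebra_def is_subalgebra_def
    using sub mods eq A.twisted_assoc_algebra C.twisted_assoc_algebra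
    by (auto simp: is_h_module_subalgebra_def is_subalgebra_def twisted_h_module_algebra)
qed

theorem proposition2p11:
  fixes K :: "('k, 'm) ring_scheme"
    and H :: "('k, 'h) hopf"
    and F :: "('k, 'h, 'h) tensor"
    and C A B :: "('k, 'c, 'h) hopf_module"
  assumes "field K" and "hopf_algebra K H" and "two_cocycle K H F"
    and "h_module_factorisation K H C A B"
  shows "h_module_factorisation K (hopf_twist K H F)
           (cocycle_twist K H F C) (cocycle_twist K H F A) (cocycle_twist K H F B) \<and>
         (\<forall>t\<in>carrier (tensor K B A).
           factorisation_map K (cocycle_twist K H F C) (cocycle_twist K H F A)
             (cocycle_twist K H F B) t
           = tensor_act K H A B F
               (factorisation_map K C A B
                 (tensor_act K H B A (inv\<^bsub>tensor_algebra K H H\<^esub> F) t)))"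
proof -
  interpret hopf_cocycle K H F
    by (intro hopf_cocycle.intro hopf_cocycle_axioms.intro assms)
  have sub: "is_h_module_subalgebra K H A C" "is_h_module_subalgebra K H B C"
    and m_bij: "bij_betw (mult_map K A B C) (carrier (tensor K A B)) (carrier C)"
    using assms(4) by (simp_all add: h_module_factorisation_def algebra_factorisation_def)
  have mods: "h_module_algebra K H A" "h_module_algebra K H B" "h_module_algebra K H C"
    using sub by (simp_all add: is_h_module_subalgebra_def)
  interpret AB: twisted_factors K H F A B C
    by (intro twisted_factors.intro hopf_cocycle_axioms h_module_subalgebra_pair.intro
        h_module_algebra_pair.intro h_module_subalgebra_pair_axioms.intro mods sub)
  interpret BA: twisted_factors K H F B A C
    by (intro twisted_factors.intro hopf_cocycle_axioms h_module_subalgebra_pair.intro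
        h_module_algebra_pair.intro h_module_subalgebra_pair_axioms.intro mods sub)
  let ?T = "carrier (tensor K A B)" and ?m = "mult_map K A B C"
    and ?AF = "cocycle_twist K H F A" and ?BF = "cocycle_twist K H F B" and ?CF = "cocycle_twist K H F C"
  let ?mF = "mult_map K ?AF ?BF ?CF"
  have mF: "?mF t = ?m (tensor_act K H A B F' t)" if "t \<in> ?T" for t
    by (rule AB.mult_map_twist[OF that])
  have mF_bij: "bij_betw ?mF ?T (carrier C)"
    using bij_betw_trans[OF AB.tensor_act_F_bij m_bij]
    by (rule bij_betw_cong[THEN iffD1, rotated]) (simp add: mF)
  have mF_linear: "linear_map K (tensor K A B) C ?mF"
  proof (subst linear_map_cong[OF mF])
    show "linear_map K (tensor K A B) C (\<lambda>t. ?m (tensor_act K H A B F' t))"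
      by (rule linear_map_compose[OF AB.AB.mult_map_linear
            bilinear_map_right[OF AB.AB.tensor_act_bilinear]]) simp
  qed simp_all
  have subF: "is_h_module_subalgebra K HF ?AF ?CF" "is_h_module_subalgebra K HF ?BF ?CF"
    by (intro twisted_h_module_subalgebra sub)+
  have fact: "h_module_factorisation K HF ?CF ?AF ?BF"
    unfolding h_module_factorisation_def algebra_factorisation_def
    using subF mF_bij mF_linear by (auto simp: is_h_module_subalgebra_def)
  have "factorisation_map K ?CF ?AF ?BF t
      = tensor_act K H A B F (factorisation_map K C A B (tensor_act K H B A F' t))"
    if t: "t \<in> carrier (tensor K B A)" for t
  proof -
    let ?u = "mult_map K B A C (tensor_act K H B A F' t)"
    let ?s = "inv_into ?T ?m ?u"
    have u: "?u \<in> carrier C"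
      using t by simp
    have s: "?s \<in> ?T" "?m ?s = ?u"
      using u m_bij by (auto simp: bij_betw_def inv_into_into f_inv_into_f)
    have mFs: "?mF (tensor_act K H A B F ?s) = ?u"
      using s by (simp add: mF AB.AB.tensor_act_mult[symmetric] F_inverse AB.AB.tensor_act_one
          del: tensor_algebra_simps)
    have "inv_into ?T ?mF (?mF (tensor_act K H A B F ?s)) = tensor_act K H A B F ?s"
      using s by (intro inv_into_f_f bij_betw_imp_inj_on[OF mF_bij]) simp
    then have "inv_into ?T ?mF ?u = tensor_act K H A B F ?s"
      unfolding mFs .
    then show ?thesis
      by (simp add: factorisation_map_def BA.mult_map_twist[OF t])
  qed
  with fact show ?thesis
    by blast
qed

end
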